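(* The following enumeration problems are pairwise equivalent under parsimonious reductions: (1) \textsc{Enumerate Maximal INDs}; (2) \textsc{Enumerate Maximal INDs}$_{\text{Identity}}$ (both databases over the same schema, only identity mappings between columns allowed); (3) \textsc{Enumerate Maximal Satisfying WA3NS Assignments}. Moreover, there is a parsimonious reduction from \textsc{Transversal Hypergraph} to each of these problems.
   Context: A schema is a non-empty finite set of attributes, a row over $R$ is a tuple indexed by $R$, a database is a finite set of rows. For databases $\mathfrak{r}$ over $R$ and $\mathfrak{s}$ over $S$, a pair $(X,\sigma)$ with $X\subseteq R$, $\sigma:X\to S$ injective, is an inclusion dependency (IND) if every $r\in\mathfrak{r}$ has some $s\in\mathfrak{s}$ with $r[a]=s[\sigma(a)]$ for all $a\in X$. Write $(X,\sigma)\preccurlyeq(X',\sigma')$ if $X\subseteq X'$ and $\sigma=\sigma'|_X$; an IND is maximal if it is $\preccurlyeq$-maximal among INDs. When $\mathfrak{r},\mathfrak{s}$ share schema $R$ and only identity maps are allowed, an IND is a set $X$ with $\mathfrak{r}[X]\subseteq\mathfrak{s}[X]$ and maximal means inclusion-wise maximal. A Boolean formula is antimonotone if all its literals are negative; it is 3-normalized if it is a conjunction of disjunctions of conjunctions of literals. Assignments are identified with the sets of variables set to true; a satisfying assignment is maximal if no proper superset is satisfying. A hypergraph is a non-empty finite vertex set $V$ with edges $\mathcal{H}\subseteq\mathcal{P}(V)$; $\mathrm{Tr}(\mathcal{H})$ is the set of inclusion-minimal sets $T\subseteq V$ meeting every edge. Problems: \textsc{Enumerate Maximal INDs}: given $\mathfrak{r},\mathfrak{s}$,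 list all maximal INDs. \textsc{Enumerate Maximal INDs}$_{\text{Identity}}$: given $\mathfrak{r},\mathfrak{s}$ over the same schema, list all maximal INDs with identity mapping. \textsc{Enumerate Maximal Satisfying WA3NS Assignments}: given an antimonotone 3-normalized formula, list its maximal satisfying assignments. \textsc{Transversal Hypergraph}: given $(V,\mathcal{H})$, list $\mathrm{Tr}(\mathcal{H})$. A parsimonious reduction from enumeration problem $\Pi$ to $\Pi'$ is a pair of polynomial-time computable functions $f,g$ such that for every instance $I$, $g(I,\cdot)$ is a bijection from the solution set $\Pi'(f(I))$ to $\Pi(I)$. *)

theory Defs
  imports Main
begin

type_synonym word = "bool list"

datatype move = Lm | Sm | Rm

text \<open>A Turing machine with finitely many states 0..nst-1 (0 = start, 1 = halt) and a
  finite tape alphabet 0..nsym-1 (0 = blank, 1 = bit False, 2 = bit True, others = work symbols).\<close>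
record tm =
  nst :: nat
  nsym :: nat
  trans :: "nat \<Rightarrow> nat \<Rightarrow> nat \<times> nat \<times> move"

definition wf_tm :: "tm \<Rightarrow> bool" where
  "wf_tm M \<longleftrightarrow> 2 \<le> nst M \<and> 3 \<le> nsym M \<and>
     (\<forall>q<nst M. \<forall>s<nsym M. fst (trans M q s) < nst M \<and> fst (snd (trans M q s)) < nsym M)"

type_synonym config = "nat \<times> (int \<Rightarrow> nat) \<times> int"

fun mv :: "move \<Rightarrow> int" where
  "mv Lm = -1" | "mv Sm = 0" | "mv Rm = 1"

fun step :: "tm \<Rightarrow> config \<Rightarrow> config" where
  "step M (q, t, h) =
     (if q = 1 then (q, t, h)
      else (case trans M q (t h) of (q', s', m) \<Rightarrow> (q', t(h := s'), h + mv m)))"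

definition sym_of_bit :: "bool \<Rightarrow> nat" where
  "sym_of_bit b = (if b then 2 else 1)"

definition init_config :: "word \<Rightarrow> config" where
  "init_config x = (0, \<lambda>i. if 0 \<le> i \<and> i < int (length x) then sym_of_bit (x ! nat i) else 0, 0)"

definition halts_with :: "tm \<Rightarrow> word \<Rightarrow> word \<Rightarrow> nat \<Rightarrow> bool" where
  "halts_with M x y n \<longleftrightarrow>
     (case (step M ^^ n) (init_config x) of (q, t, h) \<Rightarrow>
        q = 1 \<and> (\<forall>i<length y. t (h + int i) = sym_of_bit (y ! i)) \<and> t (h + int (length y)) = 0)"

definition poly_time_computable :: "(word \<Rightarrow> word) \<Rightarrow> bool" where
  "poly_time_computable f \<longleftrightarrow>
     (\<exists>M c k. wf_tm M \<and> (\<forall>x. \<exists>n \<le> c * (length x + 1) ^ k. halts_with M x (f x) n))"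

definition pair_word :: "word \<Rightarrow> word \<Rightarrow> word" where
  "pair_word x y = concat (map (\<lambda>b. [True, b]) x) @ [False] @ y"

record enum_problem =
  inst :: "word set"
  sols :: "word \<Rightarrow> word set"

definition parsimonious_reduction :: "enum_problem \<Rightarrow> enum_problem \<Rightarrow> bool" where
  "parsimonious_reduction P Q \<longleftrightarrow>
     (\<exists>f g. poly_time_computable f \<and> poly_time_computable g \<and>
        (\<forall>I\<in>inst P. f I \<in> inst Q \<and>
           bij_betw (\<lambda>y. g (pair_word I y)) (sols Q (f I)) (sols P I)))"

datatype tree = TNat nat | TList "tree list"

fun bin :: "nat \<Rightarrow> bool list" where
  "bin n = (if n = 0 then [] else odd n # bin (n div 2))"

definition tok0 :: word where "tok0 = [False, False, False]"
definition tok1 :: word where "tok1 = [False, False, True]"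
definition tokN :: word where "tokN = [False, True, False]"
definition tokL :: word where "tokL = [False, True, True]"
definition tokE :: word where "tokE = [True, False, False]"

definition enc_bits :: "bool list \<Rightarrow> word" where
  "enc_bits bs = concat (map (\<lambda>b. if b then tok1 else tok0) bs)"

primrec enc_tree :: "tree \<Rightarrow> word" where
  "enc_tree (TNat n) = tokN @ enc_bits (bin n) @ tokE"
| "enc_tree (TList ts) = tokL @ concat (map enc_tree ts) @ tokE"

definition tnats :: "nat list \<Rightarrow> tree" where
  "tnats xs = TList (map TNat xs)"

definition enc_natset :: "nat set \<Rightarrow> word" where
  "enc_natset A = enc_tree (tnats (sorted_list_of_set A))"

definition enc_map :: "(nat \<rightharpoonup> nat) \<Rightarrow> word" where
  "enc_map \<sigma> = enc_tree (TList (map (\<lambda>a. TList [TNat a, TNat (the (\<sigma> a))])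
                                   (sorted_list_of_set (dom \<sigma>))))"

definition mk_problem ::
  "('a \<Rightarrow> tree) \<Rightarrow> ('a \<Rightarrow> bool) \<Rightarrow> ('a \<Rightarrow> 'b set) \<Rightarrow> ('b \<Rightarrow> word) \<Rightarrow> enum_problem" where
  "mk_problem rep valid sol encs =
     \<lparr> inst = {enc_tree (rep a) | a. valid a},
       sols = (\<lambda>w. \<Union> {encs ` sol a | a. valid a \<and> enc_tree (rep a) = w}) \<rparr>"

text \<open>Attributes and values are natural numbers. A row over schema R is a partial map with
  domain R; a database is a finite set of rows.\<close>
type_synonym row = "nat \<rightharpoonup> nat"

text \<open>Concrete representation of a database: list of attributes, list of rows, each row a
  list of (attribute, value) pairs.\<close>
type_synonym db_rep = "nat list \<times> (nat \<times> nat) list list"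

definition db_tree :: "db_rep \<Rightarrow> tree" where
  "db_tree d = TList [tnats (fst d),
      TList (map (\<lambda>r. TList (map (\<lambda>(a, v). TList [TNat a, TNat v]) r)) (snd d))]"

definition db_valid :: "db_rep \<Rightarrow> bool" where
  "db_valid d \<longleftrightarrow> fst d \<noteq> [] \<and>
     (\<forall>r\<in>set (snd d). distinct (map fst r) \<and> set (map fst r) = set (fst d))"

definition db_schema :: "db_rep \<Rightarrow> nat set" where
  "db_schema d = set (fst d)"

definition db_rows :: "db_rep \<Rightarrow> row set" where
  "db_rows d = map_of ` set (snd d)"

text \<open>An IND (X, sigma) is represented by the partial map sigma with dom sigma = X.\<close>
definition is_IND :: "nat set \<Rightarrow> row set \<Rightarrow> nat set \<Rightarrow> row set \<Rightarrow> (nat \<rightharpoonup> nat) \<Rightarrow> bool" where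
  "is_IND R rr S ss \<sigma> \<longleftrightarrow> dom \<sigma> \<subseteq> R \<and> inj_on \<sigma> (dom \<sigma>) \<and> ran \<sigma> \<subseteq> S \<and>
     (\<forall>r\<in>rr. \<exists>s\<in>ss. \<forall>a\<in>dom \<sigma>. r a = s (the (\<sigma> a)))"

definition is_max_IND :: "nat set \<Rightarrow> row set \<Rightarrow> nat set \<Rightarrow> row set \<Rightarrow> (nat \<rightharpoonup> nat) \<Rightarrow> bool" where
  "is_max_IND R rr S ss \<sigma> \<longleftrightarrow> is_IND R rr S ss \<sigma> \<and>
     \<not> (\<exists>\<sigma>'. is_IND R rr S ss \<sigma>' \<and> \<sigma> \<subseteq>\<^sub>m \<sigma>' \<and> \<sigma>' \<noteq> \<sigma>)"

definition is_IND_id :: "nat set \<Rightarrow> row set \<Rightarrow> row set \<Rightarrow> nat set \<Rightarrow> bool" where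
  "is_IND_id R rr ss X \<longleftrightarrow> X \<subseteq> R \<and> (\<lambda>r. r |` X) ` rr \<subseteq> (\<lambda>s. s |` X) ` ss"

definition is_max_IND_id :: "nat set \<Rightarrow> row set \<Rightarrow> row set \<Rightarrow> nat set \<Rightarrow> bool" where
  "is_max_IND_id R rr ss X \<longleftrightarrow> is_IND_id R rr ss X \<and>
     \<not> (\<exists>Y. is_IND_id R rr ss Y \<and> X \<subset> Y)"

definition EnumMaxINDs :: enum_problem where
  "EnumMaxINDs = mk_problem
     (\<lambda>(d1, d2). TList [db_tree d1, db_tree d2])
     (\<lambda>(d1, d2). db_valid d1 \<and> db_valid d2)
     (\<lambda>(d1, d2). {\<sigma>. is_max_IND (db_schema d1) (db_rows d1) (db_schema d2) (db_rows d2) \<sigma>})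
     enc_map"

definition EnumMaxINDsIdentity :: enum_problem where
  "EnumMaxINDsIdentity = mk_problem
     (\<lambda>(d1, d2). TList [db_tree d1, db_tree d2])
     (\<lambda>(d1, d2). db_valid d1 \<and> db_valid d2 \<and> db_schema d1 = db_schema d2)
     (\<lambda>(d1, d2). {X. is_max_IND_id (db_schema d1) (db_rows d1) (db_rows d2) X})
     enc_natset"

text \<open>A formula is a conjunction (outer list) of disjunctions (middle lists) of
  conjunctions (inner lists) of negative literals (variable v stands for the literal not v).\<close>
type_synonym wa3ns = "nat list list list"

definition wa3ns_vars :: "wa3ns \<Rightarrow> nat set" where
  "wa3ns_vars \<phi> = (\<Union>c\<in>set \<phi>. \<Union>k\<in>set c. set k)"

definition wa3ns_sat :: "wa3ns \<Rightarrow> nat set \<Rightarrow> bool" where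
  "wa3ns_sat \<phi> A \<longleftrightarrow> (\<forall>c\<in>set \<phi>. \<exists>k\<in>set c. \<forall>v\<in>set k. v \<notin> A)"

definition wa3ns_max_sat :: "wa3ns \<Rightarrow> nat set \<Rightarrow> bool" where
  "wa3ns_max_sat \<phi> A \<longleftrightarrow> A \<subseteq> wa3ns_vars \<phi> \<and> wa3ns_sat \<phi> A \<and>
     \<not> (\<exists>B. B \<subseteq> wa3ns_vars \<phi> \<and> wa3ns_sat \<phi> B \<and> A \<subset> B)"

definition wa3ns_tree :: "wa3ns \<Rightarrow> tree" where
  "wa3ns_tree \<phi> = TList (map (\<lambda>c. TList (map tnats c)) \<phi>)"

definition EnumMaxSatWA3NS :: enum_problem where
  "EnumMaxSatWA3NS = mk_problem wa3ns_tree (\<lambda>_. True) (\<lambda>\<phi>. {A. wa3ns_max_sat \<phi> A}) enc_natset"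

definition Tr :: "nat set \<Rightarrow> nat set set \<Rightarrow> nat set set" where
  "Tr V H = {T. T \<subseteq> V \<and> (\<forall>E\<in>H. T \<inter> E \<noteq> {}) \<and>
              \<not> (\<exists>T'. T' \<subset> T \<and> (\<forall>E\<in>H. T' \<inter> E \<noteq> {}))}"

type_synonym hyp_rep = "nat list \<times> nat list list"

definition hyp_tree :: "hyp_rep \<Rightarrow> tree" where
  "hyp_tree h = TList [tnats (fst h), TList (map tnats (snd h))]"

definition hyp_valid :: "hyp_rep \<Rightarrow> bool" where
  "hyp_valid h \<longleftrightarrow> fst h \<noteq> [] \<and> (\<forall>e\<in>set (snd h). set e \<subseteq> set (fst h))"

definition TransversalHypergraph :: enum_problem where
  "TransversalHypergraph = mk_problem hyp_tree hyp_valid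
     (\<lambda>h. Tr (set (fst h)) (set ` set (snd h))) enc_natset"

end

theory Submission
  imports Defs
begin

text \<open>
  Three reductions form a cycle and a fourth one enters it; since polynomial-time computable functions
  compose, everything else follows by transitivity.

  An inclusion dependency \<open>\<sigma>\<close> is a set of variables \<open>x\<^bsub>a,b\<^esub>\<close> (\<open>\<sigma> a = b\<close>); the formula forbids two
  variables that contradict functionality or injectivity and says that every row \<open>r\<close> has a row \<open>s\<close>
  such that \<open>x\<^bsub>a,b\<^esub>\<close> is false whenever \<open>r[a] \<noteq> s[b]\<close>.  A 3-normalized formula becomes an instance with
  identity maps: the variables are attributes, a clause \<open>c\<close> is a row on the left with constant value \<open>c\<close>, and a
  disjunct \<open>k\<close> of \<open>c\<close> is a row on the right that has the value \<open>c\<close> outside of \<open>k\<close>; a dummy attribute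
  forces rows to be matched within the same clause.  Tagging every value with its attribute makes
  the identity the only possible map.  Minimal transversals are the complements of the maximal
  sets that contain no edge.

  Polynomial time is obtained from a language of programs over finitely many stacks, each stack being
  a track of the tape.  Functions on structured data that such programs compute in polynomial
  time are closed under composition, pairing, case distinction and those folds whose intermediate
  results have polynomial size, and the reductions are written with these.
\<close>

section \<open>Stack programs\<close>

text \<open>The obstacle is that \<open>poly_time_computable\<close> asks for an actual one-tape
  machine, while the constructions work on nested lists. Two codes are therefore in play:
  \<open>enc_tree\<close>, fixed by the problems, and \<open>enc\<close>, chosen so that pairing,
  \<open>Cons\<close> and case analysis are cheap on stacks. Decoders from the former to the latter
  only have to be right on genuine encodings. Iterating a polynomial-time step can produce
  exponentially long results, so there is no general recursion: each loop is a fold with a size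
  bound for all intermediate results, mostly because a step adds an amount that does not depend on
  the accumulator. Solutions are words in which sets and maps are listed in increasing order, so the
  back translation has to produce sorted lists. The bijections are restrictions of order
  isomorphisms between all feasible solutions (with the dummy attribute: those that contain it),
  which carry maximal elements to maximal elements. Degenerate inputs shape the details: empty
  disjunctions, a left database without rows, and vertices or attribute pairs that would otherwise
  occur in no clause.\<close>

type_synonym store = "nat \<Rightarrow> word"

text \<open>There is no separate pop: \<open>Cond\<close> and \<open>Loop\<close> remove the top
  symbol of the stack that they test. The branches are ordered as empty, \<open>False\<close>,
  \<open>True\<close>; a loop ends when its stack is empty.\<close>

datatype com =
    Skip
  | Push nat bool
  | Seq com com
  | Cond nat com com com
  | Loop nat com com

text \<open>The counts are exactly the numbers of instructions run by the compiled code: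
  \<open>Cond\<close> adds its \<open>IPop\<close> and a closing \<open>IJmp\<close>, a round of
  \<open>Loop\<close> its \<open>IPop\<close> and the jump back, and leaving a loop only the
  \<open>IPop\<close>.\<close>

inductive exec :: "com \<Rightarrow> store \<Rightarrow> nat \<Rightarrow> store \<Rightarrow> bool" where
  Skip: "exec Skip s 0 s"
| Push: "exec (Push i b) s 1 (s(i := b # s i))"
| Seq: "exec c s m t \<Longrightarrow> exec d t n u \<Longrightarrow> exec (Seq c d) s (m + n) u"
| Cond_Nil: "s i = [] \<Longrightarrow> exec c s n t \<Longrightarrow> exec (Cond i c d e) s (Suc (Suc n)) t"
| Cond_Cons: "s i = b # w \<Longrightarrow> exec (if b then e else d) (s(i := w)) n t
    \<Longrightarrow> exec (Cond i c d e) s (Suc (Suc n)) t"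
| Loop_Nil: "s i = [] \<Longrightarrow> exec (Loop i d e) s 1 s"
| Loop_Cons: "s i = b # w \<Longrightarrow> exec (if b then e else d) (s(i := w)) m t
    \<Longrightarrow> exec (Loop i d e) t n u \<Longrightarrow> exec (Loop i d e) s (Suc (Suc (m + n))) u"

primrec uses :: "com \<Rightarrow> nat set" where
  "uses Skip = {}"
| "uses (Push i b) = {i}"
| "uses (Seq c d) = uses c \<union> uses d"
| "uses (Cond i c d e) = {i} \<union> uses c \<union> uses d \<union> uses e"
| "uses (Loop i d e) = {i} \<union> uses d \<union> uses e"

lemma finite_uses: "finite (uses c)"
  by (induction c) auto

text \<open>A step pushes at most one symbol, so every time bound is also a bound on the size of the
  result.\<close>

lemma exec_length: "exec c s n t \<Longrightarrow> length (t i) \<le> length (s i) + n"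
  by (induction rule: exec.induct) (auto split: if_splits)

datatype instr = IPush nat bool | IPop nat nat nat nat | IJmp nat

fun instr_uses :: "instr \<Rightarrow> nat set" where
  "instr_uses (IPush i b) = {i}"
| "instr_uses (IPop i a b c) = {i}"
| "instr_uses (IJmp a) = {}"

fun instr_targets :: "instr \<Rightarrow> nat set" where
  "instr_targets (IPush i b) = {}"
| "instr_targets (IPop i a b c) = {a, b, c}"
| "instr_targets (IJmp a) = {a}"

fun istep1 :: "instr \<Rightarrow> nat \<times> store \<Rightarrow> nat \<times> store" where
  "istep1 (IPush i b) (a, s) = (Suc a, s(i := b # s i))"
| "istep1 (IPop i l0 l1 l2) (a, s) =
    (case s i of [] \<Rightarrow> (l0, s) | b # w \<Rightarrow> (if b then l2 else l1, s(i := w)))"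
| "istep1 (IJmp l) (a, s) = (l, s)"

text \<open>Outside the program a jump to itself makes the exit address a fixed point of
  \<open>istep\<close>.\<close>

definition instr_at :: "instr list \<Rightarrow> nat \<Rightarrow> instr" where
  "instr_at P a = (if a < length P then P ! a else IJmp a)"

definition istep :: "instr list \<Rightarrow> nat \<times> store \<Rightarrow> nat \<times> store" where
  "istep P c = istep1 (instr_at P (fst c)) c"

lemma istep_Pair: "istep P (a, s) = istep1 (instr_at P a) (a, s)"
  by (simp add: istep_def)

primrec csize :: "com \<Rightarrow> nat" where
  "csize Skip = 0"
| "csize (Push i b) = 1"
| "csize (Seq c d) = csize c + csize d"
| "csize (Cond i c d e) = csize c + csize d + csize e + 4"
| "csize (Loop i d e) = csize d + csize e + 3"

text \<open>Addresses are absolute and \<open>a\<close> is where the code is placed. The offsets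
  count the leading \<open>IPop\<close> and one \<open>IJmp\<close> after each preceding
  block.\<close>

primrec compile :: "com \<Rightarrow> nat \<Rightarrow> instr list" where
  "compile Skip a = []"
| "compile (Push i b) a = [IPush i b]"
| "compile (Seq c d) a = compile c a @ compile d (a + csize c)"
| "compile (Cond i c d e) a =
    (let z = a + csize c + csize d + csize e + 4 in
     IPop i (a + 1) (a + csize c + 2) (a + csize c + csize d + 3) #
       (compile c (a + 1) @ [IJmp z]) @ (compile d (a + csize c + 2) @ [IJmp z]) @
       (compile e (a + csize c + csize d + 3) @ [IJmp z]))"
| "compile (Loop i d e) a =
     IPop i (a + csize d + csize e + 3) (a + 1) (a + csize d + 2) #
       (compile d (a + 1) @ [IJmp a]) @ (compile e (a + csize d + 2) @ [IJmp a])"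

lemma length_compile [simp]: "length (compile c a) = csize c"
  by (induction c arbitrary: a) (auto simp: Let_def)

lemma compile_uses: "x \<in> set (compile c a) \<Longrightarrow> instr_uses x \<subseteq> uses c"
  by (induction c arbitrary: a) (auto simp: Let_def)

text \<open>The inequality is not strict because the address just behind the code is the regular
  exit.\<close>

lemma compile_targets: "x \<in> set (compile c a) \<Longrightarrow> l \<in> instr_targets x \<Longrightarrow> l \<le> a + csize c"
  by (induction c arbitrary: a) (fastforce simp: Let_def)+

definition code_at :: "instr list \<Rightarrow> nat \<Rightarrow> instr list \<Rightarrow> bool" where
  "code_at P a xs \<longleftrightarrow> (\<exists>us vs. P = us @ xs @ vs \<and> length us = a)"

lemma code_at_append:
  "code_at P a (xs @ ys) \<longleftrightarrow> code_at P a xs \<and> code_at P (a + length xs) ys"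
proof
  assume "code_at P a (xs @ ys)"
  then obtain us vs where "P = us @ (xs @ ys) @ vs" "length us = a"
    by (auto simp: code_at_def)
  then have "P = us @ xs @ (ys @ vs)" "P = (us @ xs) @ ys @ vs" "length us = a" "length (us @ xs) = a + length xs"
    by auto
  then show "code_at P a xs \<and> code_at P (a + length xs) ys"
    unfolding code_at_def by blast
next
  assume "code_at P a xs \<and> code_at P (a + length xs) ys"
  then obtain us vs us' vs' where *: "P = us @ xs @ vs" "length us = a"
      "P = us' @ ys @ vs'" "length us' = a + length xs"
    unfolding code_at_def by blast
  then have "(us @ xs) @ vs = us' @ (ys @ vs')" "length (us @ xs) = length us'"
    by (metis append.assoc, simp)
  then have "us' = us @ xs" by (metis append_eq_append_conv)
  then show "code_at P a (xs @ ys)" using * unfolding code_at_def by auto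
qed

lemma code_at_Cons:
  "code_at P a (x # xs) \<longleftrightarrow> code_at P a [x] \<and> code_at P (Suc a) xs"
  using code_at_append[of P a "[x]" xs] by simp

lemma code_at_nth: "code_at P a [x] \<Longrightarrow> instr_at P a = x"
  by (auto simp: code_at_def instr_at_def nth_append)

lemma funpow_Suc2: "(f ^^ Suc (Suc n)) x = f ((f ^^ n) (f x))"
  by (simp add: funpow_swap1)

lemma exec_compile:
  assumes "exec c s n t" "code_at P a (compile c a)"
  shows "(istep P ^^ n) (a, s) = (a + csize c, t)"
  using assms
proof (induction arbitrary: a rule: exec.induct)
  case (Seq c s m t d n u)
  then show ?case
    by (simp add: code_at_append add.commute[of m n] funpow_add add.assoc)
next
  case (Cond_Nil s i c n t d e)
  from Cond_Nil.prems have *: "instr_at P a = IPop i (a + 1) (a + csize c + 2) (a + csize c + csize d + 3)"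
    "code_at P (Suc a) (compile c (Suc a))"
    "instr_at P (Suc a + csize c) = IJmp (a + csize c + csize d + csize e + 4)"
    by (auto simp: Let_def code_at_Cons[of _ _ _ "compile _ _ @ _"] code_at_append code_at_Cons[of _ _ _ "compile _ _"]
      simp del: append.simps dest!: code_at_nth)
  show ?case using Cond_Nil.IH[OF *(2)] * Cond_Nil.hyps(1) unfolding funpow_Suc2
    by (simp add: istep_Pair)
next
  case (Cond_Cons s i b w e d n t c)
  from Cond_Cons.prems have *: "instr_at P a = IPop i (a + 1) (a + csize c + 2) (a + csize c + csize d + 3)"
    "code_at P (a + csize c + 2) (compile d (a + csize c + 2))"
    "code_at P (a + csize c + csize d + 3) (compile e (a + csize c + csize d + 3))"
    "instr_at P (a + csize c + 2 + csize d) = IJmp (a + csize c + csize d + csize e + 4)"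
    "instr_at P (a + csize c + csize d + 3 + csize e) = IJmp (a + csize c + csize d + csize e + 4)"
    by (auto simp: Let_def code_at_Cons[of _ _ _ "compile _ _ @ _"] code_at_append code_at_Cons[of _ _ _ "compile _ _"]
      eval_nat_numeral dest!: code_at_nth)
  let ?l = "if b then a + csize c + csize d + 3 else a + csize c + 2"
  have "code_at P ?l (compile (if b then e else d) ?l)" using * by auto
  from Cond_Cons.IH[OF this] show ?case using * Cond_Cons.hyps(1) unfolding funpow_Suc2
    by (cases b) (simp_all add: istep_Pair fun_upd_def)
next
  case (Loop_Nil s i d e)
  then have "instr_at P a = IPop i (a + csize d + csize e + 3) (a + 1) (a + csize d + 2)"
    by (auto simp: code_at_Cons[of _ _ _ "compile _ _ @ _"] dest!: code_at_nth)
  with Loop_Nil show ?case by (simp add: istep_Pair)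
next
  case (Loop_Cons s i b w e d m t n u)
  from Loop_Cons.prems have *: "instr_at P a = IPop i (a + csize d + csize e + 3) (a + 1) (a + csize d + 2)"
    "code_at P (Suc a) (compile d (Suc a))"
    "code_at P (a + csize d + 2) (compile e (a + csize d + 2))"
    "instr_at P (Suc a + csize d) = IJmp a"
    "instr_at P (a + csize d + 2 + csize e) = IJmp a"
    by (auto simp: code_at_Cons[of _ _ _ "compile _ _ @ _"] code_at_append code_at_Cons[of _ _ _ "compile _ _"]
      eval_nat_numeral dest!: code_at_nth)
  let ?l = "if b then a + csize d + 2 else Suc a"
  have "code_at P ?l (compile (if b then e else d) ?l)" using * by auto
  from Loop_Cons.IH(1)[OF this]
  have "(istep P ^^ Suc (Suc m)) (a, s) = (a, t)" using * Loop_Cons.hyps(1) unfolding funpow_Suc2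
    by (cases b) (simp_all add: istep_Pair fun_upd_def)
  \<comment> \<open>\<open>funpow_add\<close> applies the right summand first, so the first round
    has to stand on the right.\<close>
  moreover have "Suc (Suc (m + n)) = n + Suc (Suc m)" by simp
  ultimately show ?case using Loop_Cons.IH(2)[OF Loop_Cons.prems]
    by (simp only: funpow_add o_apply)
qed (auto simp: istep_Pair dest!: code_at_nth)

section \<open>Simulation of stack programs by Turing machines\<close>

text \<open>A tape symbol below \<open>3 ^ k\<close> is read as \<open>k\<close> tracks in base 3; a
  digit is \<open>0\<close> for a free cell and \<open>1\<close> or \<open>2\<close> for a
  bit.\<close>

definition digit :: "nat \<Rightarrow> nat \<Rightarrow> nat" where
  "digit i s = s div 3 ^ i mod 3"

definition undigits :: "nat \<Rightarrow> (nat \<Rightarrow> nat) \<Rightarrow> nat" where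
  "undigits k d = (\<Sum>i<k. d i * 3 ^ i)"

lemma undigits_less: "(\<And>i. i < k \<Longrightarrow> d i < 3) \<Longrightarrow> undigits k d < 3 ^ k"
proof (induction k)
  case (Suc k)
  have "d k * 3 ^ k \<le> 2 * 3 ^ k" using Suc.prems[of k] by (intro mult_right_mono) auto
  moreover have "undigits k d < 3 ^ k" using Suc by auto
  moreover have "undigits (Suc k) d = undigits k d + d k * 3 ^ k" by (simp add: undigits_def)
  ultimately show ?case unfolding power_Suc by linarith
qed (simp add: undigits_def)

lemma digit_undigits: "(\<And>i. i < k \<Longrightarrow> d i < 3) \<Longrightarrow> j < k \<Longrightarrow> digit j (undigits k d) = d j"
proof (induction k arbitrary: j)
  case (Suc k)
  have less: "undigits k d < 3 ^ k" using Suc by (intro undigits_less) auto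
  show ?case
  proof (cases "j = k")
    case True
    then show ?thesis using less Suc.prems(1)[of k] by (simp add: digit_def undigits_def)
  next
    case False
    then have "j < k" using Suc by auto
    then obtain e where e: "k = j + Suc e" using less_imp_Suc_add by fastforce
    then have "undigits (Suc k) d = undigits k d + 3 * (d k * 3 ^ e) * 3 ^ j"
      by (simp add: undigits_def power_add)
    then have "undigits (Suc k) d div 3 ^ j = undigits k d div 3 ^ j + 3 * (d k * 3 ^ e)"
      by simp
    then show ?thesis using Suc.IH[OF Suc.prems(1) \<open>j < k\<close>] by (simp add: digit_def)
  qed
qed simp

lemma undigits_cong: "(\<And>i. i < k \<Longrightarrow> d i = e i) \<Longrightarrow> undigits k d = undigits k e"
  by (simp add: undigits_def)

definition set_digit :: "nat \<Rightarrow> nat \<Rightarrow> nat \<Rightarrow> nat \<Rightarrow> nat" where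
  "set_digit k i v s = undigits k ((\<lambda>j. digit j s)(i := v))"

lemma set_digit_less: "v < 3 \<Longrightarrow> set_digit k i v s < 3 ^ k"
  unfolding set_digit_def by (intro undigits_less) (auto simp: digit_def)

lemma set_digit_undigits:
  "(\<And>i. i < k \<Longrightarrow> d i < 3) \<Longrightarrow> set_digit k i v (undigits k d) = undigits k (d(i := v))"
  unfolding set_digit_def by (intro undigits_cong) (auto simp: digit_undigits)

definition cell :: "word \<Rightarrow> nat \<Rightarrow> nat" where
  "cell w j = (if j < length w then sym_of_bit (rev w ! j) else 0)"

lemma cell_less [simp]: "cell w j < 3"
  by (simp add: cell_def sym_of_bit_def)

lemma cell_Cons: "cell (b # w) j = (if j = length w then sym_of_bit b else cell w j)"
  by (auto simp: cell_def nth_append)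

text \<open>Track \<open>i\<close> of cell \<open>j\<close> holds the \<open>j\<close>-th entry of stack \<open>i\<close>, counted from the bottom, so a
  word on track 0 is written exactly as the input and the output of the machine are.
  The symbol \<open>3 ^ k\<close> marks the cell left of all stacks.\<close>

definition tape_of :: "nat \<Rightarrow> store \<Rightarrow> int \<Rightarrow> nat" where
  "tape_of k s j = (if j < -1 then 0 else if j = -1 then 3 ^ k else undigits k (\<lambda>i. cell (s i) (nat j)))"

text \<open>Stacks are stored bottom first, so a push or a pop changes the single cell
  \<open>p\<close> at the top and shifts nothing.\<close>

lemma tape_of_upd:
  assumes "\<And>j. j \<noteq> p \<Longrightarrow> cell w j = cell (s i) j"
  shows "tape_of k (s(i := w)) = (tape_of k s)(int p := undigits k ((\<lambda>i. cell (s i) p)(i := cell w p)))"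
proof
  fix j
  show "tape_of k (s(i := w)) j = ((tape_of k s)(int p := undigits k ((\<lambda>i. cell (s i) p)(i := cell w p)))) j"
  proof (cases "j = int p")
    case False
    then show ?thesis using assms[of "nat j"]
      by (auto simp: tape_of_def intro!: undigits_cong)
  qed (auto simp: tape_of_def intro!: undigits_cong)
qed

lemma tape_of_less_marker: "j \<noteq> -1 \<Longrightarrow> tape_of k s j < 3 ^ k"
  by (auto simp: tape_of_def intro: undigits_less)

text \<open>State \<open>4 * (a + 1) + ph\<close> serves the instruction at address
  \<open>a\<close>. In phase 0 the head is on the marker, phase 1 runs right to the first free cell
  of the track, phase 2 stands one cell to the left of it in order to pop, and phase 3 runs back to
  the marker before phase 0 of \<open>a\<close>. Meeting the marker in phase 2 means that the stack
  is empty. States 0 and 2 write the marker. An address behind the program halts with a move to the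
  right, onto cell 0 where the output begins.\<close>

definition tm_trans :: "nat \<Rightarrow> instr list \<Rightarrow> nat \<Rightarrow> nat \<Rightarrow> nat \<times> nat \<times> move" where
  "tm_trans k P q s =
    (if q = 0 then (2, s, Lm)
     else if q = 2 then (4, 3 ^ k, Sm)
     else if q < 4 then (1, s, Sm)
     else let a = q div 4 - 1; ph = q mod 4 in
       if ph = 3 then (if s = 3 ^ k then (4 * a + 4, s, Sm) else (q, s, Lm))
       else if a \<ge> length P then (1, s, Rm)
       else case P ! a of
         IJmp l \<Rightarrow> (4 * l + 4, s, Sm)
       | IPush i b \<Rightarrow>
           if ph = 0 then (4 * a + 5, s, Rm)
           else if digit i s = 0 then (4 * Suc a + 7, set_digit k i (sym_of_bit b) s, Lm)
           else (4 * a + 5, s, Rm)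
       | IPop i l0 l1 l2 \<Rightarrow>
           if ph = 0 then (4 * a + 5, s, Rm)
           else if ph = 1 then (if digit i s = 0 then (4 * a + 6, s, Lm) else (4 * a + 5, s, Rm))
           else if s = 3 ^ k then (4 * l0 + 4, s, Sm)
           else (4 * (if digit i s = 2 then l2 else l1) + 7, set_digit k i 0 s, Lm))"

text \<open>The states go up to phase 3 of the exit address \<open>length P\<close>. The symbols are
  the \<open>3 ^ k\<close> track contents and the marker; the surplus guarantees three symbols even
  for \<open>k = 0\<close>.\<close>

definition the_tm :: "nat \<Rightarrow> instr list \<Rightarrow> tm" where
  "the_tm k P = \<lparr> nst = 4 * length P + 8, nsym = 3 ^ k + 3, trans = tm_trans k P \<rparr>"

lemma sym_of_bit_less [simp]: "sym_of_bit b < 3"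
  by (simp add: sym_of_bit_def)

lemma wf_the_tm:
  assumes "\<And>x l. x \<in> set P \<Longrightarrow> l \<in> instr_targets x \<Longrightarrow> l \<le> length P"
  shows "wf_tm (the_tm k P)"
proof -
  have "fst (tm_trans k P q s) < 4 * length P + 8 \<and> fst (snd (tm_trans k P q s)) < 3 ^ k + 3"
    if q: "q < 4 * length P + 8" and s: "s < 3 ^ k + 3" for q s
  proof -
    define a where "a = q div 4 - Suc 0"
    have sd: "set_digit k i v s < 3 ^ k + 3" if "v < 3" for i v
      using set_digit_less[OF that, of k i s] by linarith
    have a: "a \<le> length P" using q by (simp add: a_def)
    show ?thesis
    proof (cases "q < 4 \<or> q mod 4 = 3 \<or> a \<ge> length P")
      case True
      then show ?thesis using q s a by (auto simp: tm_trans_def a_def[symmetric] Let_def)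
    next
      case False
      then have t: "\<forall>l\<in>instr_targets (P ! a). l \<le> length P"
        using assms[of "P ! a"] by auto
      show ?thesis
        using False q s sd sym_of_bit_less
        by (cases "P ! a") (use t in \<open>auto simp: tm_trans_def a_def[symmetric] Let_def\<close>)
    qed
  qed
  then show ?thesis by (simp add: wf_tm_def the_tm_def)
qed

lemma scan_right:
  assumes "\<And>j. j < n \<Longrightarrow> \<exists>m. trans M q (t (h + int j)) = (q, t (h + int j), Rm)" "q \<noteq> 1"
  shows "(step M ^^ n) (q, t, h) = (q, t, h + int n)"
  using assms
proof (induction n)
  case (Suc n)
  then have "trans M q (t (h + int n)) = (q, t (h + int n), Rm)" by auto
  with Suc show ?case by (auto simp: algebra_simps)
qed simp

lemma scan_left:
  assumes "\<And>j. j < n \<Longrightarrow> \<exists>m. trans M q (t (h - int j)) = (q, t (h - int j), Lm)" "q \<noteq> 1"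
  shows "(step M ^^ n) (q, t, h) = (q, t, h - int n)"
  using assms
proof (induction n)
  case (Suc n)
  then have "trans M q (t (h - int n)) = (q, t (h - int n), Lm)" by auto
  with Suc show ?case by (auto simp: algebra_simps)
qed simp

lemma funpow_trans: "(f ^^ m) x = y \<Longrightarrow> (f ^^ n) y = z \<Longrightarrow> (f ^^ (m + n)) x = z"
  by (simp add: funpow_add add.commute[of m n])

text \<open>It takes \<open>h + 1\<close> moves to reach the marker and one more step to change the
  phase. The case \<open>h = -1\<close> occurs after a push onto an empty stack.\<close>

lemma return_home:
  assumes "h \<ge> -1"
  shows "(step (the_tm k P) ^^ nat (h + 2)) (4 * a + 7, tape_of k s, h) = (4 * a + 4, tape_of k s, -1)"
proof -
  have d: "(4 * a + 7) div 4 = Suc a" "(4 * a + 7) mod 4 = 3" by presburger+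
  have "(step (the_tm k P) ^^ nat (h + 1)) (4 * a + 7, tape_of k s, h) = (4 * a + 7, tape_of k s, h - int (nat (h + 1)))"
  proof (rule scan_left)
    fix j assume "j < nat (h + 1)"
    then have "h - int j \<noteq> -1" by linarith
    then have "tape_of k s (h - int j) \<noteq> 3 ^ k" using tape_of_less_marker[of "h - int j" k s] by auto
    then show "\<exists>m. trans (the_tm k P) (4 * a + 7) (tape_of k s (h - int j)) = (4 * a + 7, tape_of k s (h - int j), Lm)"
      by (simp add: the_tm_def tm_trans_def Let_def d)
  qed simp
  moreover have "(step (the_tm k P) ^^ 1) (4 * a + 7, tape_of k s, -1) = (4 * a + 4, tape_of k s, -1)"
    by (auto simp: the_tm_def tm_trans_def Let_def d tape_of_def)
  moreover have "h - int (nat (h + 1)) = -1" using assms by simp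
  ultimately have "(step (the_tm k P) ^^ (nat (h + 1) + 1)) (4 * a + 7, tape_of k s, h) = (4 * a + 4, tape_of k s, -1)"
    by (metis funpow_trans)
  moreover have "nat (h + 1) + 1 = nat (h + 2)" using assms by auto
  ultimately show ?thesis by (simp only:)
qed

lemma digit_tape_of: "i < k \<Longrightarrow> digit i (tape_of k s (int j)) = cell (s i) j"
  by (simp add: tape_of_def digit_undigits)

lemma set_digit_tape_of:
  "set_digit k i v (tape_of k s (int j)) = undigits k ((\<lambda>i. cell (s i) j)(i := v))"
  by (simp add: tape_of_def set_digit_undigits)

lemma scan_stack:
  assumes "a < length P" "P ! a = IPush i b \<or> P ! a = IPop i l0 l1 l2" "i < k"
  shows "(step (the_tm k P) ^^ Suc (length (s i))) (4 * a + 4, tape_of k s, -1)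
    = (4 * a + 5, tape_of k s, int (length (s i)))"
proof -
  have d: "(4 * a + 5) div 4 = Suc a" "(4 * a + 5) mod 4 = 1" by presburger+
  have 1: "(step (the_tm k P) ^^ 1) (4 * a + 4, tape_of k s, -1) = (4 * a + 5, tape_of k s, 0)"
    using assms by (auto simp: the_tm_def tm_trans_def Let_def)
  have 2: "(step (the_tm k P) ^^ length (s i)) (4 * a + 5, tape_of k s, 0) = (4 * a + 5, tape_of k s, 0 + int (length (s i)))"
  proof (rule scan_right)
    fix j assume "j < length (s i)"
    then have "digit i (tape_of k s (int j)) \<noteq> 0"
      using assms by (simp add: digit_tape_of cell_def sym_of_bit_def)
    then show "\<exists>m. trans (the_tm k P) (4 * a + 5) (tape_of k s (0 + int j)) = (4 * a + 5, tape_of k s (0 + int j), Rm)"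
      using assms d by (auto simp: the_tm_def tm_trans_def Let_def)
  qed simp
  show ?thesis using funpow_trans[OF 1 2] by simp
qed

text \<open>An instruction costs one trip from the marker to the top of a stack and back; the
  constant 5 generously covers the turns and changes of phase.\<close>

lemma tm_simulates_istep:
  assumes a: "a < length P" and k: "\<And>x. x \<in> set P \<Longrightarrow> instr_uses x \<subseteq> {..<k}"
    and L: "\<And>i. length (s i) \<le> L" and i: "istep P (a, s) = (a', s')"
  shows "\<exists>m \<le> 2 * L + 5. (step (the_tm k P) ^^ m) (4 * a + 4, tape_of k s, -1) = (4 * a' + 4, tape_of k s', -1)"
proof -
  have d: "(4 * a + 5) div 4 = Suc a" "(4 * a + 5) mod 4 = 1"
     "(4 * a + 6) div 4 = Suc a" "(4 * a + 6) mod 4 = 2" by presburger+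
  have u: "instr_uses (P ! a) \<subseteq> {..<k}" using a k by auto
  show ?thesis
  proof (cases "P ! a")
    case (IJmp l)
    then have "(step (the_tm k P) ^^ 1) (4 * a + 4, tape_of k s, -1) = (4 * a' + 4, tape_of k s', -1)"
      using a i by (auto simp: the_tm_def tm_trans_def Let_def istep_Pair instr_at_def)
    then show ?thesis by (intro exI[of _ 1]) auto
  next
    case (IPush j b)
    let ?l = "length (s j)"
    have j: "j < k" using u IPush by auto
    have s': "a' = Suc a" "s' = s(j := b # s j)" using i a IPush by (auto simp: istep_Pair instr_at_def)
    have 1: "(step (the_tm k P) ^^ Suc ?l) (4 * a + 4, tape_of k s, -1) = (4 * a + 5, tape_of k s, int ?l)"
      using scan_stack a IPush j by metis
    have "digit j (tape_of k s (int ?l)) = 0" by (simp add: digit_tape_of j cell_def)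
    moreover have "tape_of k s' = (tape_of k s)(int ?l := undigits k ((\<lambda>i. cell (s i) ?l)(j := cell (b # s j) ?l)))"
      unfolding s' by (rule tape_of_upd) (auto simp: cell_Cons)
    ultimately have 2: "(step (the_tm k P) ^^ 1) (4 * a + 5, tape_of k s, int ?l) = (4 * a' + 7, tape_of k s', int ?l - 1)"
      using a IPush d s'(1) by (auto simp: the_tm_def tm_trans_def Let_def set_digit_tape_of cell_Cons)
    from return_home[of "int ?l - 1" k P a' s']
    have 3: "(step (the_tm k P) ^^ Suc ?l) (4 * a' + 7, tape_of k s', int ?l - 1) = (4 * a' + 4, tape_of k s', -1)"
      by (simp add: nat_add_distrib)
    show ?thesis using funpow_trans[OF funpow_trans[OF 1 2] 3] L[of j]
      by (intro exI[of _ "Suc ?l + 1 + Suc ?l"]) auto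
  next
    case (IPop j l0 l1 l2)
    let ?l = "length (s j)"
    have j: "j < k" using u IPop by auto
    have 1: "(step (the_tm k P) ^^ Suc ?l) (4 * a + 4, tape_of k s, -1) = (4 * a + 5, tape_of k s, int ?l)"
      using scan_stack a IPop j by metis
    have "digit j (tape_of k s (int ?l)) = 0" by (simp add: digit_tape_of j cell_def)
    then have 2: "(step (the_tm k P) ^^ 1) (4 * a + 5, tape_of k s, int ?l) = (4 * a + 6, tape_of k s, int ?l - 1)"
      using a IPop d by (auto simp: the_tm_def tm_trans_def Let_def)
    show ?thesis
    proof (cases "s j")
      case Nil
      then have s': "a' = l0" "s' = s" using i a IPop by (auto simp: istep_Pair instr_at_def)
      have 3: "(step (the_tm k P) ^^ 1) (4 * a + 6, tape_of k s, -1) = (4 * a' + 4, tape_of k s', -1)"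
        using a IPop d s' by (auto simp: the_tm_def tm_trans_def Let_def tape_of_def)
      show ?thesis using funpow_trans[OF funpow_trans[OF 1 2], of 1] 3 L[of j] Nil
        by (intro exI[of _ "Suc ?l + 1 + 1"]) auto
    next
      case (Cons b w)
      then have s': "a' = (if b then l2 else l1)" "s' = s(j := w)" using i a IPop by (auto simp: istep_Pair instr_at_def)
      have l: "int ?l - 1 = int (length w)" using Cons by simp
      have "tape_of k s (int (length w)) \<noteq> 3 ^ k"
        using tape_of_less_marker[of "int (length w)" k s] by auto
      moreover have "digit j (tape_of k s (int (length w))) = sym_of_bit b"
        by (simp add: digit_tape_of j cell_Cons Cons)
      moreover have "tape_of k s' = (tape_of k s)(int (length w) := undigits k ((\<lambda>i. cell (s i) (length w))(j := cell w (length w))))"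
        unfolding s' by (rule tape_of_upd) (auto simp: cell_Cons Cons)
      ultimately have 3: "(step (the_tm k P) ^^ 1) (4 * a + 6, tape_of k s, int ?l - 1) = (4 * a' + 7, tape_of k s', int (length w) - 1)"
        unfolding l using a IPop d s'(1) by (auto simp: the_tm_def tm_trans_def Let_def set_digit_tape_of cell_def sym_of_bit_def)
      from return_home[of "int (length w) - 1" k P a' s']
      have 4: "(step (the_tm k P) ^^ Suc (length w)) (4 * a' + 7, tape_of k s', int (length w) - 1) = (4 * a' + 4, tape_of k s', -1)"
        by (simp add: nat_add_distrib)
      show ?thesis using funpow_trans[OF funpow_trans[OF funpow_trans[OF 1 2] 3] 4] L[of j] Cons
        by (intro exI[of _ "Suc ?l + 1 + 1 + Suc (length w)"]) auto
    qed
  qed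
qed

lemma istep_length: "istep P (a, s) = (a', s') \<Longrightarrow> length (s' i) \<le> Suc (length (s i))"
  by (cases "instr_at P a") (auto simp: istep_Pair split: list.splits if_splits)

text \<open>Each instruction lengthens a stack by at most one, so \<open>L + n\<close> bounds all
  stacks during the run and the overhead is quadratic.\<close>

lemma tm_simulates_run:
  assumes k: "\<And>x. x \<in> set P \<Longrightarrow> instr_uses x \<subseteq> {..<k}" and L: "\<And>i. length (s i) \<le> L"
    and "(istep P ^^ n) (a, s) = (a', s')"
  shows "(\<exists>m \<le> n * (2 * (L + n) + 5).
      (step (the_tm k P) ^^ m) (4 * a + 4, tape_of k s, -1) = (4 * a' + 4, tape_of k s', -1)) \<and>
    (\<forall>i. length (s' i) \<le> L + n)"
  using assms(3)
proof (induction n arbitrary: a' s')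
  case 0
  then show ?case using L by auto
next
  case (Suc n)
  obtain b u where bu: "(istep P ^^ n) (a, s) = (b, u)" by (meson surj_pair)
  from Suc.IH[OF bu] obtain m where m: "m \<le> n * (2 * (L + n) + 5)"
    "(step (the_tm k P) ^^ m) (4 * a + 4, tape_of k s, -1) = (4 * b + 4, tape_of k u, -1)"
    and u: "\<And>i. length (u i) \<le> L + n" by auto
  have st: "istep P (b, u) = (a', s')" using bu Suc.prems by simp
  have "\<exists>m \<le> 2 * (L + n) + 5. (step (the_tm k P) ^^ m) (4 * b + 4, tape_of k u, -1) = (4 * a' + 4, tape_of k s', -1)"
  proof (cases "b < length P")
    case True
    then show ?thesis using tm_simulates_istep[OF True k u st] by auto
  next
    case False
    \<comment> \<open>Behind the program \<open>istep\<close> stays where it is, which costs the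
      machine no step at all.\<close>
    then show ?thesis using st by (intro exI[of _ 0]) (auto simp: istep_Pair instr_at_def)
  qed
  then obtain l where l: "l \<le> 2 * (L + n) + 5"
    "(step (the_tm k P) ^^ l) (4 * b + 4, tape_of k u, -1) = (4 * a' + 4, tape_of k s', -1)" by auto
  have "m + l \<le> n * (2 * (L + n) + 5) + (2 * (L + n) + 5)" using m l by linarith
  also have "\<dots> = Suc n * (2 * (L + n) + 5)" by simp
  also have "\<dots> \<le> Suc n * (2 * (L + Suc n) + 5)" by (intro mult_left_mono) auto
  finally have "m + l \<le> Suc n * (2 * (L + Suc n) + 5)" .
  moreover have "length (s' i) \<le> L + Suc n" for i
    using istep_length[OF st, of i] u[of i] by linarith
  ultimately show ?case using funpow_trans[OF m(2) l(2)] by blast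
qed

abbreviation single_store :: "word \<Rightarrow> store" where
  "single_store w \<equiv> (\<lambda>_. [])(0 := w)"

text \<open>Track 0 has weight 1 and the other tracks are empty, so apart from the marker the tape
  is the plain input or output and nothing has to be recoded.\<close>

lemma tape_of_single_store:
  assumes "0 < k"
  shows "tape_of k (single_store (rev x)) =
    (\<lambda>i. if 0 \<le> i \<and> i < int (length x) then sym_of_bit (x ! nat i) else 0)(-1 := 3 ^ k)"
proof
  fix j
  have "(\<Sum>i<k. cell (single_store (rev x) i) (nat j) * 3 ^ i) = (\<Sum>i<k. if i = 0 then cell (rev x) (nat j) else 0)"
    by (intro sum.cong) (auto simp: cell_def)
  also have "\<dots> = cell (rev x) (nat j)" using assms by (simp add: sum.delta)
  finally show "tape_of k (single_store (rev x)) j =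
    ((\<lambda>i. if 0 \<le> i \<and> i < int (length x) then sym_of_bit (x ! nat i) else 0)(-1 := 3 ^ k)) j"
    by (auto simp: tape_of_def undigits_def cell_def)
qed

section \<open>Polynomial bounds\<close>

definition poly_bd :: "(nat \<Rightarrow> nat) \<Rightarrow> bool" where
  "poly_bd p \<longleftrightarrow> mono p \<and> (\<exists>c d. \<forall>n. p n \<le> c * (n + 1) ^ d)"

lemma poly_bd_const: "poly_bd (\<lambda>n. c)"
proof -
  have "\<forall>n. c \<le> c * (n + 1) ^ 0" by simp
  then show ?thesis unfolding poly_bd_def mono_def by blast
qed

lemma poly_bd_id: "poly_bd (\<lambda>n. n)"
  unfolding poly_bd_def by (auto simp: mono_def intro!: exI[of _ 1] exI[of _ 1])

lemma poly_bd_add: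
  assumes "poly_bd p" "poly_bd q" shows "poly_bd (\<lambda>n. p n + q n)"
proof -
  obtain c d c' d' where *: "\<And>n. p n \<le> c * (n + 1) ^ d" "\<And>n. q n \<le> c' * (n + 1) ^ d'"
    using assms unfolding poly_bd_def by blast
  have "p n + q n \<le> (c + c') * (n + 1) ^ (d + d')" for n
  proof -
    have "c * (n + 1) ^ d \<le> c * (n + 1) ^ (d + d')" "c' * (n + 1) ^ d' \<le> c' * (n + 1) ^ (d + d')"
      by (intro mult_left_mono power_increasing; simp)+
    then show ?thesis using *[of n] unfolding add_mult_distrib by linarith
  qed
  then show ?thesis using assms unfolding poly_bd_def by (auto simp: mono_def add_mono)
qed

lemma poly_bd_mult:
  assumes "poly_bd p" "poly_bd q" shows "poly_bd (\<lambda>n. p n * q n)"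
proof -
  obtain c d c' d' where *: "\<And>n. p n \<le> c * (n + 1) ^ d" "\<And>n. q n \<le> c' * (n + 1) ^ d'"
    using assms unfolding poly_bd_def by blast
  have "p n * q n \<le> (c * c') * (n + 1) ^ (d + d')" for n
    using mult_mono[OF *[of n]] by (simp add: power_add algebra_simps)
  then show ?thesis using assms unfolding poly_bd_def by (auto simp: mono_def mult_mono)
qed

lemma poly_bd_comp:
  assumes "poly_bd p" "poly_bd q" shows "poly_bd (\<lambda>n. p (q n))"
proof -
  obtain c d c' d' where *: "\<And>n. p n \<le> c * (n + 1) ^ d" "\<And>n. q n \<le> c' * (n + 1) ^ d'"
    using assms unfolding poly_bd_def by blast
  have "p (q n) \<le> (c * (c' + 1) ^ d) * (n + 1) ^ (d' * d)" for n
  proof -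
    have "q n + 1 \<le> c' * (n + 1) ^ d' + (n + 1) ^ d'" using *(2)[of n] by (intro add_mono) auto
    then have "q n + 1 \<le> (c' + 1) * (n + 1) ^ d'" by simp
    from power_mono[OF this, of d] have "(q n + 1) ^ d \<le> (c' + 1) ^ d * (n + 1) ^ (d' * d)"
      by (simp only: power_mult_distrib power_mult)
    then have "c * (q n + 1) ^ d \<le> c * ((c' + 1) ^ d * (n + 1) ^ (d' * d))" by (intro mult_left_mono) auto
    from order_trans[OF *(1)[of "q n"] this] show ?thesis by (simp only: mult.assoc)
  qed
  then show ?thesis using assms unfolding poly_bd_def by (auto simp: mono_def)
qed

lemmas poly_bd_intros = poly_bd_const poly_bd_id poly_bd_add poly_bd_mult

text \<open>This is why monotonicity belongs to \<open>poly_bd\<close>: a bound on the length of an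
  intermediate result can be put in place of the length itself.\<close>

lemma poly_bdD: "poly_bd p \<Longrightarrow> m \<le> n \<Longrightarrow> p m \<le> p n"
  by (auto simp: poly_bd_def mono_def)

theorem exec_poly_time_computable:
  assumes p: "poly_bd p"
    and c: "\<And>x. \<exists>n \<le> p (length x). exec c (single_store (rev x)) n (single_store (rev (f x)))"
  shows "poly_time_computable f"
proof -
  define P where "P = compile c 0"
  obtain k where k: "\<And>i. i \<in> uses c \<Longrightarrow> i < k" using finite_uses[of c] unfolding finite_nat_set_iff_bounded by blast
  \<comment> \<open>The successor provides track 0 even for a program that touches no stack.\<close>
  define K where "K = Suc k"
  define M where "M = the_tm K P"
  have "uses c \<subseteq> {..<K}" using k unfolding K_def by (meson lessThan_iff less_SucI subsetI)
  then have K: "instr_uses x \<subseteq> {..<K}" if "x \<in> set P" for x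
    using compile_uses[of x c 0] that unfolding P_def by (meson subset_trans)
  have wf: "wf_tm M" unfolding M_def
  proof (rule wf_the_tm)
    fix x l assume "x \<in> set P" "l \<in> instr_targets x"
    then show "l \<le> length P" unfolding P_def using compile_targets[of x c 0 l] by simp
  qed
  \<comment> \<open>The bound of \<open>tm_simulates_run\<close>, two steps that write the marker
    and enter address 0, and one step that moves to cell 0 and halts.\<close>
  define T where "T = (\<lambda>n. p n * (2 * (n + p n) + 5) + 3)"
  have T: "poly_bd T" unfolding T_def by (intro poly_bd_intros p)
  have "\<exists>m \<le> T (length x). halts_with M x (f x) m" for x
  proof -
    obtain n where n: "n \<le> p (length x)" "exec c (single_store (rev x)) n (single_store (rev (f x)))"
      using c by blast
    have "code_at P 0 (compile c 0)" unfolding P_def code_at_def by (intro exI[of _ "[]"]) simp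
    from exec_compile[OF n(2) this] have run: "(istep P ^^ n) (0, single_store (rev x)) = (length P, single_store (rev (f x)))"
      by (simp add: P_def)
    obtain m where m: "m \<le> n * (2 * (length x + n) + 5)"
      "(step M ^^ m) (4, tape_of K (single_store (rev x)), -1) = (4 * length P + 4, tape_of K (single_store (rev (f x))), -1)"
    proof -
      have "\<And>i. length (single_store (rev x) i) \<le> length x" by simp
      from tm_simulates_run[OF K this run] show ?thesis using that unfolding M_def by auto
    qed
    let ?t = "\<lambda>i. if 0 \<le> i \<and> i < int (length x) then sym_of_bit (x ! nat i) else 0"
    have "(step M ^^ 1) (init_config x) = (2, ?t, -1)"
      by (auto simp: init_config_def M_def the_tm_def tm_trans_def)
    moreover have "(step M ^^ 1) (2, ?t, -1) = (4, tape_of K (single_store (rev x)), -1)"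
      by (simp add: M_def the_tm_def tm_trans_def tape_of_single_store K_def)
    ultimately have "(step M ^^ (1 + 1)) (init_config x) = (4, tape_of K (single_store (rev x)), -1)"
      by (rule funpow_trans)
    moreover have "(step M ^^ 1) (4 * length P + 4, tape_of K (single_store (rev (f x))), -1)
        = (1, tape_of K (single_store (rev (f x))), 0)"
      by (simp add: M_def the_tm_def tm_trans_def)
    ultimately have *: "(step M ^^ (1 + 1 + m + 1)) (init_config x) = (1, tape_of K (single_store (rev (f x))), 0)"
      using m(2) by (intro funpow_trans[OF funpow_trans])
    have "halts_with M x (f x) (1 + 1 + m + 1)"
      unfolding halts_with_def * by (simp add: tape_of_single_store K_def)
    moreover have "n * (2 * (length x + n) + 5) \<le> p (length x) * (2 * (length x + p (length x)) + 5)"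
      using n(1) by (intro mult_mono) auto
    ultimately show ?thesis using m(1) unfolding T_def by (intro exI[of _ "1 + 1 + m + 1"]) auto
  qed
  moreover obtain C D where "\<And>n. T n \<le> C * (n + 1) ^ D" using T unfolding poly_bd_def by blast
  ultimately show ?thesis unfolding poly_time_computable_def using wf by (meson order_trans)
qed

section \<open>Elementary stack programs with time bounds\<close>

notation Seq (infixr ";;" 60)

text \<open>Upper bounds instead of exact times, so that branches of different cost can share one
  bound.\<close>

definition execs :: "com \<Rightarrow> store \<Rightarrow> nat \<Rightarrow> store \<Rightarrow> bool" where
  "execs c s n t \<longleftrightarrow> (\<exists>m\<le>n. exec c s m t)"

lemma execs_weaken: "execs c s m t \<Longrightarrow> m \<le> n \<Longrightarrow> t = t' \<Longrightarrow> execs c s n t'"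
  by (auto simp: execs_def intro: order_trans)

lemma execs_Skip: "execs Skip s n s"
  by (auto simp: execs_def intro: exec.Skip)

lemma execs_Push: "execs (Push i b) s 1 (s(i := b # s i))"
  using exec.Push by (auto simp: execs_def)

lemma execs_Seq: "execs c s m t \<Longrightarrow> execs d t n u \<Longrightarrow> execs (c ;; d) s (m + n) u"
  unfolding execs_def by (meson add_mono exec.Seq)

lemma execs_Cond_Cons:
  "s i = b # w \<Longrightarrow> execs (if b then e else d) (s(i := w)) n t \<Longrightarrow> execs (Cond i c d e) s (n + 2) t"
  unfolding execs_def using exec.Cond_Cons by fastforce

lemma execs_Loop_Nil: "s i = [] \<Longrightarrow> execs (Loop i d e) s 1 s"
  unfolding execs_def using exec.Loop_Nil by blast

lemma execs_Loop_Cons: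
  assumes "s i = b # w" "execs (if b then e else d) (s(i := w)) m t" "execs (Loop i d e) t n u"
  shows "execs (Loop i d e) s (m + n + 2) u"
proof -
  obtain m' n' where "m' \<le> m" "n' \<le> n" "exec (if b then e else d) (s(i := w)) m' t" "exec (Loop i d e) t n' u"
    using assms unfolding execs_def by blast
  then show ?thesis using exec.Loop_Cons[of s i b w e d m' t n' u] assms(1)
    unfolding execs_def by (intro exI[of _ "Suc (Suc (m' + n'))"]) auto
qed

lemma execs_length: "execs c s n t \<Longrightarrow> length (t i) \<le> length (s i) + n"
  unfolding execs_def using exec_length[of c s _ t i] by fastforce

text \<open>Popping \<open>i\<close> while piling up blocks on \<open>j\<close> reverses their
  order, hence \<open>rev\<close>. The body is assumed correct in every store because each round
  starts in a different one.\<close>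

lemma execs_Loop_block:
  assumes "i \<noteq> j"
    and "\<And>b s. execs (if b then e else d) s m (s(j := f b @ s j))"
  shows "execs (Loop i d e) s (Suc ((m + 2) * length (s i)))
     (s(i := [], j := concat (map f (rev (s i))) @ s j))"
proof (induction "s i" arbitrary: s)
  case Nil
  have "s(i := [], j := concat (map f (rev (s i))) @ s j) = s" using Nil by auto
  then show ?case by (intro execs_weaken[OF execs_Loop_Nil]) (use Nil in auto)
next
  case (Cons b w)
  let ?t = "s(i := w, j := f b @ s j)"
  have 1: "execs (if b then e else d) (s(i := w)) m ?t"
    using assms(2)[of b "s(i := w)"] assms(1) by simp
  have 2: "execs (Loop i d e) ?t (Suc ((m + 2) * length w)) (s(i := [], j := concat (map f (rev (s i))) @ s j))"
    by (rule execs_weaken[OF Cons(1)]) (use assms(1) Cons(2)[symmetric] in \<open>auto simp: fun_eq_iff\<close>)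
  show ?case
    by (rule execs_weaken[OF execs_Loop_Cons[OF Cons(2)[symmetric] 1 2]]) (use Cons(2)[symmetric] in auto)
qed

definition moveto :: "nat \<Rightarrow> nat \<Rightarrow> com" where
  "moveto i j = Loop i (Push j False) (Push j True)"

lemma execs_moveto:
  assumes "i \<noteq> j"
  shows "execs (moveto i j) s (Suc (3 * length (s i))) (s(i := [], j := rev (s i) @ s j))"
proof -
  have "execs (if b then Push j True else Push j False) s 1 (s(j := [b] @ s j))" for b s
    using execs_Push[of j b s] by (cases b) auto
  from execs_Loop_block[OF assms, where f = "\<lambda>b. [b]", OF this, of s] show ?thesis
    unfolding moveto_def by (rule execs_weaken) (auto simp: algebra_simps)
qed

definition clear :: "nat \<Rightarrow> com" where
  "clear i = Loop i Skip Skip"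

lemma execs_clear: "execs (clear i) s (Suc (2 * length (s i))) (s(i := []))"
proof -
  \<comment> \<open>The block loop with empty blocks; \<open>Suc i\<close> is merely some other
    stack.\<close>
  have "execs (if b then Skip else Skip) s 0 (s(Suc i := [] @ s (Suc i)))" for b s
    using execs_Skip[of s 0] by simp
  from execs_Loop_block[of i "Suc i", where f = "\<lambda>b. []", OF _ this, of s] show ?thesis
    unfolding clear_def by (rule execs_weaken) (auto simp: algebra_simps fun_eq_iff concat_eq_Nil_conv)
qed

definition push_word :: "nat \<Rightarrow> word \<Rightarrow> com" where
  "push_word i w = foldr (\<lambda>b c. c ;; Push i b) w Skip"

lemma execs_push_word: "execs (push_word i w) s (length w) (s(i := w @ s i))"
proof (induction w)
  case Nil
  then show ?case by (simp add: push_word_def execs_Skip)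
next
  case (Cons b w)
  have *: "push_word i (b # w) = push_word i w ;; Push i b" by (simp add: push_word_def)
  show ?case unfolding *
    by (rule execs_weaken[OF execs_Seq[OF Cons execs_Push]]) (auto simp: fun_eq_iff)
qed

definition double :: "word \<Rightarrow> word" where
  "double x = concat (map (\<lambda>b. [True, b]) x)"

lemma pair_word_double: "pair_word x y = double x @ False # y"
  by (simp add: pair_word_def double_def)

lemma double_simps [simp]: "double [] = []" "double (b # x) = True # b # double x"
  by (simp_all add: double_def)

lemma length_double [simp]: "length (double x) = 2 * length x"
  by (induction x) auto

lemma pair_word_inj: "pair_word x y = pair_word x' y' \<longleftrightarrow> x = x' \<and> y = y'"
proof (induction x arbitrary: x')
  case Nil
  then show ?case by (cases x') (auto simp: pair_word_double)
next
  case (Cons b x)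
  then show ?case by (cases x') (auto simp: pair_word_double)
qed

lemma length_pair_word [simp]: "length (pair_word x y) = 2 * length x + length y + 1"
  by (simp add: pair_word_double)

text \<open>Reading is destructive, so copying a stack means moving it to two targets at
  once.\<close>

definition fork :: "nat \<Rightarrow> nat \<Rightarrow> nat \<Rightarrow> com" where
  "fork i j k = Loop i (Push j False ;; Push k False) (Push j True ;; Push k True)"

lemma execs_fork:
  assumes "i \<noteq> j" "i \<noteq> k" "j \<noteq> k"
  shows "execs (fork i j k) s (Suc (4 * length (s i))) (s(i := [], j := rev (s i) @ s j, k := rev (s i) @ s k))"
proof (induction "s i" arbitrary: s)
  case Nil
  have "s(i := [], j := rev (s i) @ s j, k := rev (s i) @ s k) = s" using Nil by auto
  then show ?case unfolding fork_def by (intro execs_weaken[OF execs_Loop_Nil]) (use Nil in auto)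
next
  case (Cons b w)
  let ?t = "s(i := w, j := b # s j, k := b # s k)"
  have "execs (Push j b ;; Push k b) (s(i := w)) (1 + 1) ?t"
    by (rule execs_weaken[OF execs_Seq[OF execs_Push execs_Push]]) (use assms in \<open>auto simp: fun_eq_iff\<close>)
  then have 1: "execs (if b then Push j True ;; Push k True else Push j False ;; Push k False) (s(i := w)) (1 + 1) ?t"
    by (cases b) auto
  have 2: "execs (fork i j k) ?t (Suc (4 * length w)) (s(i := [], j := rev (s i) @ s j, k := rev (s i) @ s k))"
    by (rule execs_weaken[OF Cons(1)]) (use assms Cons(2)[symmetric] in \<open>auto simp: fun_eq_iff\<close>)
  show ?case unfolding fork_def
    by (rule execs_weaken[OF execs_Loop_Cons[OF Cons(2)[symmetric] 1 2[unfolded fork_def]]])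
      (use Cons(2)[symmetric] in auto)
qed

definition move_double :: "nat \<Rightarrow> nat \<Rightarrow> com" where
  "move_double i j = Loop i (Push j False ;; Push j True) (Push j True ;; Push j True)"

lemma execs_move_double:
  assumes "i \<noteq> j"
  shows "execs (move_double i j) s (Suc (4 * length (s i))) (s(i := [], j := double (rev (s i)) @ s j))"
proof -
  have "execs (if b then Push j True ;; Push j True else Push j False ;; Push j True) s (1 + 1)
      (s(j := [True, b] @ s j))" for b s
    by (cases b) (auto intro!: execs_weaken[OF execs_Seq[OF execs_Push execs_Push]])
  from execs_Loop_block[OF assms, where f = "\<lambda>b. [True, b]", OF this, of s] show ?thesis
    unfolding move_double_def by (rule execs_weaken) (auto simp: algebra_simps double_def)
qed

text \<open>Stack \<open>l\<close> only serves as a flag that makes the loop run once more.\<close>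

definition split_pair :: "nat \<Rightarrow> nat \<Rightarrow> com" where
  "split_pair m l = Push l True ;; Loop l Skip
     (Cond 0 Skip Skip (Cond 0 Skip (Push m False ;; Push l True) (Push m True ;; Push l True)))"

lemma execs_split_pair:
  assumes "m \<noteq> l" "0 < m" "0 < l" "s l = []" "s 0 = pair_word x y"
  shows "execs (split_pair m l) s (8 * length x + 10) (s(0 := y, m := rev x @ s m))"
proof -
  let ?b = "Cond 0 Skip Skip (Cond 0 Skip (Push m False ;; Push l True) (Push m True ;; Push l True))"
  \<comment> \<open>The flag is set on entry. A \<open>True\<close> that announces a bit leads to
    setting it again; the separator \<open>False\<close> leaves it empty, and the loop stops with
    \<open>y\<close> on stack 0.\<close>
  have "execs (Loop l Skip ?b) s (8 * length x + 9) (s(0 := y, l := [], m := rev x @ s m))"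
    if "s l = [True]" "s 0 = pair_word x y" for s
    using that
  proof (induction x arbitrary: s)
    case Nil
    have 1: "execs (if True then ?b else Skip) (s(l := [])) (0 + 2) (s(l := [], 0 := y))"
      unfolding if_True by (rule execs_Cond_Cons[where b = False and w = y])
        (use Nil assms in \<open>auto simp: pair_word_double intro: execs_Skip\<close>)
    have 2: "execs (Loop l Skip ?b) (s(l := [], 0 := y)) 1 (s(l := [], 0 := y))"
      by (rule execs_Loop_Nil) (use assms in auto)
    show ?case
      by (rule execs_weaken[OF execs_Loop_Cons[OF Nil(1) 1 2]]) (use assms in \<open>auto simp: fun_eq_iff\<close>)
  next
    case (Cons b x)
    let ?t = "s(0 := pair_word x y, m := b # s m)"
    have "execs (Push m b ;; Push l True) (s(l := [], 0 := pair_word x y)) (1 + 1) ?t"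
      by (rule execs_weaken[OF execs_Seq[OF execs_Push execs_Push]]) (use assms Cons in \<open>auto simp: fun_eq_iff\<close>)
    then have "execs (if b then Push m True ;; Push l True else Push m False ;; Push l True)
        (s(l := [], 0 := pair_word x y)) (1 + 1) ?t" by (cases b) auto
    then have "execs (Cond 0 Skip (Push m False ;; Push l True) (Push m True ;; Push l True))
       (s(l := [], 0 := b # pair_word x y)) (1 + 1 + 2) ?t"
      by (intro execs_Cond_Cons[where b = b and w = "pair_word x y"]) (use assms in simp_all)
    then have 1: "execs (if True then ?b else Skip) (s(l := [])) (1 + 1 + 2 + 2) ?t"
      unfolding if_True by (intro execs_Cond_Cons[where b = True and w = "b # pair_word x y"])
        (use Cons assms in \<open>auto simp: pair_word_double\<close>)
    have 2: "execs (Loop l Skip ?b) ?t (8 * length x + 9) (?t(0 := y, l := [], m := rev x @ ?t m))"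
      by (rule Cons.IH) (use assms Cons in auto)
    show ?case
      by (rule execs_weaken[OF execs_Loop_Cons[OF Cons(2) 1 2]]) (use assms in \<open>auto simp: fun_eq_iff\<close>)
  qed
  from this[of "s(l := [True])"] have *: "execs (Loop l Skip ?b) (s(l := [True])) (8 * length x + 9) (s(0 := y, m := rev x @ s m))"
    by (rule execs_weaken) (use assms in \<open>auto simp: fun_eq_iff\<close>)
  have "execs (Push l True) s 1 (s(l := [True]))"
    using execs_Push[of l True s] assms by simp
  from execs_weaken[OF execs_Seq[OF this *]] show ?thesis unfolding split_pair_def by auto
qed

text \<open>The input and the output are on stack 0.  The scratch stacks \<open>1..<k\<close> are empty before and after the run,
  and all stacks from \<open>k\<close> on are left alone, so that an enclosing program can keep data there.\<close>

definition computes :: "('a \<Rightarrow> word) \<Rightarrow> ('b \<Rightarrow> word) \<Rightarrow> ('a \<Rightarrow> 'b) \<Rightarrow> bool" where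
  "computes ea eb f \<longleftrightarrow> (\<exists>c p k. poly_bd p \<and>
     (\<forall>a s. (\<forall>i. 0 < i \<longrightarrow> i < k \<longrightarrow> s i = []) \<longrightarrow> s 0 = ea a \<longrightarrow>
        execs c s (p (length (ea a))) (s(0 := eb (f a)))))"

section \<open>Closure properties of polynomial-time stack programs\<close>

lemma computesI:
  assumes "poly_bd p"
    and "\<And>a s. (\<And>i. 0 < i \<Longrightarrow> i < k \<Longrightarrow> s i = []) \<Longrightarrow> s 0 = ea a \<Longrightarrow>
        execs c s (p (length (ea a))) (s(0 := eb (f a)))"
  shows "computes ea eb f"
  unfolding computes_def using assms by blast

text \<open>The third fact follows from the running time, since each step adds at most one symbol;
  it bounds the time of any program that consumes the output.\<close>

lemma computesE:
  assumes "computes ea eb f"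
  obtains c p k where "poly_bd p"
    "\<And>a s. (\<And>i. 0 < i \<Longrightarrow> i < k \<Longrightarrow> s i = []) \<Longrightarrow> s 0 = ea a \<Longrightarrow>
        execs c s (p (length (ea a))) (s(0 := eb (f a)))"
    "\<And>a. length (eb (f a)) \<le> length (ea a) + p (length (ea a))"
proof -
  from assms obtain c p k where *: "poly_bd p"
    "\<And>a s. (\<And>i. 0 < i \<Longrightarrow> i < k \<Longrightarrow> s i = []) \<Longrightarrow> s 0 = ea a \<Longrightarrow>
        execs c s (p (length (ea a))) (s(0 := eb (f a)))"
    unfolding computes_def by blast
  have "length (eb (f a)) \<le> length (ea a) + p (length (ea a))" for a
    using execs_length[OF *(2)[of "(\<lambda>_. [])(0 := ea a)" a], of 0] by simp
  from that[OF * this] show ?thesis .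
qed

lemma computes_length:
  assumes "computes ea eb f"
  obtains p where "poly_bd p" "\<And>a. length (eb (f a)) \<le> p (length (ea a))"
proof -
  obtain p where p: "poly_bd p" "\<And>a. length (eb (f a)) \<le> length (ea a) + p (length (ea a))"
    by (rule computesE[OF assms]) blast
  then have "poly_bd (\<lambda>n. n + p n)" by (intro poly_bd_intros)
  then show ?thesis using p that by blast
qed

lemma computes_comp:
  assumes "computes ea eb f" "computes eb ec g"
  shows "computes ea ec (\<lambda>x. g (f x))"
proof -
  obtain c p k where f: "poly_bd p"
    "\<And>a s. (\<And>i. 0 < i \<Longrightarrow> i < k \<Longrightarrow> s i = []) \<Longrightarrow> s 0 = ea a \<Longrightarrow>
        execs c s (p (length (ea a))) (s(0 := eb (f a)))"
    "\<And>a. length (eb (f a)) \<le> length (ea a) + p (length (ea a))"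
    by (rule computesE[OF assms(1)]) blast
  obtain d q l where g: "poly_bd q"
    "\<And>a s. (\<And>i. 0 < i \<Longrightarrow> i < l \<Longrightarrow> s i = []) \<Longrightarrow> s 0 = eb a \<Longrightarrow>
        execs d s (q (length (eb a))) (s(0 := ec (g a)))"
    by (rule computesE[OF assms(2)]) blast
  show ?thesis
  proof (rule computesI)
    show "poly_bd (\<lambda>n. p n + q (n + p n))"
      by (intro poly_bd_intros poly_bd_comp[OF g(1)] f)
    fix a and s :: store
    assume s: "\<And>i. 0 < i \<Longrightarrow> i < max k l \<Longrightarrow> s i = []" "s 0 = ea a"
    have 1: "execs c s (p (length (ea a))) (s(0 := eb (f a)))"
      using f(2)[of s a] s by auto
    have 2: "execs d (s(0 := eb (f a))) (q (length (eb (f a)))) (s(0 := eb (f a), 0 := ec (g (f a))))"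
      using g(2)[of "s(0 := eb (f a))" "f a"] s by auto
    show "execs (c ;; d) s (p (length (ea a)) + q (length (ea a) + p (length (ea a)))) (s(0 := ec (g (f a))))"
      by (rule execs_weaken[OF execs_Seq[OF 1 2]]) (use poly_bdD[OF g(1) f(3)] in auto)
  qed
qed

lemma computes_pair:
  assumes "computes ea eb f" "computes ea ec g"
  shows "computes ea (\<lambda>(b, c). pair_word (eb b) (ec c)) (\<lambda>a. (f a, g a))"
proof -
  obtain c p k where f: "poly_bd p"
    "\<And>a s. (\<And>i. 0 < i \<Longrightarrow> i < k \<Longrightarrow> s i = []) \<Longrightarrow> s 0 = ea a \<Longrightarrow>
        execs c s (p (length (ea a))) (s(0 := eb (f a)))"
    "\<And>a. length (eb (f a)) \<le> length (ea a) + p (length (ea a))"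
    by (rule computesE[OF assms(1)]) blast
  obtain d q l where g: "poly_bd q"
    "\<And>a s. (\<And>i. 0 < i \<Longrightarrow> i < l \<Longrightarrow> s i = []) \<Longrightarrow> s 0 = ea a \<Longrightarrow>
        execs d s (q (length (ea a))) (s(0 := ec (g a)))"
    by (rule computesE[OF assms(2)]) blast
  \<comment> \<open>The stacks \<open>m\<close> and \<open>Suc m\<close> lie beyond the scratch
    space of both programs; they keep the second copy of the input and the first result.\<close>
  define m where "m = Suc (max k l)"
  show ?thesis
  proof (rule computesI)
    \<comment> \<open>The eight parts take \<open>10 * n + 7 * u + p n + q n + 6\<close> steps,
      where the length \<open>u\<close> of the first result is at most
      \<open>n + p n\<close>.\<close>
    show "poly_bd (\<lambda>n. 17 * n + 8 * p n + q n + 6)"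
      by (intro poly_bd_intros f g)
    fix a and s :: store
    assume s: "\<And>i. 0 < i \<Longrightarrow> i < m + 2 \<Longrightarrow> s i = []" "s 0 = ea a"
    let ?x = "ea a" and ?u = "eb (f a)" and ?v = "ec (g a)"
    have "0 < m" by (simp add: m_def)
    then have sm: "s m = []" "s (Suc m) = []" "0 < m" using s(1)[of m] s(1)[of "Suc m"] by simp_all
    have 1: "execs (fork 0 m (Suc m)) s (Suc (4 * length ?x)) (s(0 := [], m := rev ?x, Suc m := rev ?x))"
      by (rule execs_weaken[OF execs_fork]) (use s sm in auto)
    have 2: "execs (moveto (Suc m) 0) (s(0 := [], m := rev ?x, Suc m := rev ?x)) (Suc (3 * length ?x)) (s(0 := ?x, m := rev ?x))"
      by (rule execs_weaken[OF execs_moveto]) (use s sm in \<open>auto simp: fun_eq_iff\<close>)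
    have 3: "execs c (s(0 := ?x, m := rev ?x)) (p (length ?x)) (s(0 := ?u, m := rev ?x))"
      by (rule execs_weaken[OF f(2)]) (use s sm in \<open>auto simp: fun_eq_iff m_def\<close>)
    have 4: "execs (moveto 0 (Suc m)) (s(0 := ?u, m := rev ?x)) (Suc (3 * length ?u)) (s(0 := [], m := rev ?x, Suc m := rev ?u))"
      by (rule execs_weaken[OF execs_moveto]) (use s sm in \<open>auto simp: fun_eq_iff\<close>)
    have 5: "execs (moveto m 0) (s(0 := [], m := rev ?x, Suc m := rev ?u)) (Suc (3 * length ?x)) (s(0 := ?x, Suc m := rev ?u))"
      by (rule execs_weaken[OF execs_moveto]) (use s sm in \<open>auto simp: fun_eq_iff\<close>)
    have 6: "execs d (s(0 := ?x, Suc m := rev ?u)) (q (length ?x)) (s(0 := ?v, Suc m := rev ?u))"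
      by (rule execs_weaken[OF g(2)]) (use s sm in \<open>auto simp: fun_eq_iff m_def\<close>)
    have 7: "execs (Push 0 False) (s(0 := ?v, Suc m := rev ?u)) 1 (s(0 := False # ?v, Suc m := rev ?u))"
      by (rule execs_weaken[OF execs_Push]) (use s sm in \<open>auto simp: fun_eq_iff\<close>)
    have 8: "execs (move_double (Suc m) 0) (s(0 := False # ?v, Suc m := rev ?u)) (Suc (4 * length ?u)) (s(0 := pair_word ?u ?v))"
      by (rule execs_weaken[OF execs_move_double]) (use s sm in \<open>auto simp: fun_eq_iff pair_word_double\<close>)
    note * = execs_Seq[OF 1 execs_Seq[OF 2 execs_Seq[OF 3 execs_Seq[OF 4 execs_Seq[OF 5 execs_Seq[OF 6 execs_Seq[OF 7 8]]]]]]]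
    show "execs (fork 0 m (Suc m) ;; moveto (Suc m) 0 ;; c ;; moveto 0 (Suc m) ;; moveto m 0 ;; d ;; Push 0 False ;; move_double (Suc m) 0)
      s (17 * length (ea a) + 8 * p (length (ea a)) + q (length (ea a)) + 6)
      (s(0 := (case (f a, g a) of (b, c) \<Rightarrow> pair_word (eb b) (ec c))))"
      by (rule execs_weaken[OF *]) (use f(3)[of a] in auto)
  qed
qed

text \<open>\<open>Skip\<close> computes every function that does not change the code, so mere
  changes of type are free.\<close>

lemma computes_recode: "(\<And>x. ea x = eb (f x)) \<Longrightarrow> computes ea eb f"
  by (rule computesI[OF poly_bd_const[of 0], where c = Skip and k = 0])
    (auto intro!: execs_weaken[OF execs_Skip[of _ 0]] simp: fun_eq_iff)

lemma computes_const: "computes ea eb (\<lambda>_. y)"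
proof (rule computesI)
  show "poly_bd (\<lambda>n. Suc (2 * n) + length (eb y))"
    using poly_bd_add[OF poly_bd_mult[OF poly_bd_const[of 2] poly_bd_id] poly_bd_const[of "Suc (length (eb y))"]] by simp
  fix a and s :: store
  assume "\<And>i. 0 < i \<Longrightarrow> i < 0 \<Longrightarrow> s i = []" "s 0 = ea a"
  then show "execs (clear 0 ;; push_word 0 (eb y)) s (Suc (2 * length (ea a)) + length (eb y)) (s(0 := eb y))"
    by (intro execs_weaken[OF execs_Seq[OF execs_clear execs_push_word]]) (auto simp: fun_eq_iff)
qed

lemma computes_fst: "computes (\<lambda>(a, b). pair_word (ea a) (eb b)) ea fst"
proof (rule computesI)
  show "poly_bd (\<lambda>n. 16 * n + 20)" by (intro poly_bd_intros)
  fix a :: "'a \<times> 'b" and s :: store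
  assume s: "\<And>i. 0 < i \<Longrightarrow> i < 3 \<Longrightarrow> s i = []" "s 0 = (case a of (a, b) \<Rightarrow> pair_word (ea a) (eb b))"
  obtain x y where a: "a = (x, y)" by (cases a)
  have s12: "s 1 = []" "s 2 = []" using s by auto
  have 1: "execs (split_pair 1 2) s (8 * length (ea x) + 10) (s(0 := eb y, 1 := rev (ea x)))"
    by (rule execs_weaken[OF execs_split_pair]) (use s s12 a in \<open>auto simp: fun_eq_iff\<close>)
  have 2: "execs (clear 0) (s(0 := eb y, 1 := rev (ea x))) (Suc (2 * length (eb y))) (s(0 := [], 1 := rev (ea x)))"
    by (rule execs_weaken[OF execs_clear]) (auto simp: fun_eq_iff)
  have 3: "execs (moveto 1 0) (s(0 := [], 1 := rev (ea x))) (Suc (3 * length (ea x))) (s(0 := ea x))"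
    by (rule execs_weaken[OF execs_moveto]) (use s s12 a in \<open>auto simp: fun_eq_iff\<close>)
  show "execs (split_pair 1 2 ;; clear 0 ;; moveto 1 0) s
      (16 * length (case a of (a, b) \<Rightarrow> pair_word (ea a) (eb b)) + 20) (s(0 := ea (fst a)))"
    by (rule execs_weaken[OF execs_Seq[OF 1 execs_Seq[OF 2 3]]]) (auto simp: a)
qed

lemma computes_snd: "computes (\<lambda>(a, b). pair_word (ea a) (eb b)) eb snd"
proof (rule computesI)
  show "poly_bd (\<lambda>n. 16 * n + 20)" by (intro poly_bd_intros)
  fix a :: "'a \<times> 'b" and s :: store
  assume s: "\<And>i. 0 < i \<Longrightarrow> i < 3 \<Longrightarrow> s i = []" "s 0 = (case a of (a, b) \<Rightarrow> pair_word (ea a) (eb b))"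
  obtain x y where a: "a = (x, y)" by (cases a)
  have s12: "s 1 = []" "s 2 = []" using s by auto
  have 1: "execs (split_pair 1 2) s (8 * length (ea x) + 10) (s(0 := eb y, 1 := rev (ea x)))"
    by (rule execs_weaken[OF execs_split_pair]) (use s s12 a in \<open>auto simp: fun_eq_iff\<close>)
  have 2: "execs (clear 1) (s(0 := eb y, 1 := rev (ea x))) (Suc (2 * length (ea x))) (s(0 := eb y))"
    by (rule execs_weaken[OF execs_clear]) (use s12 in \<open>auto simp: fun_eq_iff\<close>)
  show "execs (split_pair 1 2 ;; clear 1) s
      (16 * length (case a of (a, b) \<Rightarrow> pair_word (ea a) (eb b)) + 20) (s(0 := eb (snd a)))"
    by (rule execs_weaken[OF execs_Seq[OF 1 2]]) (auto simp: a)
qed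

section \<open>Polynomial-time functions on structured data\<close>

text \<open>Injectivity lets equality of values be decided on their codes.\<close>

class enc =
  fixes enc :: "'a \<Rightarrow> word"
  assumes enc_inj: "enc x = enc y \<Longrightarrow> x = y"

lemma pair_word_neq_Nil [simp]: "pair_word x y \<noteq> []" "[] \<noteq> pair_word x y"
  by (simp_all add: pair_word_double)

instantiation bool :: enc
begin
definition "enc b = [b]" for b :: bool
instance by standard (simp add: enc_bool_def)
end

instantiation unit :: enc
begin
definition "enc u = []" for u :: unit
instance by standard simp
end

instantiation prod :: (enc, enc) enc
begin
definition "enc p = pair_word (enc (fst p)) (enc (snd p))" for p :: "'a \<times> 'b"
instance by standard (auto simp: enc_prod_def pair_word_inj prod_eq_iff intro: enc_inj)
end

text \<open>Pairing doubles only the first component, so the code of a list is linear in the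
  codes of its elements.\<close>

instantiation list :: (enc) enc
begin
primrec enc_list :: "'a list \<Rightarrow> word" where
  "enc_list [] = []"
| "enc_list (x # xs) = pair_word (enc x) (enc_list xs)"
instance
proof
  show "xs = ys" if "enc xs = enc ys" for xs ys :: "'a list"
    using that
  proof (induction xs arbitrary: ys)
    case Nil
    then show ?case by (cases ys) auto
  next
    case (Cons x xs)
    then show ?case by (cases ys) (auto simp: pair_word_inj intro: enc_inj)
  qed
qed
end

declare bin.simps [simp del]

primrec of_bits :: "word \<Rightarrow> nat" where
  "of_bits [] = 0"
| "of_bits (b # w) = of_bool b + 2 * of_bits w"

lemma of_bits_bin [simp]: "of_bits (bin n) = n"
proof (induction n rule: bin.induct)
  case (1 n)
  then show ?case by (subst bin.simps) auto
qed

lemma bin_inj: "bin m = bin n \<longleftrightarrow> m = n"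
  by (metis of_bits_bin)

text \<open>A number has the code of its list of binary digits, so \<open>bin\<close> is the
  identity on codes.\<close>

instantiation nat :: enc
begin
definition "enc n = enc (bin n)" for n :: nat
instance by standard (auto simp: enc_nat_def bin_inj dest: enc_inj)
end

lemma enc_Pair [simp]: "enc (a, b) = pair_word (enc a) (enc b)"
  by (simp add: enc_prod_def)

lemma enc_prod_conv: "enc = (\<lambda>(a, b). pair_word (enc a) (enc b))"
  by (auto simp: fun_eq_iff)

definition PT :: "('a::enc \<Rightarrow> 'b::enc) \<Rightarrow> bool" where
  "PT f \<longleftrightarrow> computes enc enc f"

named_theorems PT_intros

lemma PT_id [PT_intros]: "PT (\<lambda>x. x)"
  unfolding PT_def by (rule computes_recode) simp

lemma PT_const [PT_intros]: "PT (\<lambda>_. c)"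
  unfolding PT_def by (rule computes_const)

lemma PT_comp: "PT g \<Longrightarrow> PT f \<Longrightarrow> PT (\<lambda>x. g (f x))"
  unfolding PT_def by (rule computes_comp)

lemma PT_Pair [PT_intros]: "PT f \<Longrightarrow> PT g \<Longrightarrow> PT (\<lambda>x. (f x, g x))"
  unfolding PT_def enc_prod_conv by (rule computes_pair)

lemma PT_fst [PT_intros]: "PT f \<Longrightarrow> PT (\<lambda>x. fst (f x))"
  using computes_comp[of enc enc f enc fst] computes_fst unfolding PT_def by (metis enc_prod_conv)

lemma PT_snd [PT_intros]: "PT f \<Longrightarrow> PT (\<lambda>x. snd (f x))"
  using computes_comp[of enc enc f enc snd] computes_snd unfolding PT_def by (metis enc_prod_conv)

text \<open>Programs have a single input, so a function of several arguments is treated as a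
  function of nested pairs.\<close>

lemma PT_comp2: "PT (\<lambda>p. h (fst p) (snd p)) \<Longrightarrow> PT f \<Longrightarrow> PT g \<Longrightarrow> PT (\<lambda>x. h (f x) (g x))"
  using PT_comp[of "\<lambda>p. h (fst p) (snd p)" "\<lambda>x. (f x, g x)"] PT_Pair by auto

lemma PT_comp3: "PT (\<lambda>p. h (fst p) (fst (snd p)) (snd (snd p))) \<Longrightarrow> PT f \<Longrightarrow> PT g \<Longrightarrow> PT k \<Longrightarrow> PT (\<lambda>x. h (f x) (g x) (k x))"
  using PT_comp[of "\<lambda>p. h (fst p) (fst (snd p)) (snd (snd p))" "\<lambda>x. (f x, g x, k x)"] PT_Pair[OF _ PT_Pair, of f g k]
  by auto

lemma PT_length:
  assumes "PT f"
  obtains p where "poly_bd p" "\<And>a. length (enc (f a)) \<le> p (length (enc a))"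
  using computes_length assms unfolding PT_def by metis

lemma PT_recode: "(\<And>x. enc x = enc (f x)) \<Longrightarrow> PT f"
  unfolding PT_def by (rule computes_recode)

lemma PT_Cons [PT_intros]:
  assumes "PT f" "PT g"
  shows "PT (\<lambda>x. f x # g x)"
proof -
  have "PT (\<lambda>p. fst p # snd p)" by (rule PT_recode) (simp add: enc_prod_def)
  from PT_comp2[OF this assms] show ?thesis .
qed

text \<open>The condition is computed first and paired with the input. The code of that pair is
  \<open>True # b # False # enc x\<close>; three nested tests strip the prefix, and the middle one
  selects the branch.\<close>

lemma PT_if [PT_intros]:
  assumes "PT b" "PT f" "PT g"
  shows "PT (\<lambda>x. if b x then f x else g x)"
proof -
  obtain c p k where f: "poly_bd p"
    "\<And>a s. (\<And>i. 0 < i \<Longrightarrow> i < k \<Longrightarrow> s i = []) \<Longrightarrow> s 0 = enc a \<Longrightarrow>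
        execs c s (p (length (enc a))) (s(0 := enc (f a)))"
    by (rule computesE[OF assms(2)[unfolded PT_def]]) blast
  obtain d q l where g: "poly_bd q"
    "\<And>a s. (\<And>i. 0 < i \<Longrightarrow> i < l \<Longrightarrow> s i = []) \<Longrightarrow> s 0 = enc a \<Longrightarrow>
        execs d s (q (length (enc a))) (s(0 := enc (g a)))"
    by (rule computesE[OF assms(3)[unfolded PT_def]]) blast
  let ?c = "Cond 0 Skip Skip (Cond 0 Skip (Cond 0 Skip d Skip) (Cond 0 Skip c Skip))"
  have "PT (\<lambda>p. if fst p then f (snd p) else g (snd p))" unfolding PT_def
  proof (rule computesI)
    show "poly_bd (\<lambda>n. p n + q n + 6)"
      by (intro poly_bd_intros f g)
    fix a :: "bool \<times> 'a" and s :: store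
    assume s: "\<And>i. 0 < i \<Longrightarrow> i < max k l \<Longrightarrow> s i = []" "s 0 = enc a"
    obtain b x where a: "a = (b, x)" by (cases a)
    let ?n = "p (length (enc x)) + q (length (enc x))"
    have s0: "s 0 = True # b # False # enc x" using s a by (simp add: pair_word_double enc_bool_def)
    have "execs (if b then c else d) (s(0 := enc x)) ?n (s(0 := enc (if b then f x else g x)))"
    proof (cases b)
      case True
      have "execs c (s(0 := enc x)) (p (length (enc x))) (s(0 := enc x, 0 := enc (f x)))"
        by (rule f(2)) (use s in auto)
      then show ?thesis using True by (auto intro: execs_weaken)
    next
      case False
      have "execs d (s(0 := enc x)) (q (length (enc x))) (s(0 := enc x, 0 := enc (g x)))"
        by (rule g(2)) (use s in auto)
      then show ?thesis using False by (auto intro: execs_weaken)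
    qed
    then have "execs (if b then Cond 0 Skip c Skip else Cond 0 Skip d Skip) (s(0 := False # enc x)) (?n + 2)
      (s(0 := enc (if b then f x else g x)))"
      using execs_Cond_Cons[of "s(0 := False # enc x)" 0 False "enc x" Skip "if b then c else d" ?n _ Skip]
      by (cases b) simp_all
    then have "execs (Cond 0 Skip (Cond 0 Skip d Skip) (Cond 0 Skip c Skip)) (s(0 := b # False # enc x)) (?n + 2 + 2)
      (s(0 := enc (if b then f x else g x)))"
      by (intro execs_Cond_Cons[where b = b and w = "False # enc x"]) simp_all
    then have "execs ?c s (?n + 2 + 2 + 2) (s(0 := enc (if b then f x else g x)))"
      by (intro execs_Cond_Cons[where b = True and w = "b # False # enc x"]) (simp_all add: s0)
    then show "execs ?c s (p (length (enc a)) + q (length (enc a)) + 6) (s(0 := enc (if fst a then f (snd a) else g (snd a))))"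
      by (rule execs_weaken)
       (use poly_bdD[OF f(1), of "length (enc x)" "length (enc a)"] poly_bdD[OF g(1), of "length (enc x)" "length (enc a)"] a
         in \<open>auto simp: fun_eq_iff\<close>)
  qed
  from PT_comp[OF this PT_Pair[OF assms(1) PT_id]] show ?thesis unfolding fst_conv snd_conv .
qed

text \<open>The first symbol of the code of a list paired with \<open>x\<close> tells whether the
  list is empty. If it is not, the codes of \<open>(y # ys, x)\<close> and
  \<open>((y, ys), x)\<close> are the same word, so it suffices to push the tested symbol
  back.\<close>

lemma PT_case_list [PT_intros]:
  assumes "PT xs" "PT f" "PT (\<lambda>p. g (fst p) (fst (snd p)) (snd (snd p)))"
  shows "PT (\<lambda>z. case xs z of [] \<Rightarrow> f z | y # ys \<Rightarrow> g z y ys)"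
proof -
  define h where "h = (\<lambda>p. g (snd p) (fst (fst p)) (snd (fst p)))"
  have "PT h" unfolding h_def
    by (rule PT_comp3[OF assms(3)]) (intro PT_intros)+
  obtain c p k where f: "poly_bd p"
    "\<And>a s. (\<And>i. 0 < i \<Longrightarrow> i < k \<Longrightarrow> s i = []) \<Longrightarrow> s 0 = enc a \<Longrightarrow>
        execs c s (p (length (enc a))) (s(0 := enc (f a)))"
    by (rule computesE[OF assms(2)[unfolded PT_def]]) blast
  obtain d q l where h: "poly_bd q"
    "\<And>a s. (\<And>i. 0 < i \<Longrightarrow> i < l \<Longrightarrow> s i = []) \<Longrightarrow> s 0 = enc a \<Longrightarrow>
        execs d s (q (length (enc a))) (s(0 := enc (h a)))"
    by (rule computesE[OF \<open>PT h\<close>[unfolded PT_def]]) blast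
  let ?F = "\<lambda>p. case fst p of [] \<Rightarrow> f (snd p) | y # ys \<Rightarrow> h ((y, ys), snd p)"
  have "PT ?F" unfolding PT_def
  proof (rule computesI)
    show "poly_bd (\<lambda>n. p n + q n + 3)"
      by (intro poly_bd_intros f h)
    fix a :: "'b list \<times> 'a" and s :: store
    assume s: "\<And>i. 0 < i \<Longrightarrow> i < max k l \<Longrightarrow> s i = []" "s 0 = enc a"
    obtain ys x where a: "a = (ys, x)" by (cases a)
    show "execs (Cond 0 Skip c (Push 0 True ;; d)) s (p (length (enc a)) + q (length (enc a)) + 3) (s(0 := enc (?F a)))"
    proof (cases ys)
      case Nil
      have "execs c (s(0 := enc x)) (p (length (enc x))) (s(0 := enc x, 0 := enc (f x)))"
        by (rule f(2)) (use s in auto)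
      then have "execs (Cond 0 Skip c (Push 0 True ;; d)) s (p (length (enc x)) + 2) (s(0 := enc x, 0 := enc (f x)))"
        by (intro execs_Cond_Cons[where b = False and w = "enc x"]) (use s a Nil in \<open>simp_all add: pair_word_double\<close>)
      then show ?thesis
        by (rule execs_weaken)
          (use poly_bdD[OF f(1), of "length (enc x)" "length (enc a)"] a Nil in \<open>auto simp: fun_eq_iff\<close>)
    next
      case (Cons y zs)
      have e: "enc a = enc ((y, zs), x)" using a Cons by simp
      then obtain w where w: "enc a = True # w" by (cases "enc y") (auto simp: pair_word_double)
      have 1: "execs (Push 0 True) (s(0 := w)) 1 s"
        by (rule execs_weaken[OF execs_Push]) (use s w in \<open>auto simp: fun_eq_iff\<close>)
      have 2: "execs d s (q (length (enc a))) (s(0 := enc (h ((y, zs), x))))"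
        unfolding e by (rule h(2)) (use s e in auto)
      have "execs (Cond 0 Skip c (Push 0 True ;; d)) s (1 + q (length (enc a)) + 2) (s(0 := enc (h ((y, zs), x))))"
        by (rule execs_Cond_Cons[where b = True and w = w]) (use s w execs_Seq[OF 1 2] in simp_all)
      then show ?thesis
        by (rule execs_weaken) (use a Cons in auto)
    qed
  qed
  from PT_comp[OF this PT_Pair[OF assms(1) PT_id]] show ?thesis unfolding h_def fst_conv snd_conv .
qed

section \<open>Iteration and folds\<close>

lemma execs_Loop_iterate:
  fixes h :: "'a::enc \<Rightarrow> 'a"
  assumes "\<And>i a s. (\<And>i. 0 < i \<Longrightarrow> i < k \<Longrightarrow> s i = []) \<Longrightarrow> s 0 = enc a \<Longrightarrow>
        execs c s (p (length (enc a))) (s(0 := enc (h a)))"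
    and "0 < m" "k \<le> m"
    and "\<And>i. 0 < i \<Longrightarrow> i < k \<Longrightarrow> s i = []" "s 0 = enc a"
    and "\<And>i. i < length (s m) \<Longrightarrow> p (length (enc ((h ^^ i) a))) \<le> B"
  shows "execs (Loop m c c) s (Suc (length (s m) * (B + 2))) (s(0 := enc ((h ^^ length (s m)) a), m := []))"
  using assms(4-)
proof (induction "s m" arbitrary: s a)
  case Nil
  have "s(0 := enc ((h ^^ length (s m)) a), m := []) = s" using Nil by (auto simp: fun_eq_iff)
  then show ?case by (intro execs_weaken[OF execs_Loop_Nil]) (use Nil in auto)
next
  case (Cons b w)
  note sm = Cons.hyps(2)[symmetric]
  let ?t = "s(m := w, 0 := enc (h a))"
  have "execs c (s(m := w)) (p (length (enc a))) (s(m := w, 0 := enc (h a)))"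
    by (rule assms(1)) (use Cons.prems assms in auto)
  moreover have "p (length (enc a)) \<le> B" using Cons.prems(3)[of 0] sm by simp
  ultimately have 1: "execs (if b then c else c) (s(m := w)) B ?t" by (auto intro: execs_weaken)
  have 2: "execs (Loop m c c) ?t (Suc (length w * (B + 2))) (s(0 := enc ((h ^^ length (s m)) a), m := []))"
  proof (rule execs_weaken[OF Cons.hyps(1)[of ?t "h a"]])
    show "p (length (enc ((h ^^ i) (h a)))) \<le> B" if "i < length (?t m)" for i
      using Cons.prems(3)[of "Suc i"] that sm assms(2) by (simp add: funpow_swap1)
  qed (use Cons.prems assms sm in \<open>auto simp: funpow_swap1\<close>)
  show ?case by (rule execs_weaken[OF execs_Loop_Cons[OF sm 1 2]]) (use sm in auto)
qed

text \<open>The code of \<open>cnt x\<close> on a separate stack is a unary counter of which each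
  round pops one symbol. The bound \<open>q\<close> on all iterates is essential: a polynomial step
  that doubles its argument would otherwise be iterated to exponential size.\<close>

lemma PT_iterate:
  fixes cnt :: "'a::enc \<Rightarrow> 'b::enc" and init :: "'a \<Rightarrow> 'c::enc" and h :: "'c \<Rightarrow> 'c"
  assumes "PT cnt" "PT init" "PT h" and q: "poly_bd q"
    and b: "\<And>x i. i \<le> length (enc (cnt x)) \<Longrightarrow> length (enc ((h ^^ i) (init x))) \<le> q (length (enc x))"
  shows "PT (\<lambda>x. (h ^^ length (enc (cnt x))) (init x))"
proof -
  obtain c p k where f: "poly_bd p"
    "\<And>a s. (\<And>i. 0 < i \<Longrightarrow> i < k \<Longrightarrow> s i = []) \<Longrightarrow> s 0 = enc a \<Longrightarrow>
        execs c s (p (length (enc a))) (s(0 := enc (cnt a, init a)))"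
    "\<And>a. length (enc (cnt a, init a)) \<le> length (enc a) + p (length (enc a))"
    by (rule computesE[OF PT_Pair[OF assms(1,2), unfolded PT_def]]) blast
  obtain d r l where h: "poly_bd r"
    "\<And>a s. (\<And>i. 0 < i \<Longrightarrow> i < l \<Longrightarrow> s i = []) \<Longrightarrow> s 0 = enc a \<Longrightarrow>
        execs d s (r (length (enc a))) (s(0 := enc (h a)))"
    by (rule computesE[OF assms(3)[unfolded PT_def]]) blast
  define m where "m = Suc (max k l)"
  define T where "T = (\<lambda>n. p n + (8 * (n + p n) + 10) + Suc ((n + p n) * (r (q n) + 2)))"
  show ?thesis unfolding PT_def
  proof (rule computesI)
    show "poly_bd T"
      unfolding T_def Suc_eq_plus1 by (intro poly_bd_intros f h poly_bd_comp[OF h(1) q])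
    fix a :: 'a and s :: store
    assume s: "\<And>i. 0 < i \<Longrightarrow> i < m + 2 \<Longrightarrow> s i = []" "s 0 = enc a"
    let ?n = "length (enc a)" and ?N = "length (enc (cnt a))"
    have "0 < m" by (simp add: m_def)
    then have sm: "s m = []" "s (Suc m) = []" "0 < m" using s(1)[of m] s(1)[of "Suc m"] by simp_all
    have N: "?N \<le> ?n + p ?n" using f(3)[of a] by simp
    have 1: "execs c s (p ?n) (s(0 := enc (cnt a, init a)))"
      by (rule f(2)) (use s in \<open>auto simp: m_def\<close>)
    have 2: "execs (split_pair m (Suc m)) (s(0 := enc (cnt a, init a))) (8 * ?N + 10) (s(0 := enc (init a), m := rev (enc (cnt a))))"
      by (rule execs_weaken[OF execs_split_pair]) (use s sm in \<open>auto simp: fun_eq_iff\<close>)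
    let ?s = "s(0 := enc (init a), m := rev (enc (cnt a)))"
    have 3: "execs (Loop m d d) ?s (Suc (length (?s m) * (r (q ?n) + 2))) (?s(0 := enc ((h ^^ length (?s m)) (init a)), m := []))"
    proof (rule execs_Loop_iterate[where k = l and p = r])
      show "r (length (enc ((h ^^ i) (init a)))) \<le> r (q ?n)" if "i < length (?s m)" for i
        using that b[of i a] by (intro poly_bdD[OF h(1)]) auto
    qed (use h(2) s sm in \<open>auto simp: m_def\<close>)
    have "?N * (r (q ?n) + 2) \<le> (?n + p ?n) * (r (q ?n) + 2)" using N by (rule mult_right_mono) simp
    moreover have "P + (8 * a + 10 + Suc x) \<le> P + (8 * b + 10) + Suc y" if "a \<le> b" "x \<le> y" for P a b x y :: nat
      using that by simp
    ultimately have "p ?n + (8 * ?N + 10 + Suc (?N * (r (q ?n) + 2))) \<le> T ?n"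
      using N unfolding T_def by blast
    then show "execs (c ;; split_pair m (Suc m) ;; Loop m d d) s (T ?n) (s(0 := enc ((h ^^ ?N) (init a))))"
      by (intro execs_weaken[OF execs_Seq[OF 1 execs_Seq[OF 2 3]]]) (use sm in \<open>auto simp: fun_eq_iff\<close>)
  qed
qed

lemma length_enc_mem: "x \<in> set xs \<Longrightarrow> length (enc x) \<le> length (enc xs)"
  by (induction xs) auto

lemma length_le_enc: "length xs \<le> length (enc xs)"
  by (induction xs) auto

lemma length_enc_append [simp]: "length (enc (xs @ ys)) = length (enc xs) + length (enc ys)"
  by (induction xs) auto

lemma length_enc_drop: "length (enc (drop n xs)) \<le> length (enc xs)"
  by (metis append_take_drop_id le_add2 length_enc_append)

lemma PT_fold:
  assumes f: "PT (\<lambda>p. f (fst p) (fst (snd p)) (snd (snd p)))" and xs: "PT xs" and init: "PT init"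
    and q: "poly_bd q"
    and b: "\<And>z n. length (enc (fold (f z) (take n (xs z)) (init z))) \<le> q (length (enc z))"
  shows "PT (\<lambda>z. fold (f z) (xs z) (init z))"
proof -
  \<comment> \<open>The state carries the parameter, the rest of the list and the
    accumulator.\<close>
  define h where "h = (\<lambda>s. (fst s, case fst (snd s) of [] \<Rightarrow> ([], snd (snd s)) | x # r \<Rightarrow> (r, f (fst s) x (snd (snd s)))))"
  have h_simps: "h (z, [], a) = (z, [], a)" "h (z, y # ys, a) = (z, ys, f z y a)" for z y ys a
    by (simp_all add: h_def)
  have *: "(h ^^ n) (z, ys, a) = (z, drop n ys, fold (f z) (take n ys) a)" for n z ys a
  proof (induction n arbitrary: ys a)
    case (Suc n)
    then show ?case by (cases ys) (auto simp: h_simps funpow_Suc_right simp del: funpow.simps)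
  qed simp
  have h: "PT h" unfolding h_def
    by (intro PT_intros) (rule PT_comp3[OF f], (intro PT_intros)+)
  obtain p where p: "poly_bd p" "\<And>a. length (enc (xs a)) \<le> p (length (enc a))" by (rule PT_length[OF xs]) blast
  have "PT (\<lambda>z. (h ^^ length (enc (xs z))) (z, xs z, init z))"
  proof (rule PT_iterate)
    show "poly_bd (\<lambda>n. 2 * n + 2 * p n + q n + 2)" by (intro poly_bd_intros p q)
    fix z i
    show "length (enc ((h ^^ i) (z, xs z, init z))) \<le> 2 * length (enc z) + 2 * p (length (enc z)) + q (length (enc z)) + 2"
      using b[of z i] p(2)[of z] length_enc_drop[of i "xs z"] unfolding * by simp
  qed (intro PT_intros xs init h)+
  \<comment> \<open>Surplus rounds are harmless: with an empty rest \<open>h\<close> changes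
    nothing, and the code of a list has at least as many symbols as the list has elements.\<close>
  from PT_snd[OF PT_snd[OF this]] show ?thesis
    by (simp add: * length_le_enc)
qed

text \<open>If a step lengthens the accumulator by an amount that depends on the parameter and the
  element only, the growth over the whole list is the number of steps times that amount, hence
  polynomial.\<close>

lemma PT_fold_add:
  fixes xs :: "'a::enc \<Rightarrow> 'b::enc list" and init :: "'a \<Rightarrow> 'c::enc"
  assumes f: "PT (\<lambda>p. f (fst p) (fst (snd p)) (snd (snd p)))" and xs: "PT xs" and init: "PT init"
    and q: "poly_bd q"
    and b: "\<And>z x a. length (enc (f z x a)) \<le> length (enc a) + q (length (enc z) + length (enc x))"
  shows "PT (\<lambda>z. fold (f z) (xs z) (init z))"
proof -
  obtain p where p: "poly_bd p" "\<And>a. length (enc (xs a)) \<le> p (length (enc a))" by (rule PT_length[OF xs]) blast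
  obtain r where r: "poly_bd r" "\<And>a. length (enc (init a)) \<le> r (length (enc a))" by (rule PT_length[OF init]) blast
  show ?thesis
  proof (rule PT_fold[OF f xs init])
    show "poly_bd (\<lambda>n. r n + p n * q (n + p n))"
      by (intro poly_bd_intros poly_bd_comp[OF q] p r)
    fix z :: 'a and n
    let ?B = "q (length (enc z) + p (length (enc z)))"
    have *: "length (enc (fold (f z) ys a)) \<le> length (enc a) + length ys * ?B" if "set ys \<subseteq> set (xs z)" for ys a
      using that
    proof (induction ys arbitrary: a)
      case (Cons y ys)
      have "length (enc y) \<le> p (length (enc z))" using Cons.prems length_enc_mem[of y "xs z"] p(2)[of z] by simp
      then have "q (length (enc z) + length (enc y)) \<le> ?B" by (intro poly_bdD[OF q]) auto
      then have "length (enc (f z y a)) \<le> length (enc a) + ?B" using b[of z y a] by linarith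
      moreover have "length (enc (fold (f z) ys (f z y a))) \<le> length (enc (f z y a)) + length ys * ?B"
        using Cons by simp
      ultimately show ?case by simp
    qed simp
    have "length (enc (fold (f z) (take n (xs z)) (init z))) \<le> length (enc (init z)) + length (take n (xs z)) * ?B"
      by (rule *) (rule set_take_subset)
    also have "\<dots> \<le> r (length (enc z)) + p (length (enc z)) * ?B"
      using length_le_enc[of "xs z"] p(2)[of z] by (intro add_mono r(2) mult_right_mono) auto
    finally show "length (enc (fold (f z) (take n (xs z)) (init z))) \<le> r (length (enc z)) + p (length (enc z)) * ?B" .
  qed
qed

section \<open>List functions and Boolean tests\<close>

lemma PT_rev [PT_intros]: "PT xs \<Longrightarrow> PT (\<lambda>z. rev (xs z))"
proof -
  assume xs: "PT xs"
  have "PT (\<lambda>z. fold (\<lambda>x acc. x # acc) (xs z) [])"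
    \<comment> \<open>\<open>pair_word\<close> doubles its first component and adds a separator,
      hence \<open>2 * n + 1\<close> for one \<open>Cons\<close>.\<close>
    by (rule PT_fold_add[where f = "\<lambda>z x acc. x # acc" and q = "\<lambda>n. 2 * n + 1"])
      (intro PT_intros xs poly_bd_intros | simp)+
  moreover have "fold (\<lambda>x acc. x # acc) ys [] = rev ys" for ys :: "'b list"
    by (simp add: fold_Cons_rev)
  ultimately show ?thesis by simp
qed

lemma PT_append [PT_intros]: "PT xs \<Longrightarrow> PT ys \<Longrightarrow> PT (\<lambda>z. xs z @ ys z)"
proof -
  assume xs: "PT xs" and ys: "PT ys"
  have "PT (\<lambda>z. fold (\<lambda>x acc. x # acc) (rev (xs z)) (ys z))"
    by (rule PT_fold_add[where f = "\<lambda>z x acc. x # acc" and q = "\<lambda>n. 2 * n + 1"])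
      (intro PT_intros xs ys poly_bd_intros | simp)+
  then show ?thesis by (simp add: fold_Cons_rev)
qed

lemma PT_concat_map:
  assumes f: "PT (\<lambda>p. f (fst p) (snd p))" and xs: "PT xs"
  shows "PT (\<lambda>z. concat (map (f z) (xs z)))"
proof -
  obtain p where p: "poly_bd p" "\<And>a. length (enc (f (fst a) (snd a))) \<le> p (length (enc a))"
    by (rule PT_length[OF f]) blast
  have "PT (\<lambda>z. fold (\<lambda>x acc. f z x @ acc) (rev (xs z)) [])"
  proof (rule PT_fold_add)
    show "PT (\<lambda>p. f (fst p) (fst (snd p)) @ snd (snd p))"
      by (intro PT_intros PT_comp2[OF f])
    show "poly_bd (\<lambda>n. p (2 * n + 1))" by (intro poly_bd_intros poly_bd_comp[OF p(1)])
    show "length (enc (f z x @ a)) \<le> length (enc a) + p (2 * (length (enc z) + length (enc x)) + 1)" for z x a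
      using p(2)[of "(z, x)"] poly_bdD[OF p(1), of "length (enc (z, x))" "2 * (length (enc z) + length (enc x)) + 1"] by simp
  qed (intro PT_intros xs)+
  moreover have "fold (\<lambda>x acc. f z x @ acc) (rev ys) [] = concat (map (f z) ys)" for z ys
    by (induction ys) auto
  ultimately show ?thesis by simp
qed

lemma PT_map [PT_intros]:
  assumes f: "PT (\<lambda>p. f (fst p) (snd p))" and xs: "PT xs"
  shows "PT (\<lambda>z. map (f z) (xs z))"
  using PT_concat_map[of "\<lambda>z x. [f z x]", OF _ xs] PT_Cons[OF f PT_const[of "[]"]]
  by (simp add: concat_map_singleton)

lemma PT_concat [PT_intros]: "PT xs \<Longrightarrow> PT (\<lambda>z. concat (xs z))"
  using PT_concat_map[of "\<lambda>z x. x" xs, OF PT_snd[OF PT_id]] by simp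

lemma PT_filter [PT_intros]:
  assumes f: "PT (\<lambda>p. P (fst p) (snd p))" and xs: "PT xs"
  shows "PT (\<lambda>z. filter (P z) (xs z))"
proof -
  have "PT (\<lambda>z. concat (map (\<lambda>x. if P z x then [x] else []) (xs z)))"
    by (rule PT_concat_map) (intro PT_intros f xs)+
  moreover have "concat (map (\<lambda>x. if P z x then [x] else []) ys) = filter (P z) ys" for z ys
    by (induction ys) auto
  ultimately show ?thesis by simp
qed

lemma PT_not [PT_intros]: "PT P \<Longrightarrow> PT (\<lambda>z. \<not> P z)"
proof -
  assume "PT P"
  then have "PT (\<lambda>z. if P z then False else True)" by (intro PT_intros)
  moreover have "(if p then False else True) = (\<not> p)" for p by simp
  ultimately show ?thesis by (simp only:)
qed

lemma PT_conj [PT_intros]: "PT P \<Longrightarrow> PT Q \<Longrightarrow> PT (\<lambda>z. P z \<and> Q z)"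
proof -
  assume "PT P" "PT Q"
  then have "PT (\<lambda>z. if P z then Q z else False)" by (intro PT_intros)
  moreover have "(if p then q else False) = (p \<and> q)" for p q by simp
  ultimately show ?thesis by (simp only:)
qed

lemma PT_disj [PT_intros]: "PT P \<Longrightarrow> PT Q \<Longrightarrow> PT (\<lambda>z. P z \<or> Q z)"
proof -
  assume "PT P" "PT Q"
  then have "PT (\<lambda>z. if P z then True else Q z)" by (intro PT_intros)
  moreover have "(if p then True else q) = (p \<or> q)" for p q by simp
  ultimately show ?thesis by (simp only:)
qed

lemma PT_null [PT_intros]: "PT xs \<Longrightarrow> PT (\<lambda>z. xs z = [])"
proof -
  assume "PT xs"
  then have "PT (\<lambda>z. case xs z of [] \<Rightarrow> True | y # ys \<Rightarrow> False)" by (intro PT_intros)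
  moreover have "(case l of [] \<Rightarrow> True | y # ys \<Rightarrow> False) = (l = [])" for l :: "'b list" by (cases l) auto
  ultimately show ?thesis by (simp only:)
qed

lemma PT_bex [PT_intros]:
  assumes "PT (\<lambda>p. P (fst p) (snd p))" "PT xs"
  shows "PT (\<lambda>z. \<exists>x\<in>set (xs z). P z x)"
  using PT_not[OF PT_null[OF PT_filter[OF assms]]] by (simp add: filter_empty_conv)

lemma PT_ball [PT_intros]:
  assumes "PT (\<lambda>p. P (fst p) (snd p))" "PT xs"
  shows "PT (\<lambda>z. \<forall>x\<in>set (xs z). P z x)"
  using PT_null[OF PT_filter[OF PT_not[OF assms(1)] assms(2)]] by (simp add: filter_empty_conv)

text \<open>\<open>True, b, False\<close> is what \<open>pair_word [b]\<close> puts before the code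
  of the remaining word, so the loop turns a raw word into its code as a list of bits.\<close>

lemma execs_expand:
  assumes "i \<noteq> j"
  shows "execs (Loop i (Push j False ;; Push j False ;; Push j True) (Push j False ;; Push j True ;; Push j True))
    s (Suc (5 * length (s i))) (s(i := [], j := enc (rev (s i)) @ s j))"
proof -
  have b: "execs (Push j False ;; Push j b ;; Push j True) s (1 + (1 + 1)) (s(j := [True, b, False] @ s j))" for b s
    by (rule execs_weaken[OF execs_Seq[OF execs_Push execs_Seq[OF execs_Push execs_Push]]]) (auto simp: fun_eq_iff)
  have *: "execs (if b then Push j False ;; Push j True ;; Push j True else Push j False ;; Push j False ;; Push j True) s (1 + (1 + 1))
      (s(j := [True, b, False] @ s j))" for b s
    using b[of b s] by (cases b) simp_all
  have e: "concat (map (\<lambda>b. [True, b, False]) w) = enc w" for w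
    by (induction w) (auto simp: pair_word_double enc_bool_def)
  from execs_Loop_block[OF assms, where f = "\<lambda>b. [True, b, False]", OF *, of s] show ?thesis
    unfolding e by (rule execs_weaken) auto
qed

text \<open>Makes the code of a value available as data, which is how values of arbitrary type are
  compared and numbered.\<close>

lemma PT_enc [PT_intros]:
  assumes "PT f"
  shows "PT (\<lambda>z. enc (f z))"
proof -
  have "PT (enc :: 'b \<Rightarrow> word)" unfolding PT_def
  proof (rule computesI)
    show "poly_bd (\<lambda>n. 8 * n + 2)" by (intro poly_bd_intros)
    fix a :: 'b and s :: store
    assume s: "\<And>i. 0 < i \<Longrightarrow> i < 2 \<Longrightarrow> s i = []" "s 0 = enc a"
    have s1: "s 1 = []" using s by auto
    have 1: "execs (moveto 0 1) s (Suc (3 * length (enc a))) (s(0 := [], 1 := rev (enc a)))"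
      by (rule execs_weaken[OF execs_moveto]) (use s s1 in \<open>auto simp: fun_eq_iff\<close>)
    have 2: "execs (Loop 1 (Push 0 False ;; Push 0 False ;; Push 0 True) (Push 0 False ;; Push 0 True ;; Push 0 True))
      (s(0 := [], 1 := rev (enc a))) (Suc (5 * length (enc a))) (s(0 := enc (enc a)))"
      by (rule execs_weaken[OF execs_expand]) (use s s1 in \<open>auto simp: fun_eq_iff\<close>)
    show "execs (moveto 0 1 ;; Loop 1 (Push 0 False ;; Push 0 False ;; Push 0 True) (Push 0 False ;; Push 0 True ;; Push 0 True))
      s (8 * length (enc a) + 2) (s(0 := enc (enc a)))"
      by (rule execs_weaken[OF execs_Seq[OF 1 2]]) auto
  qed
  from PT_comp[OF this assms] show ?thesis .
qed

text \<open>On the machine, stack 0 initially holds the input with its last symbol on top.\<close>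

theorem PT_poly_time_computable:
  fixes f :: "word \<Rightarrow> word"
  assumes "PT f"
  shows "poly_time_computable f"
proof -
  obtain c p k where f: "poly_bd p"
    "\<And>a s. (\<And>i. 0 < i \<Longrightarrow> i < k \<Longrightarrow> s i = []) \<Longrightarrow> s 0 = enc a \<Longrightarrow>
        execs c s (p (length (enc a))) (s(0 := enc (f a)))"
    "\<And>a. length (enc (f a)) \<le> length (enc a) + p (length (enc a))"
    by (rule computesE[OF assms[unfolded PT_def]]) blast
  \<comment> \<open>\<open>X\<close> turns the raw input into its code and \<open>Y\<close> turns
    the code of the output back into a raw word. Both leave their result on stack 1; moving it
    through stack 2 to stack 0 reverses it twice, which preserves the order.\<close>
  define X where "X = Loop 0 (Push 1 False ;; Push 1 False ;; Push 1 True) (Push 1 False ;; Push 1 True ;; Push 1 True)"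
  define Y where "Y = Loop 0 Skip (Cond 0 Skip (Cond 0 Skip (Push 1 False) Skip) (Cond 0 Skip (Push 1 True) Skip))"
  define D where "D = X ;; moveto 1 2 ;; moveto 2 0 ;; c ;; Y ;; moveto 1 2 ;; moveto 2 0"
  define B where "B = (\<lambda>n. 3 * n + p (3 * n))"
  define T where "T = (\<lambda>n. 5 * n + 18 * n + p (3 * n) + 13 * B n + 10)"
  have len: "length (enc w) = 3 * length w" for w :: word
    by (induction w) (auto simp: enc_bool_def)
  have Y: "execs Y s (Suc (7 * length w)) (s(0 := [], 1 := rev w @ s 1))" if "s 0 = enc w" for w s
    using that
  proof (induction w arbitrary: s)
    case Nil
    then show ?case unfolding Y_def by (intro execs_weaken[OF execs_Loop_Nil]) (auto simp: fun_eq_iff)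
  next
    case (Cons b w)
    let ?t = "s(0 := enc w, 1 := b # s 1)"
    have s0: "s 0 = True # b # False # enc w" using Cons by (simp add: pair_word_double enc_bool_def)
    have "execs (Push 1 b) (s(0 := enc w)) 1 ?t"
      by (rule execs_weaken[OF execs_Push]) (auto simp: fun_eq_iff)
    then have "execs (Cond 0 Skip (Push 1 b) Skip) (s(0 := False # enc w)) (1 + 2) ?t"
      by (intro execs_Cond_Cons[where b = False and w = "enc w"]) simp_all
    then have "execs (if b then Cond 0 Skip (Push 1 True) Skip else Cond 0 Skip (Push 1 False) Skip) (s(0 := False # enc w)) (1 + 2) ?t"
      by (cases b) simp_all
    then have "execs (Cond 0 Skip (Cond 0 Skip (Push 1 False) Skip) (Cond 0 Skip (Push 1 True) Skip)) (s(0 := b # False # enc w)) (1 + 2 + 2) ?t"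
      by (intro execs_Cond_Cons[where b = b and w = "False # enc w"]) simp_all
    then have 1: "execs (if True then Cond 0 Skip (Cond 0 Skip (Push 1 False) Skip) (Cond 0 Skip (Push 1 True) Skip) else Skip)
        (s(0 := b # False # enc w)) (1 + 2 + 2) ?t" by simp
    have 2: "execs Y ?t (Suc (7 * length w)) (?t(0 := [], 1 := rev w @ ?t 1))" by (rule Cons.IH) simp
    show ?case unfolding Y_def
      by (rule execs_weaken[OF execs_Loop_Cons[OF s0 1 2[unfolded Y_def]]]) (auto simp: fun_eq_iff)
  qed
  show ?thesis
  proof (rule exec_poly_time_computable)
    show "poly_bd T" unfolding T_def B_def
      by (intro poly_bd_intros poly_bd_comp[OF f(1)])
    fix x :: word
    have y: "3 * length (f x) \<le> B (length x)" using f(3)[of x] by (simp add: len B_def)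
    let ?s = single_store
    have 1: "execs X (?s (rev x)) (Suc (5 * length x)) ((\<lambda>_. [])(1 := enc x))"
      unfolding X_def by (rule execs_weaken[OF execs_expand]) (auto simp: fun_eq_iff)
    have 2: "execs (moveto 1 2) ((\<lambda>_. [])(1 := enc x)) (Suc (9 * length x)) ((\<lambda>_. [])(2 := rev (enc x)))"
      by (rule execs_weaken[OF execs_moveto]) (auto simp: fun_eq_iff len)
    have 3: "execs (moveto 2 0) ((\<lambda>_. [])(2 := rev (enc x))) (Suc (9 * length x)) (?s (enc x))"
      by (rule execs_weaken[OF execs_moveto]) (auto simp: fun_eq_iff len)
    have 4: "execs c (?s (enc x)) (p (3 * length x)) (?s (enc (f x)))"
      by (rule execs_weaken[OF f(2)]) (auto simp: fun_eq_iff len)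
    have 5: "execs Y (?s (enc (f x))) (Suc (7 * length (f x))) ((\<lambda>_. [])(1 := rev (f x)))"
      by (rule execs_weaken[OF Y]) (auto simp: fun_eq_iff)
    have 6: "execs (moveto 1 2) ((\<lambda>_. [])(1 := rev (f x))) (Suc (3 * length (f x))) ((\<lambda>_. [])(2 := f x))"
      by (rule execs_weaken[OF execs_moveto]) (auto simp: fun_eq_iff len)
    have 7: "execs (moveto 2 0) ((\<lambda>_. [])(2 := f x)) (Suc (3 * length (f x))) (?s (rev (f x)))"
      by (rule execs_weaken[OF execs_moveto]) (auto simp: fun_eq_iff len)
    note * = execs_Seq[OF 1 execs_Seq[OF 2 execs_Seq[OF 3 execs_Seq[OF 4 execs_Seq[OF 5 execs_Seq[OF 6 7]]]]]]
    have "execs D (?s (rev x)) (T (length x)) (?s (rev (f x)))"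
      unfolding D_def by (rule execs_weaken[OF *]) (use y in \<open>auto simp: T_def\<close>)
    then show "\<exists>n\<le>T (length x). exec D (?s (rev x)) n (?s (rev (f x)))"
      unfolding execs_def .
  qed
qed

section \<open>Binary numbers, comparison and sorting\<close>

lemma PT_change: "PT f \<Longrightarrow> (\<And>x. enc (f x) = enc (g x)) \<Longrightarrow> PT g"
  unfolding PT_def computes_def by simp

lemma PT_bin [PT_intros]: "PT f \<Longrightarrow> PT (\<lambda>z. bin (f z))"
  by (rule PT_change, assumption) (simp add: enc_nat_def)

text \<open>Bits are stored with the least significant bit first, so these are the leading zeros.\<close>

definition strip :: "word \<Rightarrow> word" where
  "strip w = foldr (\<lambda>b w. if w = [] \<and> \<not> b then [] else b # w) w []"

lemma strip_simps: "strip [] = []" "strip (b # w) = (if strip w = [] \<and> \<not> b then [] else b # strip w)"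
  by (simp_all add: strip_def)

lemma strip_eq_Nil: "strip w = [] \<longleftrightarrow> of_bits w = 0"
  by (induction w) (auto simp: strip_simps)

lemma bin_of_bits: "bin (of_bits w) = strip w"
proof (induction w)
  case Nil
  then show ?case by (subst bin.simps) (simp add: strip_simps)
next
  case (Cons b w)
  show ?case
  proof (cases "of_bits w = 0 \<and> \<not> b")
    case True
    then show ?thesis by (subst bin.simps) (simp add: strip_simps strip_eq_Nil)
  next
    case False
    have "(of_bool b + 2 * of_bits w) div 2 = of_bits w" "odd (of_bool b + 2 * of_bits w) = b"
      by (cases b; simp)+
    then show ?thesis using False Cons by (subst bin.simps) (auto simp: strip_simps strip_eq_Nil)
  qed
qed

lemma PT_strip: "PT strip"
proof -
  have "PT (\<lambda>z. fold (\<lambda>b w. if w = [] \<and> \<not> b then [] else b # w) (rev z) [])"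
    by (rule PT_fold_add[where f = "\<lambda>_ b w. if w = [] \<and> \<not> b then [] else b # w" and q = "\<lambda>n. 2 * n + 1"])
      (intro PT_intros poly_bd_intros | simp)+
  then show ?thesis unfolding strip_def[abs_def] by (simp add: foldr_conv_fold)
qed

lemma PT_of_bits [PT_intros]: "PT f \<Longrightarrow> PT (\<lambda>z. of_bits (f z))"
  by (rule PT_change[OF PT_comp[OF PT_strip]]) (simp_all add: enc_nat_def bin_of_bits)

lemma PT_tl [PT_intros]:
  assumes "PT xs"
  shows "PT (\<lambda>z. tl (xs z))"
  unfolding tl_def by (intro PT_intros assms)

text \<open>Unlike \<open>hd\<close> it has a specified value on the empty list.\<close>

definition first :: "'a list list \<Rightarrow> 'a list" where
  "first xs = (case xs of [] \<Rightarrow> [] | y # ys \<Rightarrow> y)"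

lemma first_Cons [simp]: "first (x # xs) = x"
  by (simp add: first_def)

lemma PT_first [PT_intros]:
  assumes "PT xs"
  shows "PT (\<lambda>z. first (xs z))"
  unfolding first_def by (intro PT_intros assms)

lemma PT_butlast [PT_intros]:
  assumes "PT xs"
  shows "PT (\<lambda>z. butlast (xs z))"
proof -
  have "butlast ys = rev (tl (rev ys))" for ys :: "'b list"
    using butlast_rev[of "rev ys"] by simp
  then show ?thesis by (simp only:) (intro PT_intros assms)
qed

lemma PT_iff [PT_intros]: "PT P \<Longrightarrow> PT Q \<Longrightarrow> PT (\<lambda>z. P z = Q z)" for P :: "'a::enc \<Rightarrow> bool"
proof -
  assume "PT P" "PT Q"
  then have "PT (\<lambda>z. if P z then Q z else \<not> Q z)" by (intro PT_intros)
  moreover have "(if p then q else \<not> q) = (p = q)" for p q by simp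
  ultimately show ?thesis by (simp only:)
qed

definition eq_step :: "bool \<Rightarrow> bool \<times> word \<Rightarrow> bool \<times> word" where
  "eq_step x a = (case snd a of [] \<Rightarrow> (False, []) | y # ys \<Rightarrow> (fst a \<and> x = y, ys))"

lemma eq_step_simps [simp]:
  "eq_step x (c, []) = (False, [])" "eq_step x (c, y # ys) = (c \<and> x = y, ys)"
  by (simp_all add: eq_step_def)

text \<open>By injectivity it suffices to compare the codes. One is folded over while the other is
  consumed from the accumulator; a mismatch sets the flag to \<open>False\<close> for good, and
  symbols left over mean that the second code is longer.\<close>

lemma PT_eq [PT_intros]:
  assumes "PT f" "PT g"
  shows "PT (\<lambda>z. f z = g z)"
proof -
  have *: "PT (\<lambda>z. fold eq_step (fst z) (True, snd z))" 
  proof (rule PT_fold_add[where f = "\<lambda>_. eq_step" and q = "\<lambda>_. 0"])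
    show "PT (\<lambda>p. eq_step (fst (snd p)) (snd (snd p)))" unfolding eq_step_def
      by (intro PT_intros)
  qed (intro PT_intros poly_bd_const | simp add: eq_step_def enc_bool_def enc_prod_def split: list.splits)+
  have f: "fst (fold eq_step xs (False, ys)) = False" for xs ys
    by (induction xs arbitrary: ys) (auto simp: eq_step_def[of _ "(_, _)"] split: list.splits)
  have **: "(fst (fold eq_step xs (True, ys)) \<and> snd (fold eq_step xs (True, ys)) = []) = (xs = ys)" for xs ys
  proof (induction xs arbitrary: ys)
    case (Cons x xs)
    then show ?case by (cases ys; cases "x = hd ys") (auto simp: f)
  qed auto
  have "PT (\<lambda>z. (\<lambda>p. fst (fold eq_step (fst p) (True, snd p)) \<and> snd (fold eq_step (fst p) (True, snd p)) = []) (enc (f z), enc (g z)))"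
    by (rule PT_comp[where f = "\<lambda>z. (enc (f z), enc (g z))"]) (intro PT_intros assms *)+
  then have "PT (\<lambda>z. enc (f z) = enc (g z))" by (simp add: **)
  moreover have "(enc (f z) = enc (g z)) = (f z = g z)" for z by (auto dest: enc_inj)
  ultimately show ?thesis by simp
qed

lemma PT_member [PT_intros]:
  assumes "PT f" "PT xs"
  shows "PT (\<lambda>z. f z \<in> set (xs z))"
proof -
  have "PT (\<lambda>z. \<exists>x\<in>set (xs z). f z = x)"
    by (intro PT_intros assms PT_comp[OF assms(1)])
  then show ?thesis by simp
qed

text \<open>Digits come least significant first, so the verdict on the lower digits stands as long
  as the digits agree and is overwritten by each difference. Missing digits of the second number
  count as zeros.\<close>

definition less_step :: "bool \<Rightarrow> bool \<times> word \<Rightarrow> bool \<times> word" where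
  "less_step x a = (case snd a of [] \<Rightarrow> (if x then False else fst a, []) | y # ys \<Rightarrow> (if x = y then fst a else y, ys))"

lemma less_step_simps [simp]:
  "less_step x (c, []) = (if x then False else c, [])"
  "less_step x (c, y # ys) = (if x = y then c else y, ys)"
  by (simp_all add: less_step_def)

text \<open>A nonzero digit left over makes the second number larger regardless of the verdict;
  otherwise the verdict decides, and \<open>c\<close> is its initial value for ties.\<close>

lemma fold_less_step:
  "(let r = fold less_step xs (c, ys) in fst r \<and> (\<forall>b\<in>set (snd r). \<not> b) \<or> (\<exists>b\<in>set (snd r). b))
    \<longleftrightarrow> (if of_bits xs = of_bits ys then c else of_bits xs < of_bits ys)"
proof (induction xs arbitrary: c ys)
  case Nil
  have "of_bits ys = 0 \<longleftrightarrow> (\<forall>b\<in>set ys. \<not> b)" by (induction ys) auto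
  then show ?case by auto
next
  case (Cons x xs)
  show ?case
  proof (cases ys)
    case Nil
    then show ?thesis using Cons[of "if x then False else c" "[]"] by (cases x) simp_all
  next
    case (Cons y zs)
    have "(if of_bits (x # xs) = of_bits (y # zs) then c else of_bits (x # xs) < of_bits (y # zs))
       = (if of_bits xs = of_bits zs then if x = y then c else y else of_bits xs < of_bits zs)"
      by (cases x; cases y; auto; presburger)
    then show ?thesis using Cons.IH[of "if x = y then c else y" zs]
      unfolding Cons by (simp del: of_bits.simps)
  qed
qed

lemma PT_less [PT_intros]:
  fixes f g :: "'a::enc \<Rightarrow> nat"
  assumes "PT f" "PT g"
  shows "PT (\<lambda>z. f z < g z)"
proof -
  have *: "PT (\<lambda>z. fold less_step (fst z) (False, snd z))" 
  proof (rule PT_fold_add[where f = "\<lambda>_. less_step" and q = "\<lambda>_. 0"])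
    show "PT (\<lambda>p. less_step (fst (snd p)) (snd (snd p)))" unfolding less_step_def
      by (intro PT_intros)
  qed (intro PT_intros poly_bd_const | simp add: less_step_def enc_bool_def enc_prod_def split: list.splits)+
  have "PT (\<lambda>z. (\<lambda>r. fst r \<and> (\<forall>b\<in>set (snd r). \<not> b) \<or> (\<exists>b\<in>set (snd r). b))
    ((\<lambda>p. fold less_step (fst p) (False, snd p)) (bin (f z), bin (g z))))"
    by (rule PT_comp[OF _ PT_comp[OF *]]) (intro PT_intros assms)+
  moreover have "(\<lambda>r. fst r \<and> (\<forall>b\<in>set (snd r). \<not> b) \<or> (\<exists>b\<in>set (snd r). b))
    ((\<lambda>p. fold less_step (fst p) (False, snd p)) (bin m, bin n)) \<longleftrightarrow> m < n" for m n
    using fold_less_step[of "bin m" False "bin n"] by (simp add: Let_def split: if_splits)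
  ultimately show ?thesis by (simp only:)
qed

text \<open>Two filters replace recursion. Both tests are strict, so an old copy of \<open>x\<close>
  disappears and the result has no duplicates.\<close>

definition insert_sorted :: "nat \<Rightarrow> nat list \<Rightarrow> nat list" where
  "insert_sorted x xs = filter (\<lambda>y. y < x) xs @ x # filter (\<lambda>y. x < y) xs"

lemma insert_sorted_list_of_set:
  assumes "finite A"
  shows "insert_sorted x (sorted_list_of_set A) = sorted_list_of_set (insert x A)"
proof (rule strict_sorted_equal)
  show "sorted_wrt (<) (sorted_list_of_set (insert x A))" by (rule strict_sorted_list_of_set)
  show "sorted_wrt (<) (insert_sorted x (sorted_list_of_set A))"
    unfolding insert_sorted_def using strict_sorted_list_of_set[of A]
    by (auto simp: sorted_wrt_append sorted_wrt_filter)
  show "set (insert_sorted x (sorted_list_of_set A)) = set (sorted_list_of_set (insert x A))"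
    using assms by (auto simp: insert_sorted_def simp del: sorted_list_of_set_insert_remove)
qed

lemma fold_insert_sorted: "fold insert_sorted xs [] = sorted_list_of_set (set xs)"
proof -
  have "finite A \<Longrightarrow> fold insert_sorted xs (sorted_list_of_set A) = sorted_list_of_set (set xs \<union> A)" for A
  proof (induction xs arbitrary: A)
    case (Cons x xs)
    have "fold insert_sorted (x # xs) (sorted_list_of_set A) = fold insert_sorted xs (sorted_list_of_set (insert x A))"
      unfolding fold_simps insert_sorted_list_of_set[OF Cons.prems] ..
    also have "\<dots> = sorted_list_of_set (set xs \<union> insert x A)" by (rule Cons.IH) (use Cons.prems in simp)
    also have "set xs \<union> insert x A = set (x # xs) \<union> A" by auto
    finally show ?case .
  qed simp
  from this[of "{}"] show ?thesis by simp
qed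

text \<open>Each element is kept by at most one of the filters; this gives the additive growth bound
  for \<open>insert_sorted\<close>.\<close>

lemma length_enc_filter: 
  assumes "\<And>x. \<not> (P x \<and> Q x)"
  shows "length (enc (filter P xs)) + length (enc (filter Q xs)) \<le> length (enc xs)"
  using assms by (induction xs) (auto simp: add_mono)

lemma PT_sorted_list_of_set [PT_intros]:
  fixes xs :: "'a::enc \<Rightarrow> nat list"
  assumes "PT xs"
  shows "PT (\<lambda>z. sorted_list_of_set (set (xs z)))" 
  unfolding fold_insert_sorted[symmetric]
proof (rule PT_fold_add[where f = "\<lambda>_. insert_sorted"])
  show "PT (\<lambda>p. insert_sorted (fst (snd p)) (snd (snd p)))" unfolding insert_sorted_def
    by (intro PT_intros)
  show "poly_bd (\<lambda>n. 2 * n + 1)" by (intro poly_bd_intros)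
  show "length (enc (insert_sorted x a)) \<le> length (enc a) + (2 * (length (enc z) + length (enc x)) + 1)" for z :: 'a and x a
    using length_enc_filter[of "\<lambda>y. y < x" "\<lambda>y. x < y" a] by (auto simp: insert_sorted_def)
qed (intro PT_intros assms)+

text \<open>The final \<open>True\<close> preserves the leading zeros of a code.\<close>

definition natcode :: "'a::enc \<Rightarrow> nat" where
  "natcode x = of_bits (enc x @ [True])"

lemma natcode_inj: "natcode x = natcode y \<longleftrightarrow> x = y"
proof -
  have "strip (w @ [True]) = w @ [True]" for w by (induction w) (auto simp: strip_simps)
  then have "bin (natcode x) = enc x @ [True]" for x :: 'a by (simp add: natcode_def bin_of_bits)
  then show ?thesis by (metis append_same_eq enc_inj append1_eq_conv)
qed

lemma natcode_neq_0 [simp]: "natcode x \<noteq> 0" "0 \<noteq> natcode x"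
proof -
  have "of_bits (w @ [True]) \<noteq> 0" for w by (induction w) auto
  then show "natcode x \<noteq> 0" "0 \<noteq> natcode x" by (simp_all add: natcode_def)
qed

lemma PT_natcode [PT_intros]: "PT f \<Longrightarrow> PT (\<lambda>z. natcode (f z))"
  unfolding natcode_def by (intro PT_intros)

section \<open>Reading and writing trees\<close>

type_synonym tok = "bool \<times> bool \<times> bool"

abbreviation (input) "tN \<equiv> (False, True, False)"
abbreviation (input) "tL \<equiv> (False, True, True)"
abbreviation (input) "tE \<equiv> (True, False, False)"

primrec toks :: "tree \<Rightarrow> tok list" where
  "toks (TNat n) = tN # map (\<lambda>b. (False, False, b)) (bin n) @ [tE]"
| "toks (TList ts) = tL # concat (map toks ts) @ [tE]"

fun chunk :: "word \<Rightarrow> tok list" where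
  "chunk (a # b # c # w) = (a, b, c) # chunk w"
| "chunk _ = []"

lemma enc_tree_toks: "enc_tree t = concat (map (\<lambda>(a, b, c). [a, b, c]) (toks t))"
proof (induction t)
  case (TNat n)
  have "enc_bits w = concat (map (\<lambda>(a, b, c). [a, b, c]) (map (\<lambda>b. (False, False, b)) w))" for w
    by (induction w) (auto simp: enc_bits_def tok0_def tok1_def)
  then show ?case by (simp add: tokN_def tokE_def)
next
  case (TList ts)
  then have "concat (map enc_tree ts) = concat (map (\<lambda>(a, b, c). [a, b, c]) (concat (map toks ts)))"
    by (induction ts) auto
  then show ?case by (simp add: tokL_def tokE_def)
qed

lemma chunk_enc_tree [simp]: "chunk (enc_tree t) = toks t"
proof -
  have "chunk (concat (map (\<lambda>(a, b, c). [a, b, c]) ts)) = ts" for ts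
    by (induction ts) auto
  then show ?thesis by (simp add: enc_tree_toks)
qed

definition chunk_step :: "bool \<Rightarrow> word \<times> tok list \<Rightarrow> word \<times> tok list" where
  "chunk_step x a = (case fst a of [] \<Rightarrow> ([x], snd a) | y # r \<Rightarrow>
     (case r of [] \<Rightarrow> ([y, x], snd a) | z # r' \<Rightarrow> ([], (y, z, x) # snd a)))"

lemma chunk_fold: "chunk w = rev (snd (fold chunk_step w ([], [])))"
proof -
  have "rev (snd (fold chunk_step w ([], ts))) = rev ts @ chunk w" for ts
    by (induction w arbitrary: ts rule: chunk.induct) (auto simp: chunk_step_def)
  then show ?thesis by simp
qed

lemma PT_chunk: "PT chunk"
  unfolding chunk_fold
proof (intro PT_intros, rule PT_fold_add[where f = "\<lambda>_. chunk_step" and q = "\<lambda>_. 20"])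
  show "PT (\<lambda>p. chunk_step (fst (snd p)) (snd (snd p)))" unfolding chunk_step_def
    by (intro PT_intros)
qed (intro PT_intros poly_bd_const | simp add: chunk_step_def enc_bool_def enc_prod_def split: list.splits)+

text \<open>The tokens are read from right to left; the first component of the state is the nesting depth in
  unary.\<close>

definition item_step :: "tok \<Rightarrow> unit list \<times> tok list list \<Rightarrow> unit list \<times> tok list list" where
  "item_step t a = (if t = tE then () # fst a else if t = tN \<or> t = tL then tl (fst a) else fst a,
     if fst a = [] then [t] # snd a else (t # first (snd a)) # tl (snd a))"

definition items :: "tok list \<Rightarrow> tok list list" where
  "items ts = snd (foldr item_step ts ([], []))"

lemma foldr_item_step_bits:
  assumes "d \<noteq> []"
  shows "foldr item_step (map (\<lambda>b. (False, False, b)) w) (d, u # us) = (d, (map (\<lambda>b. (False, False, b)) w @ u) # us)"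
  using assms by (induction w) (auto simp: item_step_def)

text \<open>Inside an item a complete tree restores the depth, so all of its tokens join the current
  item.\<close>

lemma foldr_item_step_inner:
  "d \<noteq> [] \<Longrightarrow> foldr item_step (toks t) (d, u # us) = (d, (toks t @ u) # us)"
proof (induction t arbitrary: d u)
  case (TNat n)
  then show ?case by (simp add: foldr_item_step_bits item_step_def[of tE] item_step_def[of tN])
next
  case (TList ts)
  have "foldr item_step (concat (map toks ts)) (() # d, u # us) = (() # d, (concat (map toks ts) @ u) # us)" for u
    using TList.IH by (induction ts) auto
  with TList.prems show ?case by (simp add: item_step_def[of tE] item_step_def[of tL])
qed

text \<open>At depth zero the closing token \<open>tE\<close> of a tree is met first and opens a new
  item; the matching \<open>tN\<close> or \<open>tL\<close> brings the depth back to zero.\<close>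

lemma foldr_item_step_toks: "foldr item_step (toks t) ([], us) = ([], toks t # us)"
proof (cases t)
  case (TNat n)
  then show ?thesis by (simp add: foldr_item_step_bits item_step_def[of tE] item_step_def[of tN])
next
  case (TList ts)
  have "d \<noteq> [] \<Longrightarrow> foldr item_step (concat (map toks ts)) (d, u # us) = (d, (concat (map toks ts) @ u) # us)" for u d
    by (induction ts) (auto simp: foldr_item_step_inner)
  then show ?thesis using TList by (simp add: item_step_def[of tE] item_step_def[of tL])
qed

lemma items_concat [simp]: "items (concat (map toks ts)) = map toks ts"
proof -
  have "foldr item_step (concat (map toks ts)) ([], []) = ([], map toks ts)"
    by (induction ts) (auto simp: foldr_item_step_toks)
  then show ?thesis by (simp add: items_def)
qed

lemma PT_items [PT_intros]: "PT f \<Longrightarrow> PT (\<lambda>z. items (f z))"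
proof -
  have "PT (\<lambda>z. fold item_step (rev z) ([], []))"
  proof (rule PT_fold_add[where f = "\<lambda>_. item_step"])
    show "PT (\<lambda>p. item_step (fst (snd p)) (snd (snd p)))" unfolding item_step_def
      by (intro PT_intros)
    show "poly_bd (\<lambda>n. 4 * n + 10)" by (intro poly_bd_intros)
    show "length (enc (item_step x a)) \<le> length (enc a) + (4 * (length (enc z) + length (enc x)) + 10)"
      for z :: "tok list" and x a
    proof -
      have 1: "length (enc (if x = tE then () # fst a else if x = tN \<or> x = tL then tl (fst a) else fst a)) \<le> Suc (length (enc (fst a)))"
        by (cases "fst a") (auto simp: enc_unit_def)
      have 2: "length (enc (if fst a = [] then [x] # snd a else (x # first (snd a)) # tl (snd a))) \<le> length (enc (snd a)) + (4 * length (enc x) + 3)"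
        by (cases "snd a") (auto simp: first_def simp del: enc_prod_def)
      have *: "2 * A + B + 1 \<le> 2 * F + S + 1 + (4 * (Z + X) + 10)" if "A \<le> Suc F" "B \<le> S + (4 * X + 3)" for A B F S X Z :: nat
        using that by simp
      show ?thesis unfolding item_step_def enc_Pair length_pair_word enc_prod_def[of a] by (rule *[OF 1 2])
    qed
  qed (intro PT_intros)+
  then have "PT items" unfolding items_def[abs_def] foldr_conv_fold by (intro PT_intros)
  then show "PT f \<Longrightarrow> PT (\<lambda>z. items (f z))" by (rule PT_comp)
qed

text \<open>The decoder works on tokens so that the decoder of a compound tree can hand slices to
  those of its parts. It is built along the type of the data, which avoids a recursion over
  arbitrary trees.\<close>

definition codable :: "('a::enc \<Rightarrow> tree) \<Rightarrow> bool" where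
  "codable rep \<longleftrightarrow> PT (\<lambda>x. enc_tree (rep x)) \<and> (\<exists>d. PT d \<and> (\<forall>x. d (toks (rep x)) = x))"

lemma codable_TNat: "codable TNat"
  unfolding codable_def
proof
  show "PT (\<lambda>n. enc_tree (TNat n))" unfolding enc_tree.simps enc_bits_def
    by (intro PT_intros)
  have "PT (\<lambda>ts :: tok list. of_bits (map (\<lambda>t. snd (snd t)) (butlast (tl ts))))"
    by (intro PT_intros)
  moreover have "\<forall>n. of_bits (map (\<lambda>t. snd (snd t)) (butlast (tl (toks (TNat n))))) = n"
    by (simp add: butlast_append comp_def)
  ultimately show "\<exists>d. PT d \<and> (\<forall>x. d (toks (TNat x)) = x)" by blast
qed

lemma codable_list:
  assumes "codable r"
  shows "codable (\<lambda>xs. TList (map r xs))"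
  unfolding codable_def
proof
  from assms obtain d where r: "PT (\<lambda>x. enc_tree (r x))" and d: "PT d" "\<And>x. d (toks (r x)) = x"
    unfolding codable_def by blast
  show "PT (\<lambda>xs. enc_tree (TList (map r xs)))" unfolding enc_tree.simps map_map comp_def
    by (intro PT_intros PT_comp[OF r])
  have "PT (\<lambda>ts. map d (items (butlast (tl ts))))"
    by (intro PT_intros PT_comp[OF d(1)])
  moreover have "items (butlast (tl (toks (TList (map r xs))))) = map (\<lambda>x. toks (r x)) xs" for xs
    using items_concat[of "map r xs"] by (simp add: butlast_append comp_def del: items_concat)
  then have "\<forall>xs. map d (items (butlast (tl (toks (TList (map r xs)))))) = xs"
    by (simp add: comp_def d del: toks.simps)
  ultimately show "\<exists>d. PT d \<and> (\<forall>x. d (toks (TList (map r x))) = x)" by blast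
qed

lemma codable_pair:
  assumes "codable r" "codable r'"
  shows "codable (\<lambda>p. TList [r (fst p), r' (snd p)])"
  unfolding codable_def
proof
  from assms(1) obtain d where r: "PT (\<lambda>x. enc_tree (r x))" and d: "PT d" "\<And>x. d (toks (r x)) = x"
    unfolding codable_def by blast
  from assms(2) obtain d' where r': "PT (\<lambda>x. enc_tree (r' x))" and d': "PT d'" "\<And>x. d' (toks (r' x)) = x"
    unfolding codable_def by blast
  show "PT (\<lambda>p. enc_tree (TList [r (fst p), r' (snd p)]))" unfolding enc_tree.simps list.map concat.simps
    by (intro PT_intros PT_comp[OF r] PT_comp[OF r'])
  have "PT (\<lambda>ts. (d (first (items (butlast (tl ts)))), d' (first (tl (items (butlast (tl ts)))))))"
    by (intro PT_intros PT_comp[OF d(1)] PT_comp[OF d'(1)])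
  moreover have "items (butlast (tl (toks (TList [t, t'])))) = [toks t, toks t']" for t t'
    using items_concat[of "[t, t']"] by (simp add: butlast_append del: items_concat)
  then have "\<forall>p. (\<lambda>ts. (d (first (items (butlast (tl ts)))), d' (first (tl (items (butlast (tl ts)))))))
      (toks (TList [r (fst p), r' (snd p)])) = p"
    by (simp add: d d' del: toks.simps)
  ultimately show "\<exists>d. PT d \<and> (\<forall>x. d (toks (TList [r (fst x), r' (snd x)])) = x)" by blast
qed

lemma codable_decode:
  assumes "codable rep"
  obtains d :: "word \<Rightarrow> 'a::enc" where "PT d" "\<And>x. d (enc_tree (rep x)) = x"
proof -
  from assms obtain d where d: "PT d" "\<And>x. d (toks (rep x)) = x"
    unfolding codable_def by blast
  have "PT (\<lambda>w. d (chunk w))" by (rule PT_comp[OF d(1) PT_chunk])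
  then show ?thesis by (rule that) (simp add: d)
qed

section \<open>Reductions between encoded enumeration problems\<close>

definition unpair_step :: "bool \<Rightarrow> word \<times> word \<times> word \<Rightarrow> word \<times> word \<times> word" where
  "unpair_step b a = (case fst a of [] \<Rightarrow> ([b], snd a)
     | k # r \<Rightarrow> if k then ([], b # fst (snd a), snd (snd a)) else ([k], fst (snd a), b # snd (snd a)))"

lemma unpair_step_simps [simp]:
  "unpair_step b ([], p) = ([b], p)" "unpair_step b ([True], us, vs) = ([], b # us, vs)"
  "unpair_step b ([False], us, vs) = ([False], us, b # vs)"
  by (simp_all add: unpair_step_def)

text \<open>The first component of the state holds the pending control bit. \<open>[True]\<close>
  sends the next bit to the first word and is then erased; \<open>[False]\<close>, the separator,
  stays and sends all remaining bits to the second word.\<close>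

lemma PT_unpair: "\<exists>u. PT u \<and> (\<forall>x y. u (pair_word x y) = (x, y))"
proof -
  have "PT (\<lambda>w. fold unpair_step w ([], [], []))"
  proof (rule PT_fold_add[where f = "\<lambda>_. unpair_step" and q = "\<lambda>_. 20"])
    show "PT (\<lambda>p. unpair_step (fst (snd p)) (snd (snd p)))" unfolding unpair_step_def
      by (intro PT_intros)
  qed (intro PT_intros poly_bd_const | auto simp: unpair_step_def enc_bool_def enc_prod_def split: list.splits)+
  then have "PT (\<lambda>w. (\<lambda>a. (rev (fst (snd a)), rev (snd (snd a)))) (fold unpair_step w ([], [], [])))"
    by (intro PT_intros)
  moreover have f: "fold unpair_step y ([False], us, vs) = ([False], us, rev y @ vs)" for y us vs
    by (induction y arbitrary: vs) auto
  have "fold unpair_step (pair_word x y) ([], us, []) = ([False], rev x @ us, rev y)" for x y us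
    by (induction x arbitrary: us) (auto simp: pair_word_double f)
  ultimately show ?thesis by fastforce
qed

text \<open>Separating the two arguments of \<open>g\<close> makes transitivity a plain composition;
  pairing as raw words is only dealt with once, in the passage to
  \<open>parsimonious_reduction\<close>.\<close>

definition pt_reduction :: "enum_problem \<Rightarrow> enum_problem \<Rightarrow> bool" where
  "pt_reduction P Q \<longleftrightarrow> (\<exists>f g. PT f \<and> PT (\<lambda>p. g (fst p) (snd p)) \<and>
     (\<forall>I\<in>inst P. f I \<in> inst Q \<and> bij_betw (g I) (sols Q (f I)) (sols P I)))"

lemma pt_reduction_parsimonious:
  assumes "pt_reduction P Q"
  shows "parsimonious_reduction P Q"
proof -
  obtain f g where fg: "PT f" "PT (\<lambda>p. g (fst p) (snd p))"
    "\<And>I. I \<in> inst P \<Longrightarrow> f I \<in> inst Q \<and> bij_betw (g I) (sols Q (f I)) (sols P I)"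
    using assms unfolding pt_reduction_def by blast
  obtain u where u: "PT u" "\<And>x y. u (pair_word x y) = (x, y)"
    using PT_unpair by blast
  have "PT (\<lambda>w. g (fst (u w)) (snd (u w)))" by (rule PT_comp[OF fg(2) u(1)])
  then have "poly_time_computable (\<lambda>w. g (fst (u w)) (snd (u w)))" by (rule PT_poly_time_computable)
  moreover have "poly_time_computable f" by (rule PT_poly_time_computable[OF fg(1)])
  moreover have "f I \<in> inst Q \<and> bij_betw (\<lambda>y. g (fst (u (pair_word I y))) (snd (u (pair_word I y)))) (sols Q (f I)) (sols P I)"
    if "I \<in> inst P" for I using fg(3)[OF that] by (simp add: u(2))
  ultimately show ?thesis unfolding parsimonious_reduction_def by blast
qed

lemma pt_reduction_trans:
  assumes "pt_reduction P Q" "pt_reduction Q R"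
  shows "pt_reduction P R"
proof -
  obtain f g where fg: "PT f" "PT (\<lambda>p. g (fst p) (snd p))"
    "\<And>I. I \<in> inst P \<Longrightarrow> f I \<in> inst Q \<and> bij_betw (g I) (sols Q (f I)) (sols P I)"
    using assms(1) unfolding pt_reduction_def by blast
  obtain f' g' where fg': "PT f'" "PT (\<lambda>p. g' (fst p) (snd p))"
    "\<And>I. I \<in> inst Q \<Longrightarrow> f' I \<in> inst R \<and> bij_betw (g' I) (sols R (f' I)) (sols Q I)"
    using assms(2) unfolding pt_reduction_def by blast
  have "PT (\<lambda>I. f' (f I))" by (rule PT_comp[OF fg'(1) fg(1)])
  moreover have "PT (\<lambda>p. g (fst p) (g' (f (fst p)) (snd p)))"
    by (rule PT_comp2[OF fg(2)], intro PT_intros, rule PT_comp2[OF fg'(2)], rule PT_comp[OF fg(1)]) (intro PT_intros)+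
  moreover have "f' (f I) \<in> inst R \<and> bij_betw (\<lambda>y. g I (g' (f I) y)) (sols R (f' (f I))) (sols P I)"
    if "I \<in> inst P" for I
    using fg(3)[OF that] fg'(3)[of "f I"] bij_betw_trans[of "g' (f I)" _ _ "g I"] by (auto simp: comp_def)
  ultimately show ?thesis unfolding pt_reduction_def
    by (intro exI[of _ "\<lambda>I. f' (f I)"] exI[of _ "\<lambda>I y. g I (g' (f I) y)"]) simp
qed

text \<open>A decoder makes the encoding of instances injective, so the union over all instances
  with the given code has a single member.\<close>

lemma sols_mk_problem:
  assumes "codable rep" "valid a"
  shows "sols (mk_problem rep valid sol encs) (enc_tree (rep a)) = encs ` sol a"
proof -
  obtain d where "\<And>x. d (enc_tree (rep x)) = x" by (rule codable_decode[OF assms(1)]) blast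
  then have "enc_tree (rep b) = enc_tree (rep a) \<longleftrightarrow> b = a" for b by metis
  then show ?thesis using assms(2) by (auto simp: mk_problem_def)
qed

text \<open>Separates mathematics from computation: \<open>F\<close> maps instances,
  \<open>H\<close> is the bijection on abstract solutions, and \<open>G\<close> implements
  \<open>H\<close> on the lists by which solutions are written. \<open>G\<close> has to agree with
  \<open>H\<close> on actual solutions only, and \<open>lst\<close> has to be injective only there,
  so infinite sets do no harm.\<close>

lemma pt_reduction_mk_problem:
  fixes rep :: "'a::enc \<Rightarrow> tree" and rep' :: "'c::enc \<Rightarrow> tree"
    and srep :: "'s::enc \<Rightarrow> tree" and srep' :: "'t::enc \<Rightarrow> tree"
  assumes rep: "codable rep" "codable rep'" and srep: "codable srep" "codable srep'"
    and FG: "PT F" "PT (\<lambda>p. G (fst p) (snd p))"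
    and encs: "\<And>x. encs x = enc_tree (srep (lst x))" "\<And>y. encs' y = enc_tree (srep' (lst' y))"
    and valid: "\<And>a. valid a \<Longrightarrow> valid' (F a)"
    and bij: "\<And>a. valid a \<Longrightarrow> bij_betw (H a) (sol' (F a)) (sol a)"
    and G: "\<And>a y. valid a \<Longrightarrow> y \<in> sol' (F a) \<Longrightarrow> G a (lst' y) = lst (H a y)"
    and inj: "\<And>a. valid a \<Longrightarrow> inj_on lst (sol a)"
  shows "pt_reduction (mk_problem rep valid sol encs) (mk_problem rep' valid' sol' encs')"
proof -
  obtain d where d: "PT d" "\<And>x. d (enc_tree (rep x)) = x" by (rule codable_decode[OF rep(1)]) blast
  obtain e where e: "PT e" "\<And>x. e (enc_tree (srep' x)) = x" by (rule codable_decode[OF srep(2)]) blast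
  obtain e' where e': "\<And>x. e' (enc_tree (srep x)) = x" by (rule codable_decode[OF srep(1)]) blast
  have r: "PT (\<lambda>x. enc_tree (rep' x))" "PT (\<lambda>x. enc_tree (srep x))"
    using rep srep unfolding codable_def by auto
  let ?f = "\<lambda>w. enc_tree (rep' (F (d w)))"
  let ?g = "\<lambda>w y. enc_tree (srep (G (d w) (e y)))"
  have f: "PT ?f" by (rule PT_comp[OF r(1) PT_comp[OF FG(1) d(1)]])
  have g: "PT (\<lambda>p. ?g (fst p) (snd p))"
    by (rule PT_comp[OF r(2) PT_comp2[OF FG(2)]], rule PT_comp[OF d(1)], intro PT_intros, rule PT_comp[OF e(1)], intro PT_intros)
  have "?f I \<in> inst (mk_problem rep' valid' sol' encs') \<and>
      bij_betw (?g I) (sols (mk_problem rep' valid' sol' encs') (?f I)) (sols (mk_problem rep valid sol encs) I)"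
    if "I \<in> inst (mk_problem rep valid sol encs)" for I
  proof -
    from that obtain a where a: "valid a" "I = enc_tree (rep a)" by (auto simp: mk_problem_def)
    have H: "inj_on (H a) (sol' (F a))" "H a ` sol' (F a) = sol a"
      using bij[OF a(1)] by (auto simp: bij_betw_def)
    have g: "?g I (encs' y) = encs (H a y)" if "y \<in> sol' (F a)" for y
      using G[OF a(1) that] by (simp add: a(2) d(2) encs e(2))
    have "inj_on encs (sol a)"
      using inj[OF a(1)] e' unfolding inj_on_def encs by metis
    then have "inj_on (encs \<circ> H a) (sol' (F a))" using H by (intro comp_inj_on) simp_all
    then have "inj_on (?g I \<circ> encs') (sol' (F a))"
      by (rule inj_on_cong[THEN iffD1, rotated]) (simp add: g)
    then have "inj_on (?g I) (encs' ` sol' (F a))" by (rule inj_on_imageI)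
    moreover have "?g I ` encs' ` sol' (F a) = encs ` sol a"
      unfolding image_image H(2)[symmetric] by (rule image_cong[OF refl g])
    moreover have "?f I = enc_tree (rep' (F a))" by (simp add: a(2) d(2))
    moreover have "valid' (F a)" by (rule valid[OF a(1)])
    moreover have "enc_tree (rep' (F a)) \<in> inst (mk_problem rep' valid' sol' encs')"
      using valid[OF a(1)] by (auto simp: mk_problem_def)
    ultimately show ?thesis
      using sols_mk_problem[OF rep(1), of valid, OF a(1), of sol encs]
        sols_mk_problem[OF rep(2), of valid' "F a" sol' encs'] a(2)
      by (simp add: bij_betw_def)
  qed
  with f g show ?thesis unfolding pt_reduction_def
    by (intro exI[of _ ?f] exI[of _ ?g] conjI ballI) simp_all
qed

text \<open>\<open>h\<close> and \<open>k\<close> are mutually inverse and monotone, so each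
  transports maximality: an element above \<open>h x\<close> comes from one above \<open>x\<close>.
  Reverse inclusion as \<open>le'\<close> covers minimal transversals.\<close>

lemma bij_betw_maximal:
  assumes "\<And>x. x \<in> X \<Longrightarrow> h x \<in> Y" "\<And>x. x \<in> X \<Longrightarrow> k (h x) = x"
    and "\<And>y. y \<in> Y \<Longrightarrow> k y \<in> X" "\<And>y. y \<in> Y \<Longrightarrow> h (k y) = y"
    and "\<And>x x'. x \<in> X \<Longrightarrow> x' \<in> X \<Longrightarrow> le x x' \<Longrightarrow> le' (h x) (h x')"
    and "\<And>y y'. y \<in> Y \<Longrightarrow> y' \<in> Y \<Longrightarrow> le' y y' \<Longrightarrow> le (k y) (k y')"
  shows "bij_betw h {x \<in> X. \<forall>x'\<in>X. le x x' \<longrightarrow> x' = x} {y \<in> Y. \<forall>y'\<in>Y. le' y y' \<longrightarrow> y' = y}"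
proof (rule bij_betw_byWitness[where f' = k])
  show "h ` {x \<in> X. \<forall>x'\<in>X. le x x' \<longrightarrow> x' = x} \<subseteq> {y \<in> Y. \<forall>y'\<in>Y. le' y y' \<longrightarrow> y' = y}"
  proof (clarsimp simp: assms(1))
    fix x y assume *: "x \<in> X" "\<forall>x'\<in>X. le x x' \<longrightarrow> x' = x" "y \<in> Y" "le' (h x) y"
    have "le x (k y)" using assms(6)[OF assms(1)[OF *(1)] *(3,4)] unfolding assms(2)[OF *(1)] .
    with *(2) assms(3)[OF *(3)] have "k y = x" by blast
    with assms(4)[OF *(3)] show "y = h x" by simp
  qed
  show "k ` {y \<in> Y. \<forall>y'\<in>Y. le' y y' \<longrightarrow> y' = y} \<subseteq> {x \<in> X. \<forall>x'\<in>X. le x x' \<longrightarrow> x' = x}"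
  proof (clarsimp simp: assms(3))
    fix x y assume *: "y \<in> Y" "\<forall>y'\<in>Y. le' y y' \<longrightarrow> y' = y" "x \<in> X" "le (k y) x"
    have "le' y (h x)" using assms(5)[OF assms(3)[OF *(1)] *(3,4)] unfolding assms(4)[OF *(1)] .
    with *(2) assms(1)[OF *(3)] have "h x = y" by blast
    with assms(2)[OF *(3)] show "x = k y" by simp
  qed
qed (simp_all add: assms(2,4))

definition sat_sets :: "wa3ns \<Rightarrow> nat set set" where
  "sat_sets \<phi> = {A. A \<subseteq> wa3ns_vars \<phi> \<and> wa3ns_sat \<phi> A}"

lemma wa3ns_max_sat_eq: "{A. wa3ns_max_sat \<phi> A} = {A \<in> sat_sets \<phi>. \<forall>B\<in>sat_sets \<phi>. A \<subseteq> B \<longrightarrow> B = A}"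
  unfolding wa3ns_max_sat_def sat_sets_def by blast

lemma is_max_IND_eq: "{\<sigma>. is_max_IND R rr S ss \<sigma>} =
    {\<sigma> \<in> {\<sigma>. is_IND R rr S ss \<sigma>}. \<forall>\<tau>\<in>{\<sigma>. is_IND R rr S ss \<sigma>}. \<sigma> \<subseteq>\<^sub>m \<tau> \<longrightarrow> \<tau> = \<sigma>}"
  unfolding is_max_IND_def by blast

lemma is_max_IND_id_eq: "{X. is_max_IND_id R rr ss X} =
    {X \<in> {X. is_IND_id R rr ss X}. \<forall>Y\<in>{X. is_IND_id R rr ss X}. X \<subseteq> Y \<longrightarrow> Y = X}"
  unfolding is_max_IND_id_def by blast

text \<open>A proper subset of \<open>T\<close> lies in \<open>V\<close> automatically, so
  minimality may be tested inside \<open>V\<close>.\<close>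

lemma minimal_eq:
  "{T. T \<subseteq> V \<and> P T \<and> \<not> (\<exists>T'. T' \<subset> T \<and> P T')} =
    {T \<in> {T. T \<subseteq> V \<and> P T}. \<forall>T'\<in>{T. T \<subseteq> V \<and> P T}. T' \<subseteq> T \<longrightarrow> T' = T}"
proof (intro set_eqI iffI)
  fix T assume T: "T \<in> {T \<in> {T. T \<subseteq> V \<and> P T}. \<forall>T'\<in>{T. T \<subseteq> V \<and> P T}. T' \<subseteq> T \<longrightarrow> T' = T}"
  have False if "T' \<subset> T" "P T'" for T'
  proof -
    have "T' \<subseteq> V" using that T by auto
    then show False using that T by auto
  qed
  then show "T \<in> {T. T \<subseteq> V \<and> P T \<and> \<not> (\<exists>T'. T' \<subset> T \<and> P T')}" using T by auto
qed auto

lemma Tr_eq: "Tr V H = {T \<in> {T. T \<subseteq> V \<and> (\<forall>E\<in>H. T \<inter> E \<noteq> {})}.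
    \<forall>T'\<in>{T. T \<subseteq> V \<and> (\<forall>E\<in>H. T \<inter> E \<noteq> {})}. T' \<subseteq> T \<longrightarrow> T' = T}"
  unfolding Tr_def by (rule minimal_eq)

lemma finite_wa3ns_vars: "finite (wa3ns_vars \<phi>)"
  by (simp add: wa3ns_vars_def)

lemma filter_sorted_list_of_set:
  assumes "finite A"
  shows "filter P (sorted_list_of_set A) = sorted_list_of_set {x \<in> A. P x}"
  by (rule strict_sorted_equal) (use assms in \<open>auto simp: sorted_wrt_filter\<close>)

section \<open>Representations\<close>

lemma codable_tnats: "codable tnats"
  unfolding tnats_def[abs_def] by (intro codable_list codable_TNat)

abbreviation pair_tree :: "nat \<times> nat \<Rightarrow> tree" where
  "pair_tree p \<equiv> TList [TNat (fst p), TNat (snd p)]"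

abbreviation pairs_tree :: "(nat \<times> nat) list \<Rightarrow> tree" where
  "pairs_tree ps \<equiv> TList (map pair_tree ps)"

lemma codable_pairs_tree: "codable pairs_tree"
  by (intro codable_list codable_pair codable_TNat)

lemma codable_db_tree: "codable db_tree"
  unfolding db_tree_def[abs_def] case_prod_beta
  by (intro codable_list codable_pair codable_TNat codable_tnats)

lemma codable_dbs_tree: "codable (\<lambda>(d1, d2). TList [db_tree d1, db_tree d2])"
  unfolding case_prod_beta by (intro codable_pair codable_db_tree)

lemma codable_wa3ns_tree: "codable wa3ns_tree"
  unfolding wa3ns_tree_def[abs_def] by (intro codable_list codable_tnats)

lemma codable_hyp_tree: "codable hyp_tree"
  unfolding hyp_tree_def[abs_def] by (intro codable_list codable_pair codable_tnats)

definition map_list :: "(nat \<rightharpoonup> nat) \<Rightarrow> (nat \<times> nat) list" where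
  "map_list \<sigma> = map (\<lambda>a. (a, the (\<sigma> a))) (sorted_list_of_set (dom \<sigma>))"

lemma enc_map_eq: "enc_map \<sigma> = enc_tree (pairs_tree (map_list \<sigma>))"
  by (simp add: enc_map_def map_list_def comp_def)

lemma map_of_map_list: "finite (dom \<sigma>) \<Longrightarrow> map_of (map_list \<sigma>) = \<sigma>"
  by (auto simp: map_list_def map_of_map_restrict restrict_map_def fun_eq_iff domIff)

lemma inj_on_sorted_list_of_set: "(\<And>A. A \<in> S \<Longrightarrow> finite A) \<Longrightarrow> inj_on sorted_list_of_set S"
  by (metis inj_onI set_sorted_list_of_set)

lemma inj_on_map_list: "(\<And>\<sigma>. \<sigma> \<in> S \<Longrightarrow> finite (dom \<sigma>)) \<Longrightarrow> inj_on map_list S"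
  by (metis inj_onI map_of_map_list)

section \<open>Transversal hypergraph\<close>

text \<open>The tautologies \<open>[[v], []]\<close> make every vertex occur in the formula.\<close>

definition hyp_formula :: "hyp_rep \<Rightarrow> wa3ns" where
  "hyp_formula h = map (\<lambda>v. [[v], []]) (fst h) @ map (map (\<lambda>v. [v])) (snd h)"

text \<open>The clause of an edge says that one of its vertices is missing from \<open>A\<close>,
  that is, the complement of \<open>A\<close> meets the edge. An empty edge becomes an empty
  disjunction, and then neither problem has a solution.\<close>

lemma sat_sets_hyp_formula:
  assumes "hyp_valid h"
  shows "sat_sets (hyp_formula h) = {A. A \<subseteq> set (fst h) \<and> (\<forall>E\<in>set (snd h). \<not> set E \<subseteq> A)}"
proof -
  have "wa3ns_vars (hyp_formula h) = set (fst h)"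
    using assms by (auto simp: wa3ns_vars_def hyp_formula_def hyp_valid_def)
  moreover have "wa3ns_sat (hyp_formula h) A \<longleftrightarrow> (\<forall>E\<in>set (snd h). \<not> set E \<subseteq> A)" for A
    by (auto simp: wa3ns_sat_def hyp_formula_def ball_Un subset_eq)
  ultimately show ?thesis by (simp add: sat_sets_def)
qed

lemma reduction_TransversalHypergraph_WA3NS: "pt_reduction TransversalHypergraph EnumMaxSatWA3NS"
  unfolding TransversalHypergraph_def EnumMaxSatWA3NS_def
proof (rule pt_reduction_mk_problem[where F = hyp_formula and lst = sorted_list_of_set and lst' = sorted_list_of_set
      and srep = tnats and srep' = tnats and H = "\<lambda>h A. set (fst h) - A"
      and G = "\<lambda>h ys. filter (\<lambda>v. v \<notin> set ys) (sorted_list_of_set (set (fst h)))"])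
  show "PT hyp_formula" unfolding hyp_formula_def[abs_def] by (intro PT_intros)
  show "PT (\<lambda>p :: hyp_rep \<times> nat list. filter (\<lambda>v. v \<notin> set (snd p)) (sorted_list_of_set (set (fst (fst p)))))"
    by (intro PT_intros)
  fix h assume h: "hyp_valid h"
  show "bij_betw (\<lambda>A. set (fst h) - A) {A. wa3ns_max_sat (hyp_formula h) A} (Tr (set (fst h)) (set ` set (snd h)))"
    unfolding wa3ns_max_sat_eq Tr_eq sat_sets_hyp_formula[OF h]
    by (rule bij_betw_maximal[where k = "\<lambda>T. set (fst h) - T"])
      (use h in \<open>(auto simp: hyp_valid_def; blast)+\<close>)
  show "inj_on sorted_list_of_set (Tr (set (fst h)) (set ` set (snd h)))"
    by (rule inj_on_sorted_list_of_set) (auto simp: Tr_def intro: finite_subset)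
  fix A assume A: "A \<in> {A. wa3ns_max_sat (hyp_formula h) A}"
  then have "finite A" using finite_wa3ns_vars by (auto simp: wa3ns_max_sat_def intro: finite_subset)
  then show "filter (\<lambda>v. v \<notin> set (sorted_list_of_set A)) (sorted_list_of_set (set (fst h))) = sorted_list_of_set (set (fst h) - A)"
    by (simp add: filter_sorted_list_of_set set_diff_eq)
qed (simp_all add: codable_tnats codable_hyp_tree codable_wa3ns_tree enc_natset_def)

section \<open>Inclusion dependencies with identity maps\<close>

lemma zero_notin_natcode [simp]: "0 \<notin> natcode ` S"
  by (metis imageE natcode_neq_0(2))

lemma map_of_const: "map_of (map (\<lambda>x. (x, f x)) xs) = (\<lambda>x. if x \<in> set xs then Some (f x) else None)"
  by (auto simp: map_of_map_restrict restrict_map_def fun_eq_iff)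

lemma restrict_eq_iff: "m |` X = m' |` X \<longleftrightarrow> (\<forall>x\<in>X. m x = m' x)"
  by (auto simp: restrict_map_def fun_eq_iff)

text \<open>No \<open>natcode\<close> is \<open>0\<close>, which leaves \<open>0\<close> free as the
  dummy attribute.\<close>

definition formula_schema :: "wa3ns \<Rightarrow> nat list" where
  "formula_schema \<phi> = 0 # map natcode (sorted_list_of_set (set (concat (concat \<phi>))))"

definition clause_row :: "wa3ns \<Rightarrow> nat list list \<Rightarrow> (nat \<times> nat) list" where
  "clause_row \<phi> c = map (\<lambda>x. (x, natcode c)) (formula_schema \<phi>)"

text \<open>\<open>0\<close> differs from the constant of every row on the left, so a match with
  this row has to avoid the attributes of \<open>k\<close>.\<close>

definition disjunct_row :: "wa3ns \<Rightarrow> nat list list \<Rightarrow> nat list \<Rightarrow> (nat \<times> nat) list" where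
  "disjunct_row \<phi> c k = map (\<lambda>x. (x, if x \<in> set (map natcode k) then 0 else natcode c)) (formula_schema \<phi>)"

text \<open>The empty set is an inclusion dependency as soon as there is a row on the right, so a formula
  with an empty disjunction has to be treated separately.\<close>

definition formula_dbs :: "wa3ns \<Rightarrow> db_rep \<times> db_rep" where
  "formula_dbs \<phi> = (if \<exists>c\<in>set \<phi>. c = [] then (([0], [[(0, 0)]]), ([0], []))
     else ((formula_schema \<phi>, map (clause_row \<phi>) \<phi>),
           (formula_schema \<phi>, concat (map (\<lambda>c. map (disjunct_row \<phi> c) c) \<phi>))))"

lemma PT_formula_schema [PT_intros]: "PT f \<Longrightarrow> PT (\<lambda>z. formula_schema (f z))"
  unfolding formula_schema_def by (intro PT_intros)

lemma PT_formula_dbs: "PT formula_dbs"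
  unfolding formula_dbs_def[abs_def] clause_row_def disjunct_row_def by (intro PT_intros)

lemma set_formula_schema: "set (formula_schema \<phi>) = insert 0 (natcode ` wa3ns_vars \<phi>)"
  by (auto simp: formula_schema_def wa3ns_vars_def)

text \<open>Rows of different clauses disagree everywhere because \<open>natcode\<close> is
  injective. The condition \<open>c' = c\<close> stays under the quantifier over \<open>Y\<close>
  because for \<open>Y = {}\<close> a row of any clause is a match.\<close>

lemma is_IND_id_formula_dbs:
  assumes Y: "Y \<subseteq> set (formula_schema \<phi>)"
  shows "is_IND_id (set (formula_schema \<phi>)) (map_of ` set (map (clause_row \<phi>) \<phi>))
      (map_of ` set (concat (map (\<lambda>c. map (disjunct_row \<phi> c) c) \<phi>))) Y \<longleftrightarrow>
    (\<forall>c\<in>set \<phi>. \<exists>c'\<in>set \<phi>. \<exists>k\<in>set c'. \<forall>x\<in>Y. c' = c \<and> x \<notin> natcode ` set k)"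
proof -
  have *: "map_of (clause_row \<phi> c) |` Y = map_of (disjunct_row \<phi> c' k) |` Y \<longleftrightarrow>
      (\<forall>x\<in>Y. c' = c \<and> x \<notin> natcode ` set k)" for c c' k
    unfolding restrict_eq_iff clause_row_def disjunct_row_def map_of_const
    using Y by (auto simp: natcode_inj)
  have "set (concat (map (\<lambda>c. map (disjunct_row \<phi> c) c) \<phi>)) = (\<Union>c\<in>set \<phi>. disjunct_row \<phi> c ` set c)"
    by simp
  moreover have "(\<exists>x\<in>\<Union>c\<in>set \<phi>. disjunct_row \<phi> c ` set c. P x) \<longleftrightarrow> (\<exists>c\<in>set \<phi>. \<exists>k\<in>set c. P (disjunct_row \<phi> c k))" for P
    by blast
  ultimately show ?thesis unfolding is_IND_id_def *[symmetric] using Y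
    by (simp only: image_subset_iff image_iff bex_simps ball_simps set_map simp_thms)
qed

text \<open>Adding \<open>0\<close> preserves inclusion dependencies: for nonempty \<open>Y\<close>
  the match is already within the same clause, and for empty \<open>Y\<close> every clause has a
  disjunct to choose. So all maximal ones contain \<open>0\<close>, and among those containing
  \<open>0\<close> the clause is fixed.\<close>

lemma is_max_IND_id_formula_dbs:
  assumes "\<And>c. c \<in> set \<phi> \<Longrightarrow> c \<noteq> []"
  defines "N \<equiv> {Y. 0 \<in> Y \<and> Y \<subseteq> set (formula_schema \<phi>) \<and> (\<forall>c\<in>set \<phi>. \<exists>k\<in>set c. Y \<inter> natcode ` set k = {})}"
  shows "{Y. is_max_IND_id (set (formula_schema \<phi>)) (map_of ` set (map (clause_row \<phi>) \<phi>))
      (map_of ` set (concat (map (\<lambda>c. map (disjunct_row \<phi> c) c) \<phi>))) Y}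
    = {Y \<in> N. \<forall>Y'\<in>N. Y \<subseteq> Y' \<longrightarrow> Y' = Y}"
proof -
  let ?I = "is_IND_id (set (formula_schema \<phi>)) (map_of ` set (map (clause_row \<phi>) \<phi>))
      (map_of ` set (concat (map (\<lambda>c. map (disjunct_row \<phi> c) c) \<phi>)))"
  have 0: "0 \<in> set (formula_schema \<phi>)" by (simp add: formula_schema_def)
  have sub: "Y \<subseteq> set (formula_schema \<phi>)" if "?I Y" for Y using that by (simp add: is_IND_id_def)
  have 1: "?I Y \<longleftrightarrow> Y \<in> N" if "0 \<in> Y" for Y
  proof (cases "Y \<subseteq> set (formula_schema \<phi>)")
    case True
    have "(\<exists>c'\<in>set \<phi>. \<exists>k\<in>set c'. \<forall>x\<in>Y. c' = c \<and> x \<notin> natcode ` set k) \<longleftrightarrow>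
      (\<exists>k\<in>set c. Y \<inter> natcode ` set k = {})" if "c \<in> set \<phi>" for c
      using that \<open>0 \<in> Y\<close> by blast
    then show ?thesis using that True unfolding is_IND_id_formula_dbs[OF True] N_def by simp
  next
    case False
    then show ?thesis using sub by (auto simp: N_def)
  qed
  have 2: "?I (insert 0 Y)" if I: "?I Y" for Y
  proof (cases "Y = {}")
    case True
    have "\<forall>c\<in>set \<phi>. \<exists>k. k \<in> set c" using assms(1) by (metis list.set_intros(1) neq_Nil_conv)
    then show ?thesis using 0 by (subst is_IND_id_formula_dbs) (auto simp: True)
  next
    case False
    have Y: "insert 0 Y \<subseteq> set (formula_schema \<phi>)" using sub[OF that] 0 by simp
    show ?thesis unfolding is_IND_id_formula_dbs[OF Y]
    proof
      fix c assume "c \<in> set \<phi>"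
      then obtain c' k where "c' \<in> set \<phi>" "k \<in> set c'" "\<forall>x\<in>Y. c' = c \<and> x \<notin> natcode ` set k"
        using I unfolding is_IND_id_formula_dbs[OF sub[OF I]] by blast
      moreover then have "c' = c" using False by blast
      ultimately show "\<exists>c'\<in>set \<phi>. \<exists>k\<in>set c'. \<forall>x\<in>insert 0 Y. c' = c \<and> x \<notin> natcode ` set k"
        by (intro bexI[of _ c'] bexI[of _ k]) auto
    qed
  qed
  show ?thesis
  proof (intro set_eqI iffI)
    fix Y assume "Y \<in> {Y. is_max_IND_id (set (formula_schema \<phi>)) (map_of ` set (map (clause_row \<phi>) \<phi>))
      (map_of ` set (concat (map (\<lambda>c. map (disjunct_row \<phi> c) c) \<phi>))) Y}"
    then have Y: "?I Y" "\<And>Y'. ?I Y' \<Longrightarrow> \<not> Y \<subset> Y'" by (auto simp: is_max_IND_id_def)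
    then have "0 \<in> Y" using 2[OF Y(1)] by blast
    then have "Y \<in> N" using 1 Y by blast
    moreover have "Y' = Y" if "Y' \<in> N" "Y \<subseteq> Y'" for Y'
      using Y(2)[of Y'] 1[of Y'] that by (auto simp: N_def)
    ultimately show "Y \<in> {Y \<in> N. \<forall>Y'\<in>N. Y \<subseteq> Y' \<longrightarrow> Y' = Y}" by blast
  next
    fix Y assume Y: "Y \<in> {Y \<in> N. \<forall>Y'\<in>N. Y \<subseteq> Y' \<longrightarrow> Y' = Y}"
    then have 0: "0 \<in> Y" by (simp add: N_def)
    then have "?I Y" using 1 Y by blast
    moreover have False if "?I Y'" "Y \<subset> Y'" for Y'
    proof -
      have "Y' \<in> N" using 0 that 1[of Y'] by blast
      then show False using Y that by blast
    qed
    ultimately show "Y \<in> {Y. is_max_IND_id (set (formula_schema \<phi>)) (map_of ` set (map (clause_row \<phi>) \<phi>))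
      (map_of ` set (concat (map (\<lambda>c. map (disjunct_row \<phi> c) c) \<phi>))) Y}"
      by (auto simp: is_max_IND_id_def)
  qed
qed

lemma map_fst_rows [simp]:
  "map fst (clause_row \<phi> c) = formula_schema \<phi>" "map fst (disjunct_row \<phi> c k) = formula_schema \<phi>"
  by (simp_all add: clause_row_def disjunct_row_def comp_def)

lemma fst_rows [simp]:
  "fst ` set (clause_row \<phi> c) = set (formula_schema \<phi>)" "fst ` set (disjunct_row \<phi> c k) = set (formula_schema \<phi>)"
  by (metis list.set_map map_fst_rows(1), metis list.set_map map_fst_rows(2))

lemma distinct_formula_schema: "distinct (formula_schema \<phi>)"
  by (auto simp: formula_schema_def distinct_map inj_on_def natcode_inj)

lemma reduction_WA3NS_IND_id: "pt_reduction EnumMaxSatWA3NS EnumMaxINDsIdentity"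
  unfolding EnumMaxSatWA3NS_def EnumMaxINDsIdentity_def
proof (rule pt_reduction_mk_problem[where F = formula_dbs and lst = sorted_list_of_set and lst' = sorted_list_of_set
      and srep = tnats and srep' = tnats and H = "\<lambda>\<phi> Y. {v \<in> wa3ns_vars \<phi>. natcode v \<in> Y}"
      and G = "\<lambda>\<phi> ys. filter (\<lambda>v. natcode v \<in> set ys) (sorted_list_of_set (set (concat (concat \<phi>))))"])
  show "PT formula_dbs" by (rule PT_formula_dbs)
  show "PT (\<lambda>p :: wa3ns \<times> nat list. filter (\<lambda>v. natcode v \<in> set (snd p)) (sorted_list_of_set (set (concat (concat (fst p))))))"
    by (intro PT_intros)
  fix \<phi> :: wa3ns
  show "case formula_dbs \<phi> of (d1, d2) \<Rightarrow> db_valid d1 \<and> db_valid d2 \<and> db_schema d1 = db_schema d2"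
    using distinct_formula_schema[of \<phi>]
    by (auto simp: formula_dbs_def db_valid_def db_schema_def) (auto simp: formula_schema_def)
  show "bij_betw (\<lambda>Y. {v \<in> wa3ns_vars \<phi>. natcode v \<in> Y})
     (case formula_dbs \<phi> of (d1, d2) \<Rightarrow> {X. is_max_IND_id (db_schema d1) (db_rows d1) (db_rows d2) X}) {A. wa3ns_max_sat \<phi> A}"
  proof (cases "\<exists>c\<in>set \<phi>. c = []")
    case True
    then have "\<not> wa3ns_sat \<phi> A" for A unfolding wa3ns_sat_def by force
    then have "{A. wa3ns_max_sat \<phi> A} = {}" by (simp add: wa3ns_max_sat_def)
    then show ?thesis using True
      by (auto simp: formula_dbs_def db_rows_def is_max_IND_id_def is_IND_id_def bij_betw_def)
  next
    case False
    define N where "N = {Y. 0 \<in> Y \<and> Y \<subseteq> set (formula_schema \<phi>) \<and> (\<forall>c\<in>set \<phi>. \<exists>k\<in>set c. Y \<inter> natcode ` set k = {})}"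
    have "bij_betw (\<lambda>Y. {v \<in> wa3ns_vars \<phi>. natcode v \<in> Y}) {Y \<in> N. \<forall>Y'\<in>N. Y \<subseteq> Y' \<longrightarrow> Y' = Y}
      {A \<in> sat_sets \<phi>. \<forall>B\<in>sat_sets \<phi>. A \<subseteq> B \<longrightarrow> B = A}"
    proof (rule bij_betw_maximal[where k = "\<lambda>A. insert 0 (natcode ` A)"])
      fix Y assume Y: "Y \<in> N"
      have "\<exists>k\<in>set c. \<forall>v\<in>set k. natcode v \<notin> Y" if "c \<in> set \<phi>" for c
      proof -
        obtain k where "k \<in> set c" "Y \<inter> natcode ` set k = {}" using Y \<open>c \<in> set \<phi>\<close> unfolding N_def by blast
        then show ?thesis by (intro bexI[of _ k]) auto
      qed
      then show "{v \<in> wa3ns_vars \<phi>. natcode v \<in> Y} \<in> sat_sets \<phi>"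
        unfolding sat_sets_def wa3ns_sat_def by fastforce
      show "insert 0 (natcode ` {v \<in> wa3ns_vars \<phi>. natcode v \<in> Y}) = Y"
        using Y unfolding N_def set_formula_schema by auto
    next
      fix A assume A: "A \<in> sat_sets \<phi>"
      have "insert 0 (natcode ` A) \<inter> natcode ` set k = {} \<longleftrightarrow> (\<forall>v\<in>set k. v \<notin> A)" for k :: "nat list"
        by (auto simp: natcode_inj)
      then show "insert 0 (natcode ` A) \<in> N"
        using A unfolding N_def set_formula_schema sat_sets_def wa3ns_sat_def by auto
      show "{v \<in> wa3ns_vars \<phi>. natcode v \<in> insert 0 (natcode ` A)} = A"
        using A by (auto simp: sat_sets_def natcode_inj)
    qed auto
    moreover have ne: "\<And>c. c \<in> set \<phi> \<Longrightarrow> c \<noteq> []" using False by blast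
    have "(case formula_dbs \<phi> of (d1, d2) \<Rightarrow> {X. is_max_IND_id (db_schema d1) (db_rows d1) (db_rows d2) X})
        = {Y \<in> N. \<forall>Y'\<in>N. Y \<subseteq> Y' \<longrightarrow> Y' = Y}"
      unfolding N_def
      by (rule trans[OF _ is_max_IND_id_formula_dbs[OF ne]])
        (use False in \<open>simp_all add: formula_dbs_def db_schema_def db_rows_def\<close>)
    ultimately show ?thesis unfolding wa3ns_max_sat_eq by simp
  qed
  show "inj_on sorted_list_of_set {A. wa3ns_max_sat \<phi> A}"
    by (rule inj_on_sorted_list_of_set) (auto simp: wa3ns_max_sat_def intro: finite_subset finite_wa3ns_vars)
  fix Y assume Y: "Y \<in> (case formula_dbs \<phi> of (d1, d2) \<Rightarrow> {X. is_max_IND_id (db_schema d1) (db_rows d1) (db_rows d2) X})"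
  then have "finite Y"
    by (auto simp: is_max_IND_id_def is_IND_id_def db_schema_def intro: finite_subset split: prod.splits)
  moreover have "set (concat (concat \<phi>)) = wa3ns_vars \<phi>" by (auto simp: wa3ns_vars_def)
  ultimately show "filter (\<lambda>v. natcode v \<in> set (sorted_list_of_set Y)) (sorted_list_of_set (set (concat (concat \<phi>))))
      = sorted_list_of_set {v \<in> wa3ns_vars \<phi>. natcode v \<in> Y}"
    by (simp only: set_sorted_list_of_set filter_sorted_list_of_set[OF finite_wa3ns_vars])
qed (simp_all add: codable_tnats codable_dbs_tree codable_wa3ns_tree enc_natset_def)

section \<open>From identity maps to arbitrary maps\<close>

definition tag_row :: "(nat \<times> nat) list \<Rightarrow> (nat \<times> nat) list" where
  "tag_row r = map (\<lambda>p. (fst p, natcode p)) r"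

lemma map_fst_tag_row [simp]: "map fst (tag_row r) = map fst r"
  by (simp add: tag_row_def comp_def)

lemma fst_tag_row [simp]: "fst ` set (tag_row r) = fst ` set r"
  by (metis list.set_map map_fst_tag_row)

lemma map_of_tag_row: "map_of (tag_row r) a = map_option (\<lambda>v. natcode (a, v)) (map_of r a)"
  by (induction r) (auto simp: tag_row_def)

text \<open>Without rows on the left every injection is an inclusion dependency, so a common dummy row is
  added to both databases in this case.\<close>

definition nonempty_rows :: "nat list \<Rightarrow> (nat \<times> nat) list list \<Rightarrow> (nat \<times> nat) list list \<Rightarrow> (nat \<times> nat) list list" where
  "nonempty_rows R rs ss = (if rs = [] then [map (\<lambda>a. (a, 0)) (sorted_list_of_set (set R))] else ss)"

definition tagged_dbs :: "db_rep \<times> db_rep \<Rightarrow> db_rep \<times> db_rep" where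
  "tagged_dbs d = ((fst (fst d), map tag_row (nonempty_rows (fst (fst d)) (snd (fst d)) (snd (fst d)))),
     (fst (snd d), map tag_row (nonempty_rows (fst (fst d)) (snd (fst d)) (snd (snd d)))))"

lemma PT_tagged_dbs: "PT tagged_dbs"
  unfolding tagged_dbs_def[abs_def] nonempty_rows_def tag_row_def by (intro PT_intros)

text \<open>If \<open>rs\<close> is empty, every subset of \<open>R\<close> qualifies before the
  change, and also after it because both sides then consist of the same dummy row.\<close>

lemma is_IND_id_nonempty_rows:
  "is_IND_id R (map_of ` set (nonempty_rows xs rs rs)) (map_of ` set (nonempty_rows xs rs ss)) X
    \<longleftrightarrow> is_IND_id R (map_of ` set rs) (map_of ` set ss) X"
  by (auto simp: is_IND_id_def nonempty_rows_def)

lemma nonempty_rows_neq_Nil: "nonempty_rows xs rs rs \<noteq> []"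
  by (simp add: nonempty_rows_def)

lemma valid_nonempty_rows:
  assumes "\<And>r. r \<in> set ss \<Longrightarrow> distinct (map fst r) \<and> set (map fst r) = set xs" "r \<in> set (nonempty_rows xs rs ss)"
  shows "distinct (map fst r) \<and> set (map fst r) = set xs"
  using assms by (auto simp: nonempty_rows_def comp_def image_image split: if_splits)

text \<open>A tagged value determines its attribute, so one row on the left already forces
  \<open>\<sigma>\<close> to be the identity on its domain; hence \<open>rs\<close> must not be
  empty. Rows on the left are defined on all of \<open>R\<close>, which rules out a spurious match
  of two undefined entries.\<close>

lemma is_IND_tag_row:
  assumes "rs \<noteq> []" and dom: "\<And>r. r \<in> set rs \<Longrightarrow> set (map fst r) = R"
  shows "is_IND R (map_of ` set (map tag_row rs)) R (map_of ` set (map tag_row ss)) \<sigma> \<longleftrightarrow>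
    \<sigma> = Some |` dom \<sigma> \<and> is_IND_id R (map_of ` set rs) (map_of ` set ss) (dom \<sigma>)"
proof -
  have d: "\<exists>v. map_of r a = Some v" if "r \<in> set rs" "a \<in> R" for r a
    using dom[OF that(1)] that(2) by (metis domD dom_map_of_conv_image_fst list.set_map)
  have id: "\<sigma> = Some |` dom \<sigma> \<longleftrightarrow> (\<forall>a\<in>dom \<sigma>. the (\<sigma> a) = a)"
    by (auto simp: fun_eq_iff restrict_map_def domIff) (metis domI option.sel)
  have *: "(\<forall>a\<in>dom \<sigma>. map_of (tag_row r) a = map_of (tag_row s) (the (\<sigma> a))) \<longleftrightarrow>
      (\<forall>a\<in>dom \<sigma>. the (\<sigma> a) = a) \<and> map_of r |` dom \<sigma> = map_of s |` dom \<sigma>"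
    if "r \<in> set rs" "dom \<sigma> \<subseteq> R" for r s
  proof -
    have "map_of (tag_row r) a = map_of (tag_row s) b \<longleftrightarrow> b = a \<and> map_of r a = map_of s a" if a: "a \<in> dom \<sigma>" for a b
    proof -
      obtain v where "map_of r a = Some v" using d[OF \<open>r \<in> set rs\<close>] a \<open>dom \<sigma> \<subseteq> R\<close> by blast
      then show ?thesis by (cases "map_of s b") (auto simp: map_of_tag_row natcode_inj)
    qed
    then show ?thesis unfolding restrict_eq_iff by blast
  qed
  show ?thesis
  proof
    assume I: "is_IND R (map_of ` set (map tag_row rs)) R (map_of ` set (map tag_row ss)) \<sigma>"
    then have sub: "dom \<sigma> \<subseteq> R" by (simp add: is_IND_def)
    have ex: "\<exists>s\<in>set ss. (\<forall>a\<in>dom \<sigma>. the (\<sigma> a) = a) \<and> map_of r |` dom \<sigma> = map_of s |` dom \<sigma>" if "r \<in> set rs" for r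
    proof -
      have "\<exists>s\<in>set ss. \<forall>a\<in>dom \<sigma>. map_of (tag_row r) a = map_of (tag_row s) (the (\<sigma> a))"
        using I that unfolding is_IND_def by simp
      then show ?thesis unfolding *[OF that sub] .
    qed
    obtain r where "r \<in> set rs" using assms(1) by (metis list.set_intros(1) neq_Nil_conv)
    then have "\<sigma> = Some |` dom \<sigma>" using ex id by blast
    moreover have "is_IND_id R (map_of ` set rs) (map_of ` set ss) (dom \<sigma>)"
      unfolding is_IND_id_def
    proof (intro conjI sub subsetI)
      fix x assume "x \<in> (\<lambda>r. r |` dom \<sigma>) ` map_of ` set rs"
      then obtain r where r: "r \<in> set rs" "x = map_of r |` dom \<sigma>" by blast
      then obtain s where "s \<in> set ss" "map_of r |` dom \<sigma> = map_of s |` dom \<sigma>" using ex by blast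
      then show "x \<in> (\<lambda>s. s |` dom \<sigma>) ` map_of ` set ss" using r by simp
    qed
    ultimately show "\<sigma> = Some |` dom \<sigma> \<and> is_IND_id R (map_of ` set rs) (map_of ` set ss) (dom \<sigma>)" by blast
  next
    assume I: "\<sigma> = Some |` dom \<sigma> \<and> is_IND_id R (map_of ` set rs) (map_of ` set ss) (dom \<sigma>)"
    then have sub: "dom \<sigma> \<subseteq> R" by (simp add: is_IND_id_def)
    have i: "\<sigma> a = Some a" if "a \<in> dom \<sigma>" for a using I that id by force
    have "\<exists>s\<in>set ss. \<forall>a\<in>dom \<sigma>. map_of (tag_row r) a = map_of (tag_row s) (the (\<sigma> a))" if "r \<in> set rs" for r
    proof -
      obtain s where "s \<in> set ss" "map_of r |` dom \<sigma> = map_of s |` dom \<sigma>"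
        using I \<open>r \<in> set rs\<close> unfolding is_IND_id_def by blast
      then show ?thesis unfolding *[OF that sub] using I id by blast
    qed
    moreover have "inj_on \<sigma> (dom \<sigma>)" by (rule inj_onI) (metis i option.inject)
    moreover have "ran \<sigma> \<subseteq> R" using sub i by (auto simp: ran_def) (metis domI option.inject subsetD)
    ultimately show "is_IND R (map_of ` set (map tag_row rs)) R (map_of ` set (map tag_row ss)) \<sigma>"
      using sub by (simp add: is_IND_def)
  qed
qed

lemma reduction_IND_id_IND: "pt_reduction EnumMaxINDsIdentity EnumMaxINDs"
  unfolding EnumMaxINDsIdentity_def EnumMaxINDs_def
proof (rule pt_reduction_mk_problem[where F = tagged_dbs and lst = sorted_list_of_set and lst' = map_list
      and srep = tnats and srep' = pairs_tree and H = "\<lambda>_. dom" and G = "\<lambda>_. map fst"])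
  show "PT tagged_dbs" by (rule PT_tagged_dbs)
  show "PT (\<lambda>p :: (db_rep \<times> db_rep) \<times> (nat \<times> nat) list. map fst (snd p))"
    by (intro PT_intros)
  fix a :: "db_rep \<times> db_rep"
  obtain R rs S ss where a: "a = ((R, rs), (S, ss))" by (metis surj_pair)
  assume "case a of (d1, d2) \<Rightarrow> db_valid d1 \<and> db_valid d2 \<and> db_schema d1 = db_schema d2"
  then have v: "R \<noteq> []" "S \<noteq> []" "set S = set R"
      "\<And>r. r \<in> set rs \<Longrightarrow> distinct (map fst r) \<and> set (map fst r) = set R"
      "\<And>r. r \<in> set ss \<Longrightarrow> distinct (map fst r) \<and> set (map fst r) = set R"
    by (auto simp: a db_valid_def db_schema_def)
  note vr = valid_nonempty_rows[OF v(4), where rs = rs] and vs = valid_nonempty_rows[OF v(5), where rs = rs]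
  show "case tagged_dbs a of (d1, d2) \<Rightarrow> db_valid d1 \<and> db_valid d2"
    using v(1-3) vr vs by (auto simp: a tagged_dbs_def db_valid_def)
  let ?rs = "map_of ` set rs" and ?ss = "map_of ` set ss"
  have IND: "{\<sigma>. is_IND (set R) (map_of ` set (map tag_row (nonempty_rows R rs rs))) (set R)
      (map_of ` set (map tag_row (nonempty_rows R rs ss))) \<sigma>}
      = {\<sigma>. \<sigma> = Some |` dom \<sigma> \<and> is_IND_id (set R) ?rs ?ss (dom \<sigma>)}"
    using is_IND_tag_row[OF nonempty_rows_neq_Nil] vr by (simp add: is_IND_id_nonempty_rows)
  have "bij_betw dom {\<sigma>. is_max_IND (set R) (map_of ` set (map tag_row (nonempty_rows R rs rs))) (set R)
      (map_of ` set (map tag_row (nonempty_rows R rs ss))) \<sigma>} {X. is_max_IND_id (set R) ?rs ?ss X}"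
    unfolding is_max_IND_eq is_max_IND_id_eq IND
    \<comment> \<open>The inverse of \<open>dom\<close> sends a set to the identity map on
      it.\<close>
    by (rule bij_betw_maximal[where k = "\<lambda>X. Some |` X"])
      (auto simp: map_le_def dom_def restrict_map_def subset_eq)
  then show "bij_betw dom (case tagged_dbs a of (d1, d2) \<Rightarrow> {\<sigma>. is_max_IND (db_schema d1) (db_rows d1) (db_schema d2) (db_rows d2) \<sigma>})
      (case a of (d1, d2) \<Rightarrow> {X. is_max_IND_id (db_schema d1) (db_rows d1) (db_rows d2) X})"
    by (simp add: a tagged_dbs_def db_schema_def db_rows_def v(3))
  show "inj_on sorted_list_of_set (case a of (d1, d2) \<Rightarrow> {X. is_max_IND_id (db_schema d1) (db_rows d1) (db_rows d2) X})"
    by (rule inj_on_sorted_list_of_set)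
      (auto simp: is_max_IND_id_def is_IND_id_def db_schema_def a intro: finite_subset)
  fix \<sigma> :: "nat \<rightharpoonup> nat"
  show "map fst (map_list \<sigma>) = sorted_list_of_set (dom \<sigma>)"
    by (simp add: map_list_def comp_def)
qed (simp_all add: codable_tnats codable_dbs_tree codable_pairs_tree enc_natset_def enc_map_eq)

section \<open>Inclusion dependencies as formulas\<close>

text \<open>The first group consists of tautologies that make every pair of attributes occur as a
  variable. In the filter of the second group, the first alternative violates functionality and the
  second one injectivity. With no rows on the right, the third group contributes an empty
  disjunction for each row on the left.\<close>

definition ind_formula :: "db_rep \<times> db_rep \<Rightarrow> wa3ns" where
  "ind_formula d =
     concat (map (\<lambda>a. map (\<lambda>b. [[natcode (a, b)], []]) (fst (snd d))) (fst (fst d)))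
   @ concat (map (\<lambda>a. concat (map (\<lambda>b. concat (map (\<lambda>a'. map (\<lambda>b'. [[natcode (a, b)], [natcode (a', b')]])
         (filter (\<lambda>b'. a = a' \<and> b \<noteq> b' \<or> a \<noteq> a' \<and> b = b') (fst (snd d)))) (fst (fst d)))) (fst (snd d)))) (fst (fst d)))
   @ map (\<lambda>r. map (\<lambda>s. concat (map (\<lambda>p. map (\<lambda>q. natcode (fst p, fst q)) (filter (\<lambda>q. snd p \<noteq> snd q) s)) r))
         (snd (snd d))) (snd (fst d))"

lemma PT_ind_formula: "PT ind_formula"
  unfolding ind_formula_def[abs_def] by (intro PT_intros)

lemma wa3ns_vars_ind_formula:
  assumes "\<And>r. r \<in> set rs \<Longrightarrow> set (map fst r) = set R" "\<And>s. s \<in> set ss \<Longrightarrow> set (map fst s) = set S"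
  shows "wa3ns_vars (ind_formula ((R, rs), (S, ss))) = natcode ` (set R \<times> set S)"
proof
  have "natcode (fst p, fst q) \<in> natcode ` (set R \<times> set S)" if "r \<in> set rs" "s \<in> set ss" "p \<in> set r" "q \<in> set s" for r s p q
    using assms(1)[OF that(1)] assms(2)[OF that(2)] that by (intro imageI) auto
  then show "wa3ns_vars (ind_formula ((R, rs), (S, ss))) \<subseteq> natcode ` (set R \<times> set S)"
    unfolding wa3ns_vars_def ind_formula_def by auto
  show "natcode ` (set R \<times> set S) \<subseteq> wa3ns_vars (ind_formula ((R, rs), (S, ss)))"
    unfolding wa3ns_vars_def ind_formula_def by auto
qed

text \<open>Both kinds of conflict clauses together amount to
  \<open>a = a' \<longleftrightarrow> b = b'\<close> for any two chosen pairs; the tautologies drop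
  out.\<close>

lemma wa3ns_sat_ind_formula:
  "wa3ns_sat (ind_formula ((R, rs), (S, ss))) A \<longleftrightarrow>
    (\<forall>a\<in>set R. \<forall>b\<in>set S. \<forall>a'\<in>set R. \<forall>b'\<in>set S. natcode (a, b) \<in> A \<longrightarrow> natcode (a', b') \<in> A \<longrightarrow> (a = a' \<longleftrightarrow> b = b')) \<and>
    (\<forall>r\<in>set rs. \<exists>s\<in>set ss. \<forall>p\<in>set r. \<forall>q\<in>set s. snd p \<noteq> snd q \<longrightarrow> natcode (fst p, fst q) \<notin> A)"
proof -
  have 1: "(\<forall>c\<in>set (concat (map (\<lambda>a. map (\<lambda>b. [[natcode (a, b)], []]) S) R)). \<exists>k\<in>set c. \<forall>v\<in>set k. v \<notin> A)"
    by auto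
  have 2: "(\<forall>c\<in>set (concat (map (\<lambda>a. concat (map (\<lambda>b. concat (map (\<lambda>a'. map (\<lambda>b'. [[natcode (a, b)], [natcode (a', b')]])
         (filter (\<lambda>b'. a = a' \<and> b \<noteq> b' \<or> a \<noteq> a' \<and> b = b') S)) R)) S)) R)). \<exists>k\<in>set c. \<forall>v\<in>set k. v \<notin> A)
     \<longleftrightarrow> (\<forall>a\<in>set R. \<forall>b\<in>set S. \<forall>a'\<in>set R. \<forall>b'\<in>set S. natcode (a, b) \<in> A \<longrightarrow> natcode (a', b') \<in> A \<longrightarrow> (a = a' \<longleftrightarrow> b = b'))"
    by (simp add: ball_UN) blast
  have 3: "(\<forall>c\<in>set (map (\<lambda>r. map (\<lambda>s. concat (map (\<lambda>p. map (\<lambda>q. natcode (fst p, fst q)) (filter (\<lambda>q. snd p \<noteq> snd q) s)) r))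
         ss) rs). \<exists>k\<in>set c. \<forall>v\<in>set k. v \<notin> A)
     \<longleftrightarrow> (\<forall>r\<in>set rs. \<exists>s\<in>set ss. \<forall>p\<in>set r. \<forall>q\<in>set s. snd p \<noteq> snd q \<longrightarrow> natcode (fst p, fst q) \<notin> A)"
  proof -
    have "(\<forall>v\<in>set (concat (map (\<lambda>p. map (\<lambda>q. natcode (fst p, fst q)) (filter (\<lambda>q. snd p \<noteq> snd q) s)) r)). v \<notin> A)
      \<longleftrightarrow> (\<forall>p\<in>set r. \<forall>q\<in>set s. snd p \<noteq> snd q \<longrightarrow> natcode (fst p, fst q) \<notin> A)" for r s :: "(nat \<times> nat) list"
      by (auto; fastforce)
    then show ?thesis by (simp only: set_map ball_simps bex_simps)
  qed
  show ?thesis unfolding wa3ns_sat_def ind_formula_def fst_conv snd_conv set_append ball_Un 2 3 using 1 by blast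
qed

definition map_set :: "(nat \<rightharpoonup> nat) \<Rightarrow> nat set" where
  "map_set \<sigma> = {natcode (a, b) | a b. \<sigma> a = Some b}"

lemma natcode_in_map_set [simp]: "natcode (a, b) \<in> map_set \<sigma> \<longleftrightarrow> \<sigma> a = Some b"
  by (auto simp: map_set_def natcode_inj)

text \<open>The default value \<open>0\<close> is never used.\<close>

definition pick :: "nat list \<Rightarrow> nat set \<Rightarrow> nat \<Rightarrow> nat" where
  "pick S A a = (case filter (\<lambda>b. natcode (a, b) \<in> A) S of [] \<Rightarrow> 0 | b # _ \<Rightarrow> b)"

definition set_map :: "db_rep \<times> db_rep \<Rightarrow> nat set \<Rightarrow> nat \<rightharpoonup> nat" where
  "set_map d A = (\<lambda>a. if a \<in> set (fst (fst d)) \<and> (\<exists>b\<in>set (fst (snd d)). natcode (a, b) \<in> A)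
     then Some (pick (fst (snd d)) A a) else None)"

lemma pick_mem:
  assumes "b \<in> set S" "natcode (a, b) \<in> A"
  shows "pick S A a \<in> set S \<and> natcode (a, pick S A a) \<in> A"
proof (cases "filter (\<lambda>b. natcode (a, b) \<in> A) S")
  case Nil
  then show ?thesis using assms by (auto simp: filter_empty_conv)
next
  case (Cons c cs)
  have "x \<in> set (filter (\<lambda>b. natcode (a, b) \<in> A) S) \<Longrightarrow> x \<in> set S \<and> natcode (a, x) \<in> A" for x
    by simp
  from this[of c] have "c \<in> set S \<and> natcode (a, c) \<in> A" unfolding Cons by simp
  then show ?thesis using Cons by (auto simp: pick_def)
qed

text \<open>The conflict clauses leave at most one \<open>b\<close> for each \<open>a\<close>, so
  the value found by \<open>pick\<close> is the only candidate.\<close>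

lemma set_map_eq_Some:
  assumes "wa3ns_sat (ind_formula ((R, rs), (S, ss))) A"
  shows "set_map ((R, rs), (S, ss)) A a = Some b \<longleftrightarrow> a \<in> set R \<and> b \<in> set S \<and> natcode (a, b) \<in> A"
proof
  assume "set_map ((R, rs), (S, ss)) A a = Some b"
  then show "a \<in> set R \<and> b \<in> set S \<and> natcode (a, b) \<in> A"
    using pick_mem by (auto simp: set_map_def split: if_splits)
next
  assume b: "a \<in> set R \<and> b \<in> set S \<and> natcode (a, b) \<in> A"
  then have "pick S A a \<in> set S" "natcode (a, pick S A a) \<in> A" using pick_mem by blast+
  then have "pick S A a = b" using assms b unfolding wa3ns_sat_ind_formula by blast
  then show "set_map ((R, rs), (S, ss)) A a = Some b" using b by (auto simp: set_map_def)
qed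

text \<open>Attributes in a row are distinct, so \<open>map_of\<close> agrees with membership of
  pairs and two rows match exactly if no pair related by \<open>\<sigma>\<close> carries different
  values. Functionality of \<open>map_set \<sigma>\<close> is automatic, so of the conflict clauses
  only injectivity remains.\<close>

lemma is_IND_map_of_iff:
  assumes r: "\<And>r. r \<in> set rs \<Longrightarrow> distinct (map fst r) \<and> set (map fst r) = set R"
    and s: "\<And>s. s \<in> set ss \<Longrightarrow> distinct (map fst s) \<and> set (map fst s) = set S"
  shows "is_IND (set R) (map_of ` set rs) (set S) (map_of ` set ss) \<sigma> \<longleftrightarrow>
    dom \<sigma> \<subseteq> set R \<and> ran \<sigma> \<subseteq> set S \<and> wa3ns_sat (ind_formula ((R, rs), (S, ss))) (map_set \<sigma>)"
proof (cases "dom \<sigma> \<subseteq> set R \<and> ran \<sigma> \<subseteq> set S")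
  case True
  have "inj_on \<sigma> (dom \<sigma>) \<longleftrightarrow> (\<forall>a\<in>set R. \<forall>b\<in>set S. \<forall>a'\<in>set R. \<forall>b'\<in>set S. \<sigma> a = Some b \<longrightarrow> \<sigma> a' = Some b' \<longrightarrow> (a = a' \<longleftrightarrow> b = b'))"
    (is "_ \<longleftrightarrow> ?F")
  proof
    show "?F" if "inj_on \<sigma> (dom \<sigma>)"
      using that by (metis domI inj_onD option.inject)
    assume F: "?F"
    show "inj_on \<sigma> (dom \<sigma>)"
    proof (rule inj_onI)
      fix a a' assume *: "a \<in> dom \<sigma>" "a' \<in> dom \<sigma>" "\<sigma> a = \<sigma> a'"
      then obtain b where "\<sigma> a = Some b" by blast
      moreover from this have "b \<in> set S" using True by (auto simp: ran_def)
      ultimately show "a = a'" using F * True by (metis subsetD)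
    qed
  qed
  moreover have "(\<forall>a\<in>dom \<sigma>. map_of x a = map_of y (the (\<sigma> a))) \<longleftrightarrow>
      (\<forall>p\<in>set x. \<forall>q\<in>set y. snd p \<noteq> snd q \<longrightarrow> \<sigma> (fst p) \<noteq> Some (fst q))" if "x \<in> set rs" "y \<in> set ss" for x y
  proof
    have x: "map_of x a = Some u \<longleftrightarrow> (a, u) \<in> set x" and y: "map_of y b = Some v \<longleftrightarrow> (b, v) \<in> set y" for a b u v
      using r[OF that(1)] s[OF that(2)] by simp_all
    {
      assume *: "\<forall>a\<in>dom \<sigma>. map_of x a = map_of y (the (\<sigma> a))"
      have False if "p \<in> set x" "q \<in> set y" "snd p \<noteq> snd q" "\<sigma> (fst p) = Some (fst q)" for p q
      proof -
        have "map_of x (fst p) = Some (snd p)" "map_of y (fst q) = Some (snd q)" using that x y by simp_all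
        then show False using * that by (metis domI option.inject option.sel)
      qed
      then show "\<forall>p\<in>set x. \<forall>q\<in>set y. snd p \<noteq> snd q \<longrightarrow> \<sigma> (fst p) \<noteq> Some (fst q)" by blast
    }
    assume *: "\<forall>p\<in>set x. \<forall>q\<in>set y. snd p \<noteq> snd q \<longrightarrow> \<sigma> (fst p) \<noteq> Some (fst q)"
    show "\<forall>a\<in>dom \<sigma>. map_of x a = map_of y (the (\<sigma> a))"
    proof
      fix a assume "a \<in> dom \<sigma>"
      then obtain b where b: "\<sigma> a = Some b" by blast
      then have "a \<in> set (map fst x)" "b \<in> set (map fst y)"
        using True r[OF that(1)] s[OF that(2)] by (auto simp: ran_def)
      then obtain u v where uv: "(a, u) \<in> set x" "(b, v) \<in> set y" by auto
      then have "u = v" using * b by fastforce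
      then show "map_of x a = map_of y (the (\<sigma> a))" using uv b x y by (metis option.sel)
    qed
  qed
  ultimately show ?thesis using True
    unfolding is_IND_def wa3ns_sat_ind_formula natcode_in_map_set by (simp cong: ball_cong bex_cong)
qed (auto simp: is_IND_def)

lemma reduction_IND_WA3NS: "pt_reduction EnumMaxINDs EnumMaxSatWA3NS"
  unfolding EnumMaxINDs_def EnumMaxSatWA3NS_def
proof (rule pt_reduction_mk_problem[where F = ind_formula and lst = map_list and lst' = sorted_list_of_set
      and srep = pairs_tree and srep' = tnats and H = set_map
      and G = "\<lambda>d ys. map (\<lambda>a. (a, pick (fst (snd d)) (set ys) a))
         (filter (\<lambda>a. \<exists>b\<in>set (fst (snd d)). natcode (a, b) \<in> set ys) (sorted_list_of_set (set (fst (fst d)))))"])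
  show "PT ind_formula" by (rule PT_ind_formula)
  show "PT (\<lambda>p :: (db_rep \<times> db_rep) \<times> nat list. map (\<lambda>a. (a, pick (fst (snd (fst p))) (set (snd p)) a))
         (filter (\<lambda>a. \<exists>b\<in>set (fst (snd (fst p))). natcode (a, b) \<in> set (snd p)) (sorted_list_of_set (set (fst (fst (fst p)))))))"
    unfolding pick_def by (intro PT_intros)
  fix d :: "db_rep \<times> db_rep"
  obtain R rs S ss where d: "d = ((R, rs), (S, ss))" by (metis surj_pair)
  assume "case d of (d1, d2) \<Rightarrow> db_valid d1 \<and> db_valid d2"
  then have v: "\<And>r. r \<in> set rs \<Longrightarrow> distinct (map fst r) \<and> set (map fst r) = set R"
      "\<And>s. s \<in> set ss \<Longrightarrow> distinct (map fst s) \<and> set (map fst s) = set S"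
    by (auto simp: d db_valid_def)
  have vars: "wa3ns_vars (ind_formula d) = natcode ` (set R \<times> set S)"
    unfolding d by (rule wa3ns_vars_ind_formula) (use v in auto)
  note Some = set_map_eq_Some[of R rs S ss, folded d]
  let ?I = "{\<sigma>. is_IND (set R) (map_of ` set rs) (set S) (map_of ` set ss) \<sigma>}"
  have I: "?I = {\<sigma>. dom \<sigma> \<subseteq> set R \<and> ran \<sigma> \<subseteq> set S \<and> wa3ns_sat (ind_formula d) (map_set \<sigma>)}"
    unfolding d using is_IND_map_of_iff[OF v, of rs ss] by simp
  \<comment> \<open>All variables are codes of attribute pairs, so nothing in \<open>A\<close> is
    lost by passing to the map.\<close>
  have inv: "map_set (set_map d A) = A" if "A \<in> sat_sets (ind_formula d)" for A
  proof -
    have sat: "wa3ns_sat (ind_formula d) A" "A \<subseteq> natcode ` (set R \<times> set S)"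
      using that by (auto simp: sat_sets_def vars)
    then have "x \<in> map_set (set_map d A) \<longleftrightarrow> x \<in> A" for x
      using Some[OF sat(1)] sat(2) by (fastforce simp: map_set_def)
    then show ?thesis by blast
  qed
  have "bij_betw (set_map d) {A \<in> sat_sets (ind_formula d). \<forall>B\<in>sat_sets (ind_formula d). A \<subseteq> B \<longrightarrow> B = A}
    {\<sigma> \<in> ?I. \<forall>\<tau>\<in>?I. \<sigma> \<subseteq>\<^sub>m \<tau> \<longrightarrow> \<tau> = \<sigma>}"
  proof (rule bij_betw_maximal[where k = map_set])
    fix A assume A: "A \<in> sat_sets (ind_formula d)"
    then have sat: "wa3ns_sat (ind_formula d) A" by (simp add: sat_sets_def)
    show "set_map d A \<in> ?I" unfolding I
      using Some[OF sat] sat by (auto simp: inv[OF A] ran_def dom_def)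
    show "map_set (set_map d A) = A" by (rule inv[OF A])
    fix B assume B: "B \<in> sat_sets (ind_formula d)" "A \<subseteq> B"
    then have "wa3ns_sat (ind_formula d) B" by (simp add: sat_sets_def)
    then have "set_map d B a = Some b" if "set_map d A a = Some b" for a b
      using that B(2) unfolding Some[OF \<open>wa3ns_sat (ind_formula d) B\<close>] Some[OF sat] by blast
    then show "set_map d A \<subseteq>\<^sub>m set_map d B" by (auto simp: map_le_def)
  next
    fix \<sigma> assume \<sigma>: "\<sigma> \<in> ?I"
    then have sat: "wa3ns_sat (ind_formula d) (map_set \<sigma>)" and sub: "dom \<sigma> \<subseteq> set R" "ran \<sigma> \<subseteq> set S"
      unfolding I by auto
    show "map_set \<sigma> \<in> sat_sets (ind_formula d)"
      using sat sub by (auto simp: sat_sets_def vars map_set_def dom_def ran_def)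
    have "set_map d (map_set \<sigma>) a = Some b \<longleftrightarrow> \<sigma> a = Some b" for a b
      using Some[OF sat] sub by (auto simp: dom_def ran_def)
    then show "set_map d (map_set \<sigma>) = \<sigma>" by (metis not_Some_eq ext)
    fix \<tau> assume "\<tau> \<in> ?I" "\<sigma> \<subseteq>\<^sub>m \<tau>"
    then show "map_set \<sigma> \<subseteq> map_set \<tau>" by (auto simp: map_set_def map_le_def dom_def) metis
  qed
  then show "bij_betw (set_map d) {A. wa3ns_max_sat (ind_formula d) A}
      (case d of (d1, d2) \<Rightarrow> {\<sigma>. is_max_IND (db_schema d1) (db_rows d1) (db_schema d2) (db_rows d2) \<sigma>})"
    unfolding wa3ns_max_sat_eq is_max_IND_eq by (simp add: d db_schema_def db_rows_def)
  show "inj_on map_list (case d of (d1, d2) \<Rightarrow> {\<sigma>. is_max_IND (db_schema d1) (db_rows d1) (db_schema d2) (db_rows d2) \<sigma>})"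
    by (rule inj_on_map_list) (auto simp: is_max_IND_def is_IND_def db_schema_def d intro: finite_subset)
  fix A assume "A \<in> {A. wa3ns_max_sat (ind_formula d) A}"
  then have "finite A" using finite_wa3ns_vars by (auto simp: wa3ns_max_sat_def intro: finite_subset)
  then have A: "set (sorted_list_of_set A) = A" by simp
  have dom: "dom (set_map d A) = {a \<in> set R. \<exists>b\<in>set S. natcode (a, b) \<in> A}"
    by (auto simp: set_map_def d split: if_splits)
  show "map (\<lambda>a. (a, pick (fst (snd d)) (set (sorted_list_of_set A)) a))
         (filter (\<lambda>a. \<exists>b\<in>set (fst (snd d)). natcode (a, b) \<in> set (sorted_list_of_set A)) (sorted_list_of_set (set (fst (fst d)))))
     = map_list (set_map d A)"
    unfolding A map_list_def dom by (simp add: d filter_sorted_list_of_set set_map_def)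
qed (simp_all add: codable_tnats codable_dbs_tree codable_wa3ns_tree codable_pairs_tree enc_natset_def enc_map_eq)

theorem theorem4:
  shows "parsimonious_reduction EnumMaxINDs EnumMaxINDsIdentity
       \<and> parsimonious_reduction EnumMaxINDsIdentity EnumMaxINDs
       \<and> parsimonious_reduction EnumMaxINDs EnumMaxSatWA3NS
       \<and> parsimonious_reduction EnumMaxSatWA3NS EnumMaxINDs
       \<and> parsimonious_reduction EnumMaxINDsIdentity EnumMaxSatWA3NS
       \<and> parsimonious_reduction EnumMaxSatWA3NS EnumMaxINDsIdentity
       \<and> parsimonious_reduction TransversalHypergraph EnumMaxINDs
       \<and> parsimonious_reduction TransversalHypergraph EnumMaxINDsIdentity
       \<and> parsimonious_reduction TransversalHypergraph EnumMaxSatWA3NS"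
  by (intro conjI pt_reduction_parsimonious)
    (blast intro: reduction_IND_WA3NS reduction_WA3NS_IND_id reduction_IND_id_IND
      reduction_TransversalHypergraph_WA3NS pt_reduction_trans)+

end
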